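(* Let $(R,\mathfrak{m},k)$ be a complete noetherian local domain of prime characteristic which is weakly normal, with algebraically closed residue field $k$. Then $\operatorname{depth}(R)\geq\min\{2,\dim R\}$. Moreover, $R$ satisfies $(S_2)$ provided $R$ is generalized Cohen--Macaulay.
   Context: $\overline{R}$ is the integral closure of $R$ in its total quotient ring $Q(R)$. An integral extension of rings $i:A\hookrightarrow B$ is weakly subintegral if it induces a bijection $\operatorname{Spec}(B)\to\operatorname{Spec}(A)$ and for each $\mathfrak{p}\in\operatorname{Spec}(B)$ the induced map of residue fields $k(i^{-1}(\mathfrak{p}))\to k(\mathfrak{p})$ is a purely inseparable field extension. ${}^{\ast}R$ is the unique largest subextension of $R$ in $\overline{R}$ such that $R\subset{}^{\ast}R$ is weakly subintegral; $R$ is weakly normal if $R={}^{\ast}R$. A local ring $(R,\mathfrak{m})$ is generalized Cohen--Macaulay if the local cohomology modules $H^i_{\mathfrak{m}}(R)$ have finite length for all $i<\dim R$. $(S_2)$ means $\operatorname{depth}(R_{\mathfrak{p}})\geq\min\{2,\operatorname{ht}(\mathfrak{p})\}$ for all $\mathfrak{p}\in\operatorname{Spec}(R)$. *)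

theory Defs
  imports "HOL-Algebra.Algebra" "HOL-Library.Extended_Nat"
begin

text \<open>All rings are commutative rings in the sense of HOL-Algebra (locale \<^locale>\<open>cring\<close>).\<close>

section \<open>Rings of fractions\<close>

text \<open>For a multiplicative set \<open>S\<close>, the fraction \<open>a/s\<close> is the class of \<open>(a, s)\<close> under
  \<open>(a, s) \<sim> (b, t) \<longleftrightarrow> (\<exists>u\<in>S. u (t a - s b) = 0)\<close>.\<close>

definition fraction :: "('a, 'm) ring_scheme \<Rightarrow> 'a set \<Rightarrow> 'a \<Rightarrow> 'a \<Rightarrow> ('a \<times> 'a) set" where
  "fraction R S a s =
     {(b, t). b \<in> carrier R \<and> t \<in> S \<and>
        (\<exists>u\<in>S. u \<otimes>\<^bsub>R\<^esub> (t \<otimes>\<^bsub>R\<^esub> a \<ominus>\<^bsub>R\<^esub> s \<otimes>\<^bsub>R\<^esub> b) = \<zero>\<^bsub>R\<^esub>)}"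

definition localization :: "('a, 'm) ring_scheme \<Rightarrow> 'a set \<Rightarrow> ('a \<times> 'a) set ring" where
  "localization R S =
     \<lparr> carrier = {fraction R S a s | a s. a \<in> carrier R \<and> s \<in> S},
       monoid.mult = (\<lambda>U V. \<Union>(a, s)\<in>U. \<Union>(b, t)\<in>V. fraction R S (a \<otimes>\<^bsub>R\<^esub> b) (s \<otimes>\<^bsub>R\<^esub> t)),
       one = fraction R S \<one>\<^bsub>R\<^esub> \<one>\<^bsub>R\<^esub>,
       ring.zero = fraction R S \<zero>\<^bsub>R\<^esub> \<one>\<^bsub>R\<^esub>,
       ring.add = (\<lambda>U V. \<Union>(a, s)\<in>U. \<Union>(b, t)\<in>V.
                fraction R S (t \<otimes>\<^bsub>R\<^esub> a \<oplus>\<^bsub>R\<^esub> s \<otimes>\<^bsub>R\<^esub> b) (s \<otimes>\<^bsub>R\<^esub> t)) \<rparr>"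

definition regular_elements :: "('a, 'm) ring_scheme \<Rightarrow> 'a set" where
  "regular_elements R =
     {s \<in> carrier R. \<forall>a\<in>carrier R. s \<otimes>\<^bsub>R\<^esub> a = \<zero>\<^bsub>R\<^esub> \<longrightarrow> a = \<zero>\<^bsub>R\<^esub>}"

definition total_quotient_ring :: "('a, 'm) ring_scheme \<Rightarrow> ('a \<times> 'a) set ring" where
  "total_quotient_ring R = localization R (regular_elements R)"

definition to_total_quotient_ring :: "('a, 'm) ring_scheme \<Rightarrow> 'a \<Rightarrow> ('a \<times> 'a) set" where
  "to_total_quotient_ring R a = fraction R (regular_elements R) a \<one>\<^bsub>R\<^esub>"

definition localization_at_prime :: "('a, 'm) ring_scheme \<Rightarrow> 'a set \<Rightarrow> ('a \<times> 'a) set ring" where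
  "localization_at_prime R p = localization R (carrier R - p)"


section \<open>Characteristic, local rings, completeness\<close>

definition ring_char :: "('a, 'm) ring_scheme \<Rightarrow> nat" where
  "ring_char R =
     (if \<exists>n::nat. n > 0 \<and> [n] \<cdot>\<^bsub>R\<^esub> \<one>\<^bsub>R\<^esub> = \<zero>\<^bsub>R\<^esub>
      then (LEAST n::nat. n > 0 \<and> [n] \<cdot>\<^bsub>R\<^esub> \<one>\<^bsub>R\<^esub> = \<zero>\<^bsub>R\<^esub>) else 0)"

definition local_ring :: "('a, 'm) ring_scheme \<Rightarrow> bool" where
  "local_ring R \<longleftrightarrow> cring R \<and> (\<exists>!m. maximalideal m R)"

definition max_ideal :: "('a, 'm) ring_scheme \<Rightarrow> 'a set" where
  "max_ideal R = (THE m. maximalideal m R)"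

abbreviation ideal_power :: "('a, 'm) ring_scheme \<Rightarrow> 'a set \<Rightarrow> nat \<Rightarrow> 'a set" where
  "ideal_power R I n \<equiv> I [^]\<^bsub>ideals_set R\<^esub> n"

text \<open>Bijectivity of the canonical map from \<open>R\<close> to the inverse limit of the \<open>R/I\<^sup>n\<close>: the
  elements of the limit are represented by sequences with \<open>x (n + 1) \<equiv> x n\<close> modulo \<open>I\<^sup>n\<close>.\<close>

definition adically_complete :: "('a, 'm) ring_scheme \<Rightarrow> 'a set \<Rightarrow> bool" where
  "adically_complete R I \<longleftrightarrow>
     (\<forall>x :: nat \<Rightarrow> 'a.
        (\<forall>n. x n \<in> carrier R) \<and> (\<forall>n. x (Suc n) \<ominus>\<^bsub>R\<^esub> x n \<in> ideal_power R I n) \<longrightarrow>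
        (\<exists>!r. r \<in> carrier R \<and> (\<forall>n. r \<ominus>\<^bsub>R\<^esub> x n \<in> ideal_power R I n)))"


section \<open>Weak normality\<close>

definition Spec :: "('a, 'm) ring_scheme \<Rightarrow> 'a set set" where
  "Spec R = {p. primeideal p R}"

text \<open>The residue field \<open>k(p)\<close> is the field of fractions of \<open>R/p\<close>;
  \<open>residue_fraction R p a s\<close> is the element \<open>(a + p)/(s + p)\<close>.\<close>

definition residue_field :: "('a, 'm) ring_scheme \<Rightarrow> 'a set \<Rightarrow> ('a set \<times> 'a set) set ring" where
  "residue_field R p = total_quotient_ring (R Quot p)"

definition residue_fraction ::
    "('a, 'm) ring_scheme \<Rightarrow> 'a set \<Rightarrow> 'a \<Rightarrow> 'a \<Rightarrow> ('a set \<times> 'a set) set" where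
  "residue_fraction R p a s =
     fraction (R Quot p) (regular_elements (R Quot p)) (p +>\<^bsub>R\<^esub> a) (p +>\<^bsub>R\<^esub> s)"

definition contraction :: "('a \<Rightarrow> 'b) \<Rightarrow> ('a, 'm) ring_scheme \<Rightarrow> 'b set \<Rightarrow> 'a set" where
  "contraction f A q = f -` q \<inter> carrier A"

text \<open>The map \<open>k(f\<^sup>-\<^sup>1 q) \<rightarrow> k(q)\<close> induced by a ring homomorphism \<open>f : A \<rightarrow> B\<close>; the value does
  not depend on the chosen numerator and denominator.\<close>

definition residue_map ::
    "('a \<Rightarrow> 'b) \<Rightarrow> ('a, 'm) ring_scheme \<Rightarrow> ('b, 'n) ring_scheme \<Rightarrow> 'b set \<Rightarrow>
     ('a set \<times> 'a set) set \<Rightarrow> ('b set \<times> 'b set) set" where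
  "residue_map f A B q u =
     (THE v. \<exists>a\<in>carrier A. \<exists>s\<in>carrier A - contraction f A q.
        u = residue_fraction A (contraction f A q) a s \<and>
        v = residue_fraction B q (f a) (f s))"

text \<open>\<open>max 1 (ring_char K)\<close> is the characteristic exponent, so in characteristic \<open>0\<close> this says
  that the extension is trivial.\<close>

definition purely_inseparable ::
    "('a, 'm) ring_scheme \<Rightarrow> ('b, 'n) ring_scheme \<Rightarrow> ('a \<Rightarrow> 'b) \<Rightarrow> bool" where
  "purely_inseparable F K h \<longleftrightarrow>
     field F \<and> field K \<and> h \<in> ring_hom F K \<and>
     (\<forall>x\<in>carrier K. \<exists>n::nat. x [^]\<^bsub>K\<^esub> (max 1 (ring_char K) ^ n) \<in> h ` carrier F)"

definition integral_element ::
    "('a \<Rightarrow> 'b) \<Rightarrow> ('a, 'm) ring_scheme \<Rightarrow> ('b, 'n) ring_scheme \<Rightarrow> 'b \<Rightarrow> bool" where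
  "integral_element f A B b \<longleftrightarrow>
     (\<exists>p\<in>carrier (poly_ring A). p \<noteq> [] \<and> lead_coeff p = \<one>\<^bsub>A\<^esub> \<and>
        ring.eval B (map f p) b = \<zero>\<^bsub>B\<^esub>)"

definition integral_extension ::
    "('a \<Rightarrow> 'b) \<Rightarrow> ('a, 'm) ring_scheme \<Rightarrow> ('b, 'n) ring_scheme \<Rightarrow> bool" where
  "integral_extension f A B \<longleftrightarrow>
     cring A \<and> cring B \<and> f \<in> ring_hom A B \<and> inj_on f (carrier A) \<and>
     (\<forall>b\<in>carrier B. integral_element f A B b)"

definition weakly_subintegral ::
    "('a \<Rightarrow> 'b) \<Rightarrow> ('a, 'm) ring_scheme \<Rightarrow> ('b, 'n) ring_scheme \<Rightarrow> bool" where
  "weakly_subintegral f A B \<longleftrightarrow>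
     integral_extension f A B \<and>
     bij_betw (contraction f A) (Spec B) (Spec A) \<and>
     (\<forall>q\<in>Spec B.
        purely_inseparable (residue_field A (contraction f A q)) (residue_field B q)
          (residue_map f A B q))"

definition integral_closure_in_quotients :: "('a, 'm) ring_scheme \<Rightarrow> ('a \<times> 'a) set set" where
  "integral_closure_in_quotients R =
     {x \<in> carrier (total_quotient_ring R).
        integral_element (to_total_quotient_ring R) R (total_quotient_ring R) x}"

definition weakly_subintegral_subextension ::
    "('a, 'm) ring_scheme \<Rightarrow> ('a \<times> 'a) set set \<Rightarrow> bool" where
  "weakly_subintegral_subextension R T \<longleftrightarrow>
     subring T (total_quotient_ring R) \<and>
     to_total_quotient_ring R ` carrier R \<subseteq> T \<and> T \<subseteq> integral_closure_in_quotients R \<and>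
     weakly_subintegral (to_total_quotient_ring R) R (total_quotient_ring R\<lparr>carrier := T\<rparr>)"

definition is_weak_normalization :: "('a, 'm) ring_scheme \<Rightarrow> ('a \<times> 'a) set set \<Rightarrow> bool" where
  "is_weak_normalization R T \<longleftrightarrow>
     weakly_subintegral_subextension R T \<and>
     (\<forall>T'. weakly_subintegral_subextension R T' \<longrightarrow> T' \<subseteq> T)"

definition weakly_normal :: "('a, 'm) ring_scheme \<Rightarrow> bool" where
  "weakly_normal R \<longleftrightarrow> is_weak_normalization R (to_total_quotient_ring R ` carrier R)"


section \<open>Dimension, depth, Serre's condition\<close>

text \<open>The supremum of the lengths \<open>n\<close> of chains \<open>c\<^sub>0 \<subset> c\<^sub>1 \<subset> \<dots> \<subset> c\<^sub>n\<close> in \<open>F\<close>.\<close>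

definition chain_length :: "'a set set \<Rightarrow> enat" where
  "chain_length F =
     Sup {enat n | n. \<exists>c :: nat \<Rightarrow> 'a set. (\<forall>i\<le>n. c i \<in> F) \<and> (\<forall>i<n. c i \<subset> c (Suc i))}"

definition krull_dim :: "('a, 'm) ring_scheme \<Rightarrow> enat" where
  "krull_dim R = chain_length (Spec R)"

definition height :: "('a, 'm) ring_scheme \<Rightarrow> 'a set \<Rightarrow> enat" where
  "height R p = chain_length {q \<in> Spec R. q \<subseteq> p}"

definition regular_sequence :: "('a, 'm) ring_scheme \<Rightarrow> 'a list \<Rightarrow> bool" where
  "regular_sequence R xs \<longleftrightarrow>
     set xs \<subseteq> carrier R \<and>
     (\<forall>i<length xs. \<forall>a\<in>carrier R.
        xs ! i \<otimes>\<^bsub>R\<^esub> a \<in> Idl\<^bsub>R\<^esub> (set (take i xs)) \<longrightarrow> a \<in> Idl\<^bsub>R\<^esub> (set (take i xs))) \<and>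
     Idl\<^bsub>R\<^esub> (set xs) \<noteq> carrier R"

definition depth :: "('a, 'm) ring_scheme \<Rightarrow> enat" where
  "depth R = Sup {enat (length xs) | xs. set xs \<subseteq> max_ideal R \<and> regular_sequence R xs}"

definition serre_S2 :: "('a, 'm) ring_scheme \<Rightarrow> bool" where
  "serre_S2 R \<longleftrightarrow> (\<forall>p\<in>Spec R. depth (localization_at_prime R p) \<ge> min 2 (height R p))"


section \<open>Local cohomology\<close>

text \<open>As in HOL-Algebra, the \<^const>\<open>monoid.mult\<close> and \<^const>\<open>one\<close> fields of a module record carry no
  meaning.\<close>

definition ring_as_module :: "('a, 'm) ring_scheme \<Rightarrow> ('a, 'a) module" where
  "ring_as_module R =
     \<lparr> carrier = carrier R, monoid.mult = monoid.mult R, one = \<one>\<^bsub>R\<^esub>, ring.zero = \<zero>\<^bsub>R\<^esub>, ring.add = ring.add R,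
       smult = monoid.mult R \<rparr>"

definition linear_maps ::
    "('a, 'm) ring_scheme \<Rightarrow> ('a, 'b, 'k) module_scheme \<Rightarrow> ('a, 'c, 'l) module_scheme \<Rightarrow>
     ('b \<Rightarrow> 'c) set" where
  "linear_maps R M N =
     {f \<in> carrier M \<rightarrow> carrier N.
        (\<forall>x\<in>carrier M. \<forall>y\<in>carrier M. f (x \<oplus>\<^bsub>M\<^esub> y) = f x \<oplus>\<^bsub>N\<^esub> f y) \<and>
        (\<forall>r\<in>carrier R. \<forall>x\<in>carrier M. f (r \<odot>\<^bsub>M\<^esub> x) = r \<odot>\<^bsub>N\<^esub> f x)}"

definition quotient_module :: "('a, 'b, 'k) module_scheme \<Rightarrow> 'b set \<Rightarrow> ('a, 'b set) module" where
  "quotient_module M N =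
     \<lparr> carrier = a_rcosets\<^bsub>M\<^esub> N, monoid.mult = undefined, one = undefined, ring.zero = N, ring.add = set_add M,
       smult = (\<lambda>r U. \<Union>x\<in>U. N +>\<^bsub>M\<^esub> (r \<odot>\<^bsub>M\<^esub> x)) \<rparr>"

definition module_length :: "('a, 'm) ring_scheme \<Rightarrow> ('a, 'b, 'k) module_scheme \<Rightarrow> enat" where
  "module_length R M = chain_length {N. submodule N R M}"

text \<open>The extension property is tested on inclusions \<open>A \<subseteq> B\<close> of modules whose elements have the
  type of the elements of \<open>R\<close>. These include the inclusions of the ideals of \<open>R\<close> into \<open>R\<close>, so by
  Baer's criterion the extension property then holds for all inclusions of modules.\<close>

definition injective_module :: "('a, 'm) ring_scheme \<Rightarrow> ('a, 'b, 'k) module_scheme \<Rightarrow> bool" where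
  "injective_module R E \<longleftrightarrow>
     module R E \<and>
     (\<forall>(B :: ('a, 'a) module) A. module R B \<and> submodule A R B \<longrightarrow>
        (\<forall>f\<in>linear_maps R (B\<lparr>carrier := A\<rparr>) E. \<exists>g\<in>linear_maps R B E. \<forall>x\<in>A. g x = f x))"

definition injective_resolution ::
    "('a, 'm) ring_scheme \<Rightarrow> ('a, 'b, 'k) module_scheme \<Rightarrow>
     ('b \<Rightarrow> 'c) \<Rightarrow> (nat \<Rightarrow> ('a, 'c) module) \<Rightarrow> (nat \<Rightarrow> 'c \<Rightarrow> 'c) \<Rightarrow> bool" where
  "injective_resolution R M e E d \<longleftrightarrow>
     (\<forall>i. injective_module R (E i)) \<and>
     e \<in> linear_maps R M (E 0) \<and> (\<forall>i. d i \<in> linear_maps R (E i) (E (Suc i))) \<and>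
     inj_on e (carrier M) \<and>
     e ` carrier M = {x \<in> carrier (E 0). d 0 x = \<zero>\<^bsub>E 1\<^esub>} \<and>
     (\<forall>i. d i ` carrier (E i) =
            {x \<in> carrier (E (Suc i)). d (Suc i) x = \<zero>\<^bsub>E (Suc (Suc i))\<^esub>})"

definition torsion :: "('a, 'm) ring_scheme \<Rightarrow> 'a set \<Rightarrow> ('a, 'b, 'k) module_scheme \<Rightarrow> 'b set" where
  "torsion R I M =
     {x \<in> carrier M. \<exists>n. \<forall>r\<in>ideal_power R I n. r \<odot>\<^bsub>M\<^esub> x = \<zero>\<^bsub>M\<^esub>}"

text \<open>\<open>H\<^sup>i\<^sub>I(M)\<close>, the \<open>i\<close>-th right derived functor of the \<open>I\<close>-torsion functor, computed from an
  injective resolution \<open>(E, d)\<close> of \<open>M\<close>.\<close>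

definition cocycles ::
    "('a, 'm) ring_scheme \<Rightarrow> 'a set \<Rightarrow> (nat \<Rightarrow> ('a, 'c) module) \<Rightarrow> (nat \<Rightarrow> 'c \<Rightarrow> 'c) \<Rightarrow>
     nat \<Rightarrow> 'c set" where
  "cocycles R I E d i = {x \<in> torsion R I (E i). d i x = \<zero>\<^bsub>E (Suc i)\<^esub>}"

definition coboundaries ::
    "('a, 'm) ring_scheme \<Rightarrow> 'a set \<Rightarrow> (nat \<Rightarrow> ('a, 'c) module) \<Rightarrow> (nat \<Rightarrow> 'c \<Rightarrow> 'c) \<Rightarrow>
     nat \<Rightarrow> 'c set" where
  "coboundaries R I E d i =
     (case i of 0 \<Rightarrow> {\<zero>\<^bsub>E 0\<^esub>} | Suc j \<Rightarrow> d j ` torsion R I (E j))"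

definition local_cohomology ::
    "('a, 'm) ring_scheme \<Rightarrow> 'a set \<Rightarrow> (nat \<Rightarrow> ('a, 'c) module) \<Rightarrow> (nat \<Rightarrow> 'c \<Rightarrow> 'c) \<Rightarrow>
     nat \<Rightarrow> ('a, 'c set) module" where
  "local_cohomology R I E d i =
     quotient_module (E i\<lparr>carrier := cocycles R I E d i\<rparr>) (coboundaries R I E d i)"

text \<open>A definition cannot quantify over types, so the type \<open>'c\<close> carrying the injective resolution is
  a parameter. Local cohomology does not depend on the resolution, hence the predicate is the usual
  one for every \<open>'c\<close> that carries an injective resolution of \<open>R\<close>; for noetherian \<open>R\<close> the type of
  lists over the elements of \<open>R\<close> is large enough. For smaller \<open>'c\<close> the predicate is false, so a
  theorem that assumes it should keep \<open>'c\<close> arbitrary.\<close>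

definition generalized_cohen_macaulay :: "'c itself \<Rightarrow> ('a, 'm) ring_scheme \<Rightarrow> bool" where
  "generalized_cohen_macaulay (_ :: 'c itself) R \<longleftrightarrow>
     local_ring R \<and>
     (\<exists>(e :: 'a \<Rightarrow> 'c) E d. injective_resolution R (ring_as_module R) e E d \<and>
        (\<forall>i. enat i < krull_dim R \<longrightarrow>
           module_length R (local_cohomology R (max_ideal R) E d i) < \<infinity>))"

end

theory Submission
  imports Defs
begin

text \<open>
  Write \<open>m\<close> for the maximal ideal, \<open>k\<close> for the residue field, \<open>Q\<close> for the field of fractions and \<open>p\<close>
  for the characteristic. Let \<open>P\<close> be a prime of height at least two, and let
  \<open>x \<in> P\<close> be nonzero. If \<open>R\<^sub>P\<close> has depth less than two, then \<open>P\<close> consists of zero divisors modulo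
  \<open>x\<close> after localization, and prime avoidance produces one element \<open>b\<close> with \<open>(xR : b) = P\<close>
  (\<open>localization_depth_2_or_colon\<close>). Both assertions of the theorem say that no such \<open>b\<close> exists.

  Suppose \<open>P = m\<close>, and put \<open>z = b/x\<close>, so that \<open>z\<close> is not in \<open>R\<close> but \<open>m z \<subseteq> R\<close>. If \<open>m z\<close> contained a unit,
  then \<open>m\<close> would be principal and \<open>R\<close> would have dimension at most one. Hence \<open>m z \<subseteq> m\<close>, and \<open>z\<close> lies in
  the ring \<open>S = (m : m)\<close>, a subring of \<open>Q\<close> that is integral over \<open>R\<close> and has \<open>m\<close> as an ideal. An idempotent of \<open>S/m\<close>
  lifts to \<open>S\<close>, because \<open>R\<close> is complete and because the powers \<open>e\<^bsup>p^n\<^esup>\<close> form a Cauchy sequence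
  (\<open>idempotent_mod_M\<close>); as \<open>S\<close> is a domain, \<open>S/m\<close> has no idempotents except 0 and 1. So every element of
  \<open>S/m\<close> is nilpotent or a unit, and since \<open>k\<close> is algebraically closed, \<open>z - c\<close> is nilpotent modulo
  \<open>m\<close> for some \<open>c \<in> R\<close>. Then a power of \<open>z - c\<close> with exponent \<open>p^n\<close> lies in \<open>R\<close>. The elements of
  \<open>Q\<close> with such a power in \<open>R\<close> form a weakly subintegral extension
  (\<open>root_closure_weakly_subintegral\<close>), so weak normality gives \<open>z \<in> R\<close> (\<open>S_subset_image\<close>),
  a contradiction.

  Suppose \<open>P \<noteq> m\<close>. Multiplication by \<open>b/x\<close> defines a class in \<open>Ext\<^sup>1(R/P, R)\<close> with annihilator exactly \<open>P\<close>. Nakayama's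
  lemma moves such classes upwards: a class with annihilator \<open>P\<close> in \<open>Ext\<^sup>i(R/P, R)\<close> and a prime
  strictly between \<open>P\<close> and \<open>m\<close> yield a class with annihilator \<open>P'\<close> in \<open>Ext\<^bsup>i+1\<^esup>(R/P', R)\<close> for some prime
  \<open>P' \<supset> P\<close> other than \<open>m\<close> (\<open>survives_at_step\<close>). After finitely many steps there is no prime between
  \<open>P\<close> and \<open>m\<close>, and the chain of primes that was built shows \<open>i + 1 < dim R\<close>. Choose \<open>a \<in> m\<close>
  outside \<open>P\<close>. As \<open>H\<^sup>j\<^sub>m(R)\<close> has finite length for \<open>j \<le> i + 1\<close>, one power \<open>a^N\<close> kills
  \<open>Ext\<^bsup>i+1\<^esup>(R/(P + a\<^sup>n), R)\<close> for every \<open>n\<close>; the connecting maps then give \<open>a^N X \<subseteq> a\<^bsup>N+1\<^esup> X\<close> for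
  \<open>X = Ext\<^sup>i(R/P, R)\<close>, so that \<open>a^N X = 0\<close> by Nakayama's lemma, although the class has annihilator \<open>P\<close>
  (\<open>survives_at_annihilator_contradiction\<close>).

  All of this homological algebra is done with elements of a fixed injective resolution: \<open>Ext\<^sup>i(R/J, R)\<close> is
  the cohomology of the elements killed by \<open>J\<close>, local cohomology is that of the \<open>m\<close>-torsion
  elements, and the one property of injective modules that is needed is the solvability of \<open>y e' = e\<close> with
  \<open>J e' = 0\<close> whenever \<open>(J : y) e = 0\<close>. The torsion subcomplex inherits this property.
\<close>

section \<open>Ideals of Noetherian rings\<close>

definition colon :: "('a, 'm) ring_scheme \<Rightarrow> 'a set \<Rightarrow> 'a \<Rightarrow> 'a set" where
  "colon R J y = {r \<in> carrier R. r \<otimes>\<^bsub>R\<^esub> y \<in> J}"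

definition adjoin :: "('a, 'm) ring_scheme \<Rightarrow> 'a set \<Rightarrow> 'a \<Rightarrow> 'a set" where
  "adjoin R J y = {j \<oplus>\<^bsub>R\<^esub> r \<otimes>\<^bsub>R\<^esub> y | j r. j \<in> J \<and> r \<in> carrier R}"

context cring
begin

lemma ideal_minus_closed:
  "ideal I R \<Longrightarrow> a \<in> I \<Longrightarrow> b \<in> I \<Longrightarrow> a \<ominus> b \<in> I"
  unfolding a_minus_def
  by (meson additive_subgroup.a_closed additive_subgroup.a_inv_closed ideal.axioms(1))

lemma ideal_closed:
  assumes "ideal I R"
  shows "\<zero> \<in> I" "\<And>a. a \<in> I \<Longrightarrow> a \<in> carrier R" "\<And>a b. a \<in> I \<Longrightarrow> b \<in> I \<Longrightarrow> a \<oplus> b \<in> I"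
    "\<And>a. a \<in> I \<Longrightarrow> \<ominus> a \<in> I" "\<And>a b. a \<in> I \<Longrightarrow> b \<in> carrier R \<Longrightarrow> a \<otimes> b \<in> I"
    "\<And>a b. a \<in> I \<Longrightarrow> b \<in> carrier R \<Longrightarrow> b \<otimes> a \<in> I"
    "\<And>a b. a \<in> I \<Longrightarrow> b \<in> I \<Longrightarrow> a \<ominus> b \<in> I"
  using assms ideal.Icarr[OF assms] ideal.I_l_closed[OF assms] ideal.I_r_closed[OF assms]
    ideal_minus_closed[OF assms]
    additive_subgroup.zero_closed[OF ideal.axioms(1)[OF assms]]
    additive_subgroup.a_closed[OF ideal.axioms(1)[OF assms]]
    additive_subgroup.a_inv_closed[OF ideal.axioms(1)[OF assms]]
  by auto

lemma idealI_cring: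
  assumes "I \<subseteq> carrier R" "\<zero> \<in> I" "\<And>a b. a \<in> I \<Longrightarrow> b \<in> I \<Longrightarrow> a \<oplus> b \<in> I"
    "\<And>a r. a \<in> I \<Longrightarrow> r \<in> carrier R \<Longrightarrow> r \<otimes> a \<in> I"
  shows "ideal I R"
proof (rule idealI)
  show "ring R" by (rule ring_axioms)
  have inv: "\<ominus> a \<in> I" if "a \<in> I" for a
  proof -
    have "\<ominus> a = (\<ominus> \<one>) \<otimes> a" using that assms(1) by (simp add: l_minus subset_iff)
    then show ?thesis using assms(4)[OF that, of "\<ominus> \<one>"] by simp
  qed
  show "subgroup I (add_monoid R)"
    using assms inv by unfold_locales (auto simp: a_inv_def)
  show "\<And>a x. a \<in> I \<Longrightarrow> x \<in> carrier R \<Longrightarrow> x \<otimes> a \<in> I" by (rule assms(4))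
  show "\<And>a x. a \<in> I \<Longrightarrow> x \<in> carrier R \<Longrightarrow> a \<otimes> x \<in> I"
    using assms(1,4) by (metis m_comm subsetD)
qed

lemma colon_ideal:
  assumes "ideal J R" "y \<in> carrier R"
  shows "ideal (colon R J y) R"
  by (rule idealI_cring)
     (use assms in \<open>auto simp: colon_def ideal_closed[OF assms(1)] l_distr m_assoc\<close>)

lemma colon_superset: "ideal J R \<Longrightarrow> y \<in> carrier R \<Longrightarrow> J \<subseteq> colon R J y"
  by (auto simp: colon_def ideal_closed)

lemma adjoin_ideal:
  assumes "ideal J R" "y \<in> carrier R"
  shows "ideal (adjoin R J y) R"
proof -
  have "adjoin R J y = J <+> PIdl y"
    by (auto simp: adjoin_def set_add_def' cgenideal_def)
  then show ?thesis using add_ideals[OF assms(1) cgenideal_ideal[OF assms(2)]] by simp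
qed

lemma adjoin_superset:
  assumes "ideal J R" "y \<in> carrier R"
  shows "J \<subseteq> adjoin R J y" "y \<in> adjoin R J y"
proof -
  show "J \<subseteq> adjoin R J y"
  proof
    fix j assume "j \<in> J"
    then show "j \<in> adjoin R J y" unfolding adjoin_def
      using assms ideal_closed(2)[OF assms(1)] by (intro CollectI exI[of _ j] exI[of _ \<zero>]) auto
  qed
  show "y \<in> adjoin R J y" unfolding adjoin_def
    using assms ideal_closed(1)[OF assms(1)] by (intro CollectI exI[of _ \<zero>] exI[of _ \<one>]) auto
qed

lemma adjoin_least:
  assumes "ideal K R" "J \<subseteq> K" "y \<in> K"
  shows "adjoin R J y \<subseteq> K"
  using assms by (auto simp: adjoin_def ideal_closed[OF assms(1)] subset_iff)

lemma genideal_insert: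
  assumes "A \<subseteq> carrier R" "y \<in> carrier R"
  shows "Idl (insert y A) = adjoin R (Idl A) y"
proof
  have iA: "ideal (Idl A) R" by (rule genideal_ideal[OF assms(1)])
  show "Idl (insert y A) \<subseteq> adjoin R (Idl A) y"
    using assms adjoin_superset[OF iA assms(2)] genideal_self[OF assms(1)]
    by (intro genideal_minimal adjoin_ideal[OF iA assms(2)]) auto
  have iB: "ideal (Idl (insert y A)) R" using assms by (intro genideal_ideal) auto
  have "insert y A \<subseteq> Idl (insert y A)" using assms by (intro genideal_self) auto
  then show "adjoin R (Idl A) y \<subseteq> Idl (insert y A)"
    by (intro adjoin_least[OF iB] genideal_minimal[OF iB]) auto
qed

lemma genideal_empty: "Idl {} = {\<zero>}"
  using genideal_minimal[OF zeroideal, of "{}"] ideal_closed(1)[OF genideal_ideal[of "{}"]] by auto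

lemma ideal_power_simps:
  "ideal_power R I 0 = carrier R" "ideal_power R I (Suc n) = ideal_prod R (ideal_power R I n) I"
  by (simp_all add: ideals_set_def)

lemma ideal_power_ideal: "ideal I R \<Longrightarrow> ideal (ideal_power R I n) R"
  by (induction n) (simp_all only: ideal_power_simps oneideal ideal_prod_is_ideal)

lemma ideal_power_add:
  assumes "ideal I R"
  shows "ideal_power R I (m + n) = ideal_prod R (ideal_power R I m) (ideal_power R I n)"
proof -
  interpret S: comm_monoid "ideals_set R" by (rule ideals_set_is_comm_monoid)
  have "I \<in> carrier (ideals_set R)" using assms by (simp add: ideals_set_def)
  from S.nat_pow_mult[OF this, of m n] show ?thesis by (simp add: ideals_set_def)
qed

lemma ideal_prod_subset:
  assumes "ideal K R" "\<And>i j. i \<in> I \<Longrightarrow> j \<in> J \<Longrightarrow> i \<otimes> j \<in> K"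
  shows "ideal_prod R I J \<subseteq> K"
proof
  fix x assume "x \<in> ideal_prod R I J"
  then show "x \<in> K" by induction (auto simp: assms ideal_closed[OF assms(1)])
qed

lemma ideal_power_Suc_subset:
  assumes "ideal I R" shows "ideal_power R I (Suc n) \<subseteq> ideal_power R I n"
  unfolding ideal_power_simps
  by (rule ideal_prod_subset[OF ideal_power_ideal[OF assms]])
     (auto simp: ideal_closed[OF ideal_power_ideal[OF assms]] ideal_closed[OF assms])

lemma ideal_power_antimono:
  assumes "ideal I R" "m \<le> n" shows "ideal_power R I n \<subseteq> ideal_power R I m"
  using assms(2) by (induction rule: dec_induct) (use ideal_power_Suc_subset[OF assms(1)] in auto)

lemma pow_in_ideal_power:
  assumes "ideal I R" "a \<in> I" shows "a [^] (n::nat) \<in> ideal_power R I n"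
proof (induction n)
  case 0
  show ?case by (simp only: ideal_power_simps nat_pow_0 one_closed)
next
  case (Suc n)
  then show ?case unfolding ideal_power_simps nat_pow_Suc by (rule ideal_prod.prod[OF _ assms(2)])
qed

lemma primeideal_pow:
  assumes "primeideal P R" "a \<in> carrier R" "a [^] (n::nat) \<in> P" shows "a \<in> P"
  using assms(3)
proof (induction n)
  case 0
  interpret P: primeideal P R by fact
  show ?case using 0 P.one_imp_carrier P.I_notcarr by auto
next
  case (Suc n)
  interpret P: primeideal P R by fact
  show ?case using Suc P.I_prime[of "a [^] n" a] assms(2) by auto
qed

lemma primeideal_prod_notin:
  assumes "primeideal P R" "a \<in> carrier R - P" "b \<in> carrier R - P"
  shows "a \<otimes> b \<in> carrier R - P"
  using primeideal.I_prime[OF assms(1), of a b] assms(2,3) by auto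

lemma primeideal_one_notin: "primeideal P R \<Longrightarrow> \<one> \<notin> P"
  using ideal.one_imp_carrier[OF primeideal.axioms(1)] primeideal.I_notcarr[of P R] by auto

end

context noetherian_ring
begin

text \<open>The ascending chain condition in the form in which it is used throughout: every nonempty family of ideals
  has a maximal member. Most choices of a prime ideal below are instances of it.\<close>

lemma ideal_maximal_element:
  assumes "A \<noteq> {}" "\<And>I. I \<in> A \<Longrightarrow> ideal I R"
  shows "\<exists>M\<in>A. \<forall>I\<in>A. M \<subseteq> I \<longrightarrow> I = M"
proof -
  show ?thesis
  proof (rule subset_Zorn_nonempty[OF assms(1)])
    fix C assume C: "C \<noteq> {}" "subset.chain A C"
    then have "subset.chain {I. ideal I R} C"
      using assms(2) by (auto simp: subset_chain_def)
    from ideal_chain_is_trivial[OF C(1) this] show "\<Union>C \<in> A"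
      using C(2) by (auto simp: subset_chain_def)
  qed
qed

lemma ideal_sequence_stabilizes:
  assumes "\<And>n. ideal (I n) R" "\<And>n. I n \<subseteq> I (Suc n)"
  shows "\<exists>n. \<forall>m\<ge>n. I m = I n"
proof -
  have "\<exists>M\<in>range I. \<forall>J\<in>range I. M \<subseteq> J \<longrightarrow> J = M"
    by (rule ideal_maximal_element) (use assms(1) in auto)
  then obtain n where n: "\<And>m. I n \<subseteq> I m \<Longrightarrow> I m = I n" by auto
  have "I m = I n" if "m \<ge> n" for m
    by (rule n, rule lift_Suc_mono_le[of I, OF assms(2) that])
  then show ?thesis by blast
qed

end

locale noetherian_cring = noetherian_ring + cring

context noetherian_cring
begin

text \<open>An ideal that is not prime contains the product of two strictly larger ideals, so by Noetherian
  induction every ideal contains a product of primes above it. It follows that an ideal whose only prime is \<open>m\<close> contains a power of \<open>m\<close>.\<close>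

lemma ideal_power_subset_of_primes:
  assumes m: "ideal m R" and J: "ideal J R"
    and primes: "\<And>P. primeideal P R \<Longrightarrow> J \<subseteq> P \<Longrightarrow> m \<subseteq> P"
  shows "\<exists>s. ideal_power R m s \<subseteq> J"
proof (rule ccontr)
  define A where "A = {K. ideal K R \<and> J \<subseteq> K \<and> \<not> (\<exists>s. ideal_power R m s \<subseteq> K)}"
  assume "\<not> ?thesis"
  then have "A \<noteq> {}" using J by (auto simp: A_def)
  moreover have "\<And>I. I \<in> A \<Longrightarrow> ideal I R" by (auto simp: A_def)
  ultimately obtain K where K: "K \<in> A" "\<And>I. I \<in> A \<Longrightarrow> K \<subseteq> I \<Longrightarrow> I = K"
    using ideal_maximal_element[of A] by blast
  then have iK: "ideal K R" and JK: "J \<subseteq> K" and no: "\<And>s. \<not> ideal_power R m s \<subseteq> K"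
    by (auto simp: A_def)
  \<comment> \<open>By the choice of \<open>K\<close>, adjoining any new element produces an ideal that contains a power of \<open>m\<close>.\<close>
  have big: "\<exists>s. ideal_power R m s \<subseteq> adjoin R K a" if "a \<in> carrier R" "a \<notin> K" for a
  proof -
    have "adjoin R K a \<notin> A"
      using K(2)[of "adjoin R K a"] adjoin_superset[OF iK that(1)] that(2) by auto
    then show ?thesis
      using adjoin_ideal[OF iK that(1)] adjoin_superset(1)[OF iK that(1)] JK by (auto simp: A_def)
  qed
  have "primeideal K R"
  proof (rule primeidealI[OF iK is_cring])
    show "carrier R \<noteq> K" using no[of 0] unfolding ideal_power_simps by auto
    fix a b assume ab: "a \<in> carrier R" "b \<in> carrier R" "a \<otimes> b \<in> K"
    show "a \<in> K \<or> b \<in> K"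
    proof (rule ccontr)
      assume "\<not> ?thesis"
      then obtain s t where st: "ideal_power R m s \<subseteq> adjoin R K a" "ideal_power R m t \<subseteq> adjoin R K b"
        using big ab by meson
      have "ideal_power R m (s + t) \<subseteq> K"
        unfolding ideal_power_add[OF m]
      proof (rule ideal_prod_subset[OF iK])
        fix i j assume "i \<in> ideal_power R m s" "j \<in> ideal_power R m t"
        then have "i \<in> adjoin R K a" "j \<in> adjoin R K b" using st by auto
        then obtain k r k' r' where k: "k \<in> K" "r \<in> carrier R" "k' \<in> K" "r' \<in> carrier R"
          "i = k \<oplus> r \<otimes> a" "j = k' \<oplus> r' \<otimes> b" by (auto simp: adjoin_def)
        have kc: "k \<in> carrier R" "k' \<in> carrier R" using k ideal_closed[OF iK] by auto
        have "i \<otimes> j = k \<otimes> j \<oplus> r \<otimes> a \<otimes> k' \<oplus> (r \<otimes> r') \<otimes> (a \<otimes> b)"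
          unfolding k(5,6) using k(2,4) kc ab(1,2)
          by (simp add: l_distr r_distr m_assoc m_lcomm[of a] a_assoc a_lcomm)
        moreover have "j \<in> carrier R" using k kc ab by auto
        ultimately show "i \<otimes> j \<in> K"
          using k ab by (simp add: ideal_closed[OF iK])
      qed
      then show False using no by blast
    qed
  qed
  then have "m \<subseteq> K" using primes JK by blast
  moreover have "ideal_power R m (Suc 0) = ideal_prod R (carrier R) m"
    unfolding ideal_power_simps ..
  moreover have "\<dots> = m" 
    using ideal_prod_commute[OF oneideal m] ideal_prod_one[OF m] by simp
  ultimately have "ideal_power R m (Suc 0) \<subseteq> K" by (simp only:)
  then show False by (rule no[THEN notE])
qed

lemma ideal_power_subset_of_nilpotent:
  assumes m: "ideal m R" and J: "ideal J R" and nil: "\<And>r. r \<in> m \<Longrightarrow> \<exists>n::nat. r [^] n \<in> J"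
  shows "\<exists>s. ideal_power R m s \<subseteq> J"
proof (rule ideal_power_subset_of_primes[OF m J])
  fix P assume P: "primeideal P R" "J \<subseteq> P"
  show "m \<subseteq> P"
  proof
    fix r assume "r \<in> m"
    then obtain n :: nat where "r [^] n \<in> P" using nil[OF \<open>r \<in> m\<close>] P(2) by auto
    then show "r \<in> P" using primeideal_pow[OF P(1) ideal_closed(2)[OF m \<open>r \<in> m\<close>]] by simp
  qed
qed

end

section \<open>Ext groups of cyclic modules, element by element\<close>

lemma (in module) submoduleI_cring:
  assumes "H \<subseteq> carrier M" "\<zero>\<^bsub>M\<^esub> \<in> H" "\<And>a b. a \<in> H \<Longrightarrow> b \<in> H \<Longrightarrow> a \<oplus>\<^bsub>M\<^esub> b \<in> H"
    "\<And>a x. a \<in> carrier R \<Longrightarrow> x \<in> H \<Longrightarrow> a \<odot>\<^bsub>M\<^esub> x \<in> H"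
  shows "submodule H R M"
proof (rule submoduleI[OF assms(1,2) _ assms(3,4)])
  fix a assume a: "a \<in> H"
  then have "\<ominus>\<^bsub>M\<^esub> a = (\<ominus> \<one>) \<odot>\<^bsub>M\<^esub> a" using assms(1) smult_l_minus[of \<one> a] by auto
  then show "\<ominus>\<^bsub>M\<^esub> a \<in> H" using assms(4)[OF _ a, of "\<ominus> \<one>"] by simp
qed

lemma (in module) submodule_closed:
  assumes "submodule H R M"
  shows "\<zero>\<^bsub>M\<^esub> \<in> H" "\<And>a. a \<in> H \<Longrightarrow> a \<in> carrier M"
    "\<And>a b. a \<in> H \<Longrightarrow> b \<in> H \<Longrightarrow> a \<oplus>\<^bsub>M\<^esub> b \<in> H"
    "\<And>a b. a \<in> H \<Longrightarrow> b \<in> H \<Longrightarrow> a \<ominus>\<^bsub>M\<^esub> b \<in> H"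
    "\<And>r a. r \<in> carrier R \<Longrightarrow> a \<in> H \<Longrightarrow> r \<odot>\<^bsub>M\<^esub> a \<in> H"
proof -
  have "subgroup H (add_monoid M)" using assms by (simp add: submodule_def)
  then show "\<zero>\<^bsub>M\<^esub> \<in> H" using subgroup.one_closed by fastforce
qed (use submoduleE[OF assms] in \<open>auto simp: a_minus_def\<close>)

lemma (in abelian_group) minus_self_eq_zero: "a \<in> carrier G \<Longrightarrow> a \<ominus> a = \<zero>"
  by (simp add: minus_eq r_neg)

lemma (in abelian_group) eq_of_minus_eq_zero:
  "a \<in> carrier G \<Longrightarrow> b \<in> carrier G \<Longrightarrow> a \<ominus> b = \<zero> \<Longrightarrow> a = b"
  by (metis a_inv_closed a_minus_def minus_equality minus_minus)

lemma (in abelian_group) minus_add_cancel: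
  "a \<in> carrier G \<Longrightarrow> b \<in> carrier G \<Longrightarrow> (a \<ominus> b) \<oplus> b = a" "a \<in> carrier G \<Longrightarrow> b \<in> carrier G \<Longrightarrow> a \<oplus> b \<ominus> b = a"
  by (simp_all add: minus_eq a_assoc l_neg r_neg)

lemma (in module) smult_minus_distr:
  "\<lbrakk>r \<in> carrier R; x \<in> carrier M; y \<in> carrier M\<rbrakk> \<Longrightarrow> r \<odot>\<^bsub>M\<^esub> (x \<ominus>\<^bsub>M\<^esub> y) = r \<odot>\<^bsub>M\<^esub> x \<ominus>\<^bsub>M\<^esub> r \<odot>\<^bsub>M\<^esub> y"
  by (simp add: a_minus_def smult_r_distr smult_r_minus)

lemma (in module) smult_minus_distl:
  "\<lbrakk>r \<in> carrier R; s \<in> carrier R; x \<in> carrier M\<rbrakk> \<Longrightarrow> (r \<ominus> s) \<odot>\<^bsub>M\<^esub> x = r \<odot>\<^bsub>M\<^esub> x \<ominus>\<^bsub>M\<^esub> s \<odot>\<^bsub>M\<^esub> x"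
  by (simp add: a_minus_def smult_l_distr smult_l_minus)

lemma (in module) smult_lcomm:
  "\<lbrakk>r \<in> carrier R; s \<in> carrier R; x \<in> carrier M\<rbrakk> \<Longrightarrow> r \<odot>\<^bsub>M\<^esub> (s \<odot>\<^bsub>M\<^esub> x) = s \<odot>\<^bsub>M\<^esub> (r \<odot>\<^bsub>M\<^esub> x)"
  by (metis smult_assoc1 m_comm)

text \<open>The complexes for which \<open>G i\<close> behaves like an injective module as far as cyclic modules are concerned:
  the last assumption says that a homomorphism to \<open>G i\<close> from the submodule of \<open>R/J\<close> generated by \<open>y\<close>, which is
  isomorphic to \<open>R/(J : y)\<close>, extends to \<open>R/J\<close>. It is satisfied by an injective resolution and by its
  torsion subcomplex.\<close>

locale divisible_complex = noetherian_cring +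
  fixes G :: "nat \<Rightarrow> ('a, 'c) module" and d :: "nat \<Rightarrow> 'c \<Rightarrow> 'c"
  assumes mod: "module R (G i)"
    and d_linear: "d i \<in> linear_maps R (G i) (G (Suc i))"
    and d_d: "x \<in> carrier (G i) \<Longrightarrow> d (Suc i) (d i x) = \<zero>\<^bsub>G (Suc (Suc i))\<^esub>"
    and divisible: "\<lbrakk>ideal J R; y \<in> carrier R; e \<in> carrier (G i);
        \<And>r. r \<in> colon R J y \<Longrightarrow> r \<odot>\<^bsub>G i\<^esub> e = \<zero>\<^bsub>G i\<^esub>\<rbrakk>
      \<Longrightarrow> \<exists>e'\<in>carrier (G i). (\<forall>r\<in>J. r \<odot>\<^bsub>G i\<^esub> e' = \<zero>\<^bsub>G i\<^esub>) \<and> y \<odot>\<^bsub>G i\<^esub> e' = e"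

sublocale divisible_complex \<subseteq> M: module R "G i" for i
  by (rule mod)

context divisible_complex
begin

text \<open>The module \<open>Hom(R/J, G i)\<close>, a homomorphism being identified with the image of 1. Accordingly
  \<open>Z J i\<close> and \<open>B J i\<close>, defined next, are the cocycles and coboundaries of the complex \<open>Hom(R/J, G)\<close>; their quotient
  is written \<open>Ext\<^sup>i(R/J)\<close> in the comments.\<close>

definition kill :: "'a set \<Rightarrow> nat \<Rightarrow> 'c set" where
  "kill J i = {e \<in> carrier (G i). \<forall>r\<in>J. r \<odot>\<^bsub>G i\<^esub> e = \<zero>\<^bsub>G i\<^esub>}"

definition Z :: "'a set \<Rightarrow> nat \<Rightarrow> 'c set" where
  "Z J i = {e \<in> kill J i. d i e = \<zero>\<^bsub>G (Suc i)\<^esub>}"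

definition B :: "'a set \<Rightarrow> nat \<Rightarrow> 'c set" where
  "B J i = (case i of 0 \<Rightarrow> {\<zero>\<^bsub>G 0\<^esub>} | Suc k \<Rightarrow> d k ` kill J k)"

lemma B_simps: "B J 0 = {\<zero>\<^bsub>G 0\<^esub>}" "B J (Suc k) = d k ` kill J k"
  by (simp_all add: B_def)

lemma d_closed [simp]: "x \<in> carrier (G i) \<Longrightarrow> d i x \<in> carrier (G (Suc i))"
  using d_linear[of i] by (auto simp: linear_maps_def)

lemma d_add: "x \<in> carrier (G i) \<Longrightarrow> y \<in> carrier (G i) \<Longrightarrow> d i (x \<oplus>\<^bsub>G i\<^esub> y) = d i x \<oplus>\<^bsub>G (Suc i)\<^esub> d i y"
  using d_linear[of i] by (auto simp: linear_maps_def)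

lemma d_smult: "r \<in> carrier R \<Longrightarrow> x \<in> carrier (G i) \<Longrightarrow> d i (r \<odot>\<^bsub>G i\<^esub> x) = r \<odot>\<^bsub>G (Suc i)\<^esub> d i x"
  using d_linear[of i] by (auto simp: linear_maps_def)

lemma d_zero [simp]: "d i \<zero>\<^bsub>G i\<^esub> = \<zero>\<^bsub>G (Suc i)\<^esub>"
  using d_smult[of \<zero> "\<zero>\<^bsub>G i\<^esub>" i] by simp

lemma d_minus: "x \<in> carrier (G i) \<Longrightarrow> y \<in> carrier (G i) \<Longrightarrow> d i (x \<ominus>\<^bsub>G i\<^esub> y) = d i x \<ominus>\<^bsub>G (Suc i)\<^esub> d i y"
proof -
  assume x: "x \<in> carrier (G i)" and y: "y \<in> carrier (G i)"
  have "\<ominus>\<^bsub>G i\<^esub> y = (\<ominus> \<one>) \<odot>\<^bsub>G i\<^esub> y" "\<ominus>\<^bsub>G (Suc i)\<^esub> d i y = (\<ominus> \<one>) \<odot>\<^bsub>G (Suc i)\<^esub> d i y"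
    using y by (simp_all add: M.smult_l_minus)
  then show ?thesis using x y d_smult[of "\<ominus> \<one>" y i] by (simp add: a_minus_def d_add)
qed

lemma kill_submodule: "J \<subseteq> carrier R \<Longrightarrow> submodule (kill J i) R (G i)"
  by (rule M.submoduleI_cring) (auto simp: kill_def M.smult_r_distr M.smult_lcomm subset_iff)

lemma Z_submodule: "J \<subseteq> carrier R \<Longrightarrow> submodule (Z J i) R (G i)"
  using M.submodule_closed[OF kill_submodule[of J i]]
  by (intro M.submoduleI_cring) (auto simp: Z_def d_add d_smult)

lemma B_submodule: "J \<subseteq> carrier R \<Longrightarrow> submodule (B J i) R (G i)"
proof (cases i)
  case (Suc k)
  assume J: "J \<subseteq> carrier R"
  note c = M.submodule_closed[OF kill_submodule[OF J, of k]]
  show ?thesis unfolding Suc B_simps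
  proof (rule M.submoduleI_cring)
    show "d k ` kill J k \<subseteq> carrier (G (Suc k))" using c by auto
    show "\<zero>\<^bsub>G (Suc k)\<^esub> \<in> d k ` kill J k" using c(1) d_zero[of k] by (metis imageI)
    fix a b r assume a: "a \<in> d k ` kill J k"
    then obtain x where x: "x \<in> kill J k" "a = d k x" by auto
    then show "r \<in> carrier R \<Longrightarrow> r \<odot>\<^bsub>G (Suc k)\<^esub> a \<in> d k ` kill J k"
      using c d_smult[of r x k] by (metis imageI)
    assume "b \<in> d k ` kill J k"
    then obtain y where y: "y \<in> kill J k" "b = d k y" by auto
    then show "a \<oplus>\<^bsub>G (Suc k)\<^esub> b \<in> d k ` kill J k"
      using x c d_add[of x k y] by (metis imageI)
  qed
qed (auto intro!: M.submoduleI_cring simp: B_simps)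

lemma kill_antimono: "J \<subseteq> K \<Longrightarrow> kill K i \<subseteq> kill J i"
  by (auto simp: kill_def)

lemma Z_antimono: "J \<subseteq> K \<Longrightarrow> Z K i \<subseteq> Z J i"
  by (auto simp: Z_def kill_def)

lemma B_antimono: "J \<subseteq> K \<Longrightarrow> B K i \<subseteq> B J i"
  using kill_antimono[of J K] by (cases i) (auto simp: B_simps)

lemma B_subset_Z: 
  assumes "J \<subseteq> carrier R" shows "B J i \<subseteq> Z J i"
proof (cases i)
  case 0
  then show ?thesis using assms by (auto simp: B_simps Z_def kill_def)
next
  case (Suc k)
  then show ?thesis using assms by (auto simp: B_simps Z_def kill_def d_d d_smult[symmetric])
qed

lemma kill_closed: "x \<in> kill J i \<Longrightarrow> x \<in> carrier (G i)"
  by (simp add: kill_def)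

lemma Z_closed: "x \<in> Z J i \<Longrightarrow> x \<in> carrier (G i)"
  by (simp add: Z_def kill_def)

lemma ideal_subset: "ideal J R \<Longrightarrow> J \<subseteq> carrier R"
  using ideal_closed(2) by blast

lemma kill_adjoin:
  assumes "ideal J R" "y \<in> carrier R"
  shows "kill (adjoin R J y) i = {e \<in> kill J i. y \<odot>\<^bsub>G i\<^esub> e = \<zero>\<^bsub>G i\<^esub>}"
proof
  show "kill (adjoin R J y) i \<subseteq> {e \<in> kill J i. y \<odot>\<^bsub>G i\<^esub> e = \<zero>\<^bsub>G i\<^esub>}"
    using adjoin_superset[OF assms] by (auto simp: kill_def)
  show "{e \<in> kill J i. y \<odot>\<^bsub>G i\<^esub> e = \<zero>\<^bsub>G i\<^esub>} \<subseteq> kill (adjoin R J y) i"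
    using assms ideal_closed(2)[OF assms(1)]
    by (auto simp: kill_def adjoin_def M.smult_l_distr M.smult_assoc1)
qed

lemma smult_kill_colon:
  assumes "ideal J R" "y \<in> carrier R" "e \<in> kill J i"
  shows "y \<odot>\<^bsub>G i\<^esub> e \<in> kill (colon R J y) i"
  using assms by (auto simp: kill_def colon_def M.smult_assoc1[symmetric])

text \<open>Surjectivity of multiplication by \<open>y\<close> from \<open>Hom(R/J, G i)\<close> to \<open>Hom(R/(J : y), G i)\<close>, that is,
  exactness of \<open>Hom(-, G i)\<close> on \<open>0 \<rightarrow> R/(J : y) \<rightarrow> R/J \<rightarrow> R/(J + yR) \<rightarrow> 0\<close>. The next four lemmas are the
  long exact cohomology sequence of this short exact sequence, one place at a time.\<close>

lemma kill_divisible: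
  assumes "ideal J R" "y \<in> carrier R" "e \<in> kill (colon R J y) i"
  obtains e' where "e' \<in> kill J i" "y \<odot>\<^bsub>G i\<^esub> e' = e"
  using divisible[OF assms(1,2), of e i] assms(3) by (auto simp: kill_def)

text \<open>Exactness at \<open>Ext\<^bsup>k+1\<^esup>(R/(J + yR))\<close>: a class that dies in \<open>Ext\<^bsup>k+1\<^esup>(R/J)\<close> is \<open>d w\<close> with \<open>w\<close> killed by \<open>J\<close>; it
  comes from the class of \<open>y w\<close> in \<open>Ext\<^sup>k(R/(J : y))\<close> and vanishes if that one does, because a lift
  of the primitive of \<open>y w\<close> along multiplication by \<open>y\<close> corrects \<open>w\<close> to an element killed by \<open>y\<close>.\<close>

lemma boundary_adjoin:
  assumes J: "ideal J R" and y: "y \<in> carrier R" and w: "w \<in> kill J k"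
    and yw: "y \<odot>\<^bsub>G k\<^esub> w \<in> B (colon R J y) k"
  shows "d k w \<in> B (adjoin R J y) (Suc k)"
proof (cases k)
  case 0
  then have "w \<in> kill (adjoin R J y) k" using yw w by (simp add: kill_adjoin[OF J y] B_simps)
  then show ?thesis by (simp add: B_simps)
next
  case (Suc l)
  then obtain v where v: "v \<in> kill (colon R J y) l" "y \<odot>\<^bsub>G k\<^esub> w = d l v"
    using yw by (auto simp: B_simps)
  obtain v' where v': "v' \<in> kill J l" "y \<odot>\<^bsub>G l\<^esub> v' = v"
    by (rule kill_divisible[OF J y v(1)])
  have c: "v' \<in> carrier (G l)" "w \<in> carrier (G k)" "d l v' \<in> carrier (G k)"
    using v' w kill_closed Suc by auto
  have "d l v' \<in> B J k" using v' Suc by (simp add: B_simps)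
  then have "d l v' \<in> kill J k" using B_subset_Z[OF ideal_subset[OF J], of k] by (auto simp: Z_def)
  then have "w \<ominus>\<^bsub>G k\<^esub> d l v' \<in> kill J k"
    using w M.submodule_closed(4)[OF kill_submodule[OF ideal_subset[OF J]]] by blast
  moreover have "y \<odot>\<^bsub>G k\<^esub> (w \<ominus>\<^bsub>G k\<^esub> d l v') = \<zero>\<^bsub>G k\<^esub>"
    using c y v(2) v'(2) Suc d_smult[of y v' l]
    by (simp add: M.smult_minus_distr M.minus_self_eq_zero)
  ultimately have "w \<ominus>\<^bsub>G k\<^esub> d l v' \<in> kill (adjoin R J y) k" by (simp add: kill_adjoin[OF J y])
  moreover have "d k (w \<ominus>\<^bsub>G k\<^esub> d l v') = d k w"
    using c Suc d_d[of v' l] by (simp add: d_minus) (simp add: a_minus_def)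
  ultimately show ?thesis by (simp add: B_simps image_iff) metis
qed

text \<open>Exactness at \<open>Ext\<^bsup>k+1\<^esup>(R/J)\<close>: a class that dies in \<open>Ext\<^bsup>k+1\<^esup>(R/(J : r))\<close> comes from \<open>Ext\<^bsup>k+1\<^esup>(R/(J + rR))\<close>.\<close>

lemma cocycle_reduce:
  assumes J: "ideal J R" and r: "r \<in> carrier R" and z: "z \<in> Z J (Suc k)"
    and rz: "r \<odot>\<^bsub>G (Suc k)\<^esub> z \<in> B (colon R J r) (Suc k)"
  obtains b where "b \<in> B J (Suc k)" "z \<ominus>\<^bsub>G (Suc k)\<^esub> b \<in> Z (adjoin R J r) (Suc k)"
proof -
  obtain v where v: "v \<in> kill (colon R J r) k" "r \<odot>\<^bsub>G (Suc k)\<^esub> z = d k v"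
    using rz by (auto simp: B_simps)
  obtain v' where v': "v' \<in> kill J k" "r \<odot>\<^bsub>G k\<^esub> v' = v"
    by (rule kill_divisible[OF J r v(1)])
  have b: "d k v' \<in> B J (Suc k)" using v' by (simp add: B_simps)
  have c: "v' \<in> carrier (G k)" "z \<in> carrier (G (Suc k))" using v' z kill_closed Z_closed by auto
  have "d k v' \<in> Z J (Suc k)" using B_subset_Z[OF ideal_subset[OF J]] b by blast
  then have "z \<ominus>\<^bsub>G (Suc k)\<^esub> d k v' \<in> Z J (Suc k)"
    using z M.submodule_closed(4)[OF Z_submodule[OF ideal_subset[OF J]]] by blast
  moreover have "r \<odot>\<^bsub>G (Suc k)\<^esub> (z \<ominus>\<^bsub>G (Suc k)\<^esub> d k v') = \<zero>\<^bsub>G (Suc k)\<^esub>"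
    using c r v(2) v'(2) d_smult[of r v' k]
    by (simp add: M.smult_minus_distr M.minus_self_eq_zero)
  ultimately have "z \<ominus>\<^bsub>G (Suc k)\<^esub> d k v' \<in> Z (adjoin R J r) (Suc k)"
    by (simp add: Z_def kill_adjoin[OF J r])
  then show ?thesis using that b by blast
qed

text \<open>The connecting map from \<open>Ext\<^sup>k(R/(J : y))\<close> to \<open>Ext\<^bsup>k+1\<^esup>(R/(J + yR))\<close>, which sends the class of \<open>y e\<close> to that of \<open>d e\<close>.\<close>

lemma connecting:
  assumes J: "ideal J R" and y: "y \<in> carrier R" and x: "x \<in> Z (colon R J y) k"
  obtains e where "e \<in> kill J k" "y \<odot>\<^bsub>G k\<^esub> e = x" "d k e \<in> Z (adjoin R J y) (Suc k)"
proof -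
  obtain e where e: "e \<in> kill J k" "y \<odot>\<^bsub>G k\<^esub> e = x"
    using kill_divisible[OF J y, of x k] x by (auto simp: Z_def)
  then have c: "e \<in> carrier (G k)" using kill_closed by auto
  have "d k e \<in> Z J (Suc k)"
    using B_subset_Z[OF ideal_subset[OF J], of "Suc k"] e by (auto simp: B_simps)
  moreover have "y \<odot>\<^bsub>G (Suc k)\<^esub> d k e = \<zero>\<^bsub>G (Suc k)\<^esub>"
    using d_smult[OF y c] e(2) x by (simp add: Z_def)
  ultimately have "d k e \<in> Z (adjoin R J y) (Suc k)" by (simp add: Z_def kill_adjoin[OF J y])
  then show ?thesis using that e by blast
qed

text \<open>Exactness at \<open>Ext\<^sup>k(R/(J : y))\<close>, multiplied by a scalar \<open>s\<close>: if \<open>s\<close> kills the image of a class under the connecting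
  map, then \<open>s\<close> times the class is divisible by \<open>y\<close>.\<close>

lemma connecting_boundary:
  assumes J: "ideal J R" and y: "y \<in> carrier R" and e: "e \<in> kill J k" and s: "s \<in> carrier R"
    and b: "s \<odot>\<^bsub>G (Suc k)\<^esub> d k e \<in> B (adjoin R J y) (Suc k)"
  obtains z where "z \<in> Z J k" "y \<odot>\<^bsub>G k\<^esub> z = s \<odot>\<^bsub>G k\<^esub> (y \<odot>\<^bsub>G k\<^esub> e)"
proof -
  obtain w where w: "w \<in> kill J k" "y \<odot>\<^bsub>G k\<^esub> w = \<zero>\<^bsub>G k\<^esub>" "s \<odot>\<^bsub>G (Suc k)\<^esub> d k e = d k w"
    using b by (auto simp: B_simps kill_adjoin[OF J y])
  have c: "e \<in> carrier (G k)" "w \<in> carrier (G k)" using e w kill_closed by auto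
  have "s \<odot>\<^bsub>G k\<^esub> e \<ominus>\<^bsub>G k\<^esub> w \<in> kill J k"
    using e w s M.submodule_closed(4,5)[OF kill_submodule[OF ideal_subset[OF J]]] by blast
  moreover have "d k (s \<odot>\<^bsub>G k\<^esub> e \<ominus>\<^bsub>G k\<^esub> w) = \<zero>\<^bsub>G (Suc k)\<^esub>"
    using c s w(3) by (simp add: d_minus d_smult M.minus_self_eq_zero)
  moreover have "y \<odot>\<^bsub>G k\<^esub> (s \<odot>\<^bsub>G k\<^esub> e \<ominus>\<^bsub>G k\<^esub> w) = s \<odot>\<^bsub>G k\<^esub> (y \<odot>\<^bsub>G k\<^esub> e)"
    using c s y w(2) by (simp add: M.smult_minus_distr M.smult_lcomm[of y s]) (simp add: a_minus_def)
  ultimately show ?thesis using that by (simp add: Z_def)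
qed

end

section \<open>Finiteness, annihilators and climbing a chain of primes\<close>

lemma (in module) submodule_sum:
  assumes H: "submodule H R M" and K: "submodule K R M"
  shows "submodule {a \<oplus>\<^bsub>M\<^esub> b | a b. a \<in> H \<and> b \<in> K} R M"
proof (rule submoduleI_cring)
  note h = submodule_closed[OF H] and k = submodule_closed[OF K]
  show "{a \<oplus>\<^bsub>M\<^esub> b | a b. a \<in> H \<and> b \<in> K} \<subseteq> carrier M" using h k by auto
  show "\<zero>\<^bsub>M\<^esub> \<in> {a \<oplus>\<^bsub>M\<^esub> b | a b. a \<in> H \<and> b \<in> K}"
    using h(1) k(1) by (intro CollectI exI[of _ "\<zero>\<^bsub>M\<^esub>"]) auto
  fix x assume "x \<in> {a \<oplus>\<^bsub>M\<^esub> b | a b. a \<in> H \<and> b \<in> K}"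
  then obtain a b where ab: "a \<in> H" "b \<in> K" "x = a \<oplus>\<^bsub>M\<^esub> b" by auto
  show "r \<odot>\<^bsub>M\<^esub> x \<in> {a \<oplus>\<^bsub>M\<^esub> b | a b. a \<in> H \<and> b \<in> K}" if "r \<in> carrier R" for r
    using ab h k that
    by (intro CollectI exI[of _ "r \<odot>\<^bsub>M\<^esub> a"] exI[of _ "r \<odot>\<^bsub>M\<^esub> b"]) (auto simp: smult_r_distr)
  fix y assume "y \<in> {a \<oplus>\<^bsub>M\<^esub> b | a b. a \<in> H \<and> b \<in> K}"
  then obtain a' b' where ab': "a' \<in> H" "b' \<in> K" "y = a' \<oplus>\<^bsub>M\<^esub> b'" by auto
  have "x \<oplus>\<^bsub>M\<^esub> y = (a \<oplus>\<^bsub>M\<^esub> a') \<oplus>\<^bsub>M\<^esub> (b \<oplus>\<^bsub>M\<^esub> b')"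
    using ab ab' h(2) k(2) by (simp add: M.a_ac)
  then show "x \<oplus>\<^bsub>M\<^esub> y \<in> {a \<oplus>\<^bsub>M\<^esub> b | a b. a \<in> H \<and> b \<in> K}"
    using ab ab' h(3) k(3) by blast
qed

context divisible_complex
begin

text \<open>The ascending chain condition for the quotient of \<open>A\<close> by \<open>C\<close>, stated for submodules between the two.\<close>

definition acc :: "'c set \<Rightarrow> 'c set \<Rightarrow> nat \<Rightarrow> bool" where
  "acc A C i \<longleftrightarrow> (\<forall>S. (\<forall>n::nat. submodule (S n) R (G i) \<and> C \<subseteq> S n \<and> S n \<subseteq> A \<and> S n \<subseteq> S (Suc n)) \<longrightarrow>
     (\<exists>n. \<forall>m\<ge>n. S m = S n))"

lemma accD:
  assumes "acc A C i" "\<And>n. submodule (S n) R (G i)" "\<And>n. C \<subseteq> S n" "\<And>n. S n \<subseteq> A"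
    "\<And>n. S n \<subseteq> S (Suc n)"
  shows "\<exists>n. \<forall>m\<ge>n. S m = S n"
  using assms unfolding acc_def by blast

lemma acc_refl: "acc A A i"
  unfolding acc_def
proof (intro allI impI)
  fix S :: "nat \<Rightarrow> 'c set"
  assume "\<forall>n. submodule (S n) R (G i) \<and> A \<subseteq> S n \<and> S n \<subseteq> A \<and> S n \<subseteq> S (Suc n)"
  then have "S n = A" for n by blast
  then show "\<exists>n. \<forall>m\<ge>n. S m = S n" by simp
qed

lemma acc_mono:
  assumes "acc A C i" "A' \<subseteq> A"
  shows "acc A' C i"
  unfolding acc_def
proof (intro allI impI)
  fix S :: "nat \<Rightarrow> 'c set"
  assume *: "\<forall>n. submodule (S n) R (G i) \<and> C \<subseteq> S n \<and> S n \<subseteq> A' \<and> S n \<subseteq> S (Suc n)"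
  show "\<exists>n. \<forall>m\<ge>n. S m = S n"
    by (rule accD[OF assms(1)]) (use * assms(2) in blast)+
qed

text \<open>In the exact sequence \<open>Ext\<^sup>k(R/(J : y)) \<rightarrow> Ext\<^bsup>k+1\<^esup>(R/(J + yR)) \<rightarrow> Ext\<^bsup>k+1\<^esup>(R/J)\<close> the outer terms are Noetherian, hence so
  is the middle one: a chain \<open>S\<close> stabilizes once its image \<open>S'\<close> on the right and its preimage \<open>T\<close> on the left do.\<close>

lemma acc_adjoin:
  assumes J: "ideal J R" and y: "y \<in> carrier R"
    and acc1: "acc (Z J (Suc k)) (B J (Suc k)) (Suc k)"
    and acc2: "acc (Z (colon R J y) k) (B (colon R J y) k) k"
  shows "acc (Z (adjoin R J y) (Suc k)) (B (adjoin R J y) (Suc k)) (Suc k)"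
  unfolding acc_def
proof (intro allI impI)
  fix S :: "nat \<Rightarrow> 'c set"
  assume *: "\<forall>n. submodule (S n) R (G (Suc k)) \<and> B (adjoin R J y) (Suc k) \<subseteq> S n \<and>
    S n \<subseteq> Z (adjoin R J y) (Suc k) \<and> S n \<subseteq> S (Suc n)"
  then have S: "\<And>n. submodule (S n) R (G (Suc k))" "\<And>n. B (adjoin R J y) (Suc k) \<subseteq> S n"
    "\<And>n. S n \<subseteq> Z (adjoin R J y) (Suc k)" "\<And>n. S n \<subseteq> S (Suc n)" by blast+
  note Sc = M.submodule_closed[OF S(1)]
  have mono: "S m \<subseteq> S n" if "m \<le> n" for m n by (rule lift_Suc_mono_le[of S, OF S(4) that])
  have Jc: "J \<subseteq> carrier R" by (rule ideal_subset[OF J])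
  have SZ: "S n \<subseteq> Z J (Suc k)" for n
    using S(3)[of n] Z_antimono[OF adjoin_superset(1)[OF J y]] by blast
  have killS: "y \<odot>\<^bsub>G (Suc k)\<^esub> x = \<zero>\<^bsub>G (Suc k)\<^esub>" if "x \<in> S n" for x n
    using that S(3)[of n] adjoin_superset(2)[OF J y] by (auto simp: Z_def kill_def)
  note Bc = M.submodule_closed[OF B_submodule[OF Jc, of "Suc k"]]
  define S' where "S' n = {a \<oplus>\<^bsub>G (Suc k)\<^esub> b | a b. a \<in> S n \<and> b \<in> B J (Suc k)}" for n
  define T where "T n = (\<lambda>w. y \<odot>\<^bsub>G k\<^esub> w) ` {w \<in> kill J k. d k w \<in> S n}" for n
  have "\<exists>n. \<forall>m\<ge>n. S' m = S' n"
  proof (rule accD[OF acc1])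
    fix n
    show "submodule (S' n) R (G (Suc k))"
      unfolding S'_def by (rule M.submodule_sum[OF S(1) B_submodule[OF Jc]])
    show "B J (Suc k) \<subseteq> S' n"
    proof
      fix b assume b: "b \<in> B J (Suc k)"
      then show "b \<in> S' n" unfolding S'_def using Sc(1) Bc(2)
        by (intro CollectI exI[of _ "\<zero>\<^bsub>G (Suc k)\<^esub>"] exI[of _ b]) auto
    qed
    show "S' n \<subseteq> Z J (Suc k)"
      using SZ[of n] B_subset_Z[OF Jc, of "Suc k"] M.submodule_closed(3)[OF Z_submodule[OF Jc]]
      unfolding S'_def by blast
    show "S' n \<subseteq> S' (Suc n)" unfolding S'_def using S(4) by blast
  qed
  then obtain n1 where n1: "\<And>m. m \<ge> n1 \<Longrightarrow> S' m = S' n1" by blast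
  have "\<exists>n. \<forall>m\<ge>n. T m = T n"
  proof (rule accD[OF acc2])
    fix n
    note kc = M.submodule_closed[OF kill_submodule[OF Jc, of k]]
    show "submodule (T n) R (G k)"
    proof (rule M.submoduleI_cring)
      show "T n \<subseteq> carrier (G k)" unfolding T_def using y kc by auto
      have "\<zero>\<^bsub>G k\<^esub> \<in> {w \<in> kill J k. d k w \<in> S n}" using kc Sc by auto
      then show "\<zero>\<^bsub>G k\<^esub> \<in> T n" unfolding T_def using y by (intro image_eqI) auto
      fix a r assume "a \<in> T n"
      then obtain w where w: "w \<in> kill J k" "d k w \<in> S n" "a = y \<odot>\<^bsub>G k\<^esub> w" unfolding T_def by auto
      show "r \<odot>\<^bsub>G k\<^esub> a \<in> T n" if r: "r \<in> carrier R"
        unfolding T_def using w r y kc Sc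
        by (intro image_eqI[of _ _ "r \<odot>\<^bsub>G k\<^esub> w"]) (auto simp: M.smult_lcomm d_smult)
      fix b assume "b \<in> T n"
      then obtain w' where w': "w' \<in> kill J k" "d k w' \<in> S n" "b = y \<odot>\<^bsub>G k\<^esub> w'" unfolding T_def by auto
      show "a \<oplus>\<^bsub>G k\<^esub> b \<in> T n"
        unfolding T_def using w w' y kc Sc
        by (intro image_eqI[of _ _ "w \<oplus>\<^bsub>G k\<^esub> w'"]) (auto simp: M.smult_r_distr d_add)
    qed
    show "B (colon R J y) k \<subseteq> T n"
    proof
      fix v assume v: "v \<in> B (colon R J y) k"
      show "v \<in> T n"
      proof (cases k)
        case 0
        then have "v = y \<odot>\<^bsub>G k\<^esub> \<zero>\<^bsub>G k\<^esub>" using v y by (simp add: B_simps)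
        moreover have "\<zero>\<^bsub>G k\<^esub> \<in> {w \<in> kill J k. d k w \<in> S n}" using kc Sc by auto
        ultimately show ?thesis unfolding T_def by (rule image_eqI)
      next
        case (Suc l)
        then obtain u where u: "u \<in> kill (colon R J y) l" "v = d l u" using v by (auto simp: B_simps)
        obtain u' where u': "u' \<in> kill J l" "y \<odot>\<^bsub>G l\<^esub> u' = u" by (rule kill_divisible[OF J y u(1)])
        have c: "u' \<in> carrier (G l)" using u' kill_closed by auto
        have "d l u' \<in> kill J k"
          using u' Suc B_subset_Z[OF Jc, of k] by (auto simp: B_simps Z_def)
        moreover have "d k (d l u') \<in> S n" using c Suc d_d[of u' l] Sc(1) by auto
        moreover have "v = y \<odot>\<^bsub>G k\<^esub> d l u'" using u u' c y Suc d_smult[of y u' l] by simp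
        ultimately show ?thesis unfolding T_def by (intro image_eqI[of _ _ "d l u'"]) auto
      qed
    qed
    show "T n \<subseteq> Z (colon R J y) k"
      unfolding T_def Z_def using smult_kill_colon[OF J y] killS y kill_closed
      by (auto simp: d_smult)
    show "T n \<subseteq> T (Suc n)" unfolding T_def using S(4) by blast
  qed
  then obtain n2 where n2: "\<And>m. m \<ge> n2 \<Longrightarrow> T m = T n2" by blast
  define n where "n = max n1 n2"
  have "S m = S n" if m: "m \<ge> n" for m
  proof
    show "S n \<subseteq> S m" by (rule mono[OF m])
    show "S m \<subseteq> S n"
    proof
      fix x assume x: "x \<in> S m"
      have xc: "x \<in> carrier (G (Suc k))" using x Sc by auto
      have "x \<in> S' m" unfolding S'_def using x Bc(1) xc
        by (intro CollectI exI[of _ x] exI[of _ "\<zero>\<^bsub>G (Suc k)\<^esub>"]) auto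
      also have "S' m = S' n" using n1[of m] n1[of n] m by (simp add: n_def)
      finally obtain a w where a: "a \<in> S n" "w \<in> kill J k" "x = a \<oplus>\<^bsub>G (Suc k)\<^esub> d k w"
        unfolding S'_def B_simps by auto
      have c: "a \<in> carrier (G (Suc k))" "w \<in> carrier (G k)" using a Sc kill_closed by auto
      have dw: "d k w = x \<ominus>\<^bsub>G (Suc k)\<^esub> a" unfolding a(3) using c
        by (simp add: M.a_comm[of a] M.minus_add_cancel)
      have "d k w \<in> S m" unfolding dw using x a(1) mono[OF m] Sc(4) by blast
      then have "y \<odot>\<^bsub>G k\<^esub> w \<in> T m" unfolding T_def using a by auto
      also have "T m = T n" using n2[of m] n2[of n] m by (simp add: n_def)
      finally obtain w' where w': "w' \<in> kill J k" "d k w' \<in> S n" "y \<odot>\<^bsub>G k\<^esub> w = y \<odot>\<^bsub>G k\<^esub> w'"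
        unfolding T_def by auto
      have c': "w' \<in> carrier (G k)" using w' kill_closed by auto
      have "w \<ominus>\<^bsub>G k\<^esub> w' \<in> kill J k"
        using a w' M.submodule_closed(4)[OF kill_submodule[OF Jc]] by auto
      moreover have "y \<odot>\<^bsub>G k\<^esub> (w \<ominus>\<^bsub>G k\<^esub> w') = \<zero>\<^bsub>G k\<^esub>"
        using w'(3) c c' y by (simp add: M.smult_minus_distr M.minus_self_eq_zero)
      ultimately have "d k (w \<ominus>\<^bsub>G k\<^esub> w') \<in> B (adjoin R J y) (Suc k)"
        unfolding B_simps kill_adjoin[OF J y] by blast
      then have "d k w \<ominus>\<^bsub>G (Suc k)\<^esub> d k w' \<in> S n" using S(2) c c' by (auto simp: d_minus)
      then have "d k w \<ominus>\<^bsub>G (Suc k)\<^esub> d k w' \<oplus>\<^bsub>G (Suc k)\<^esub> d k w' \<in> S n" using w'(2) Sc(3) by blast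
      then have "d k w \<in> S n" using c c' by (simp add: M.minus_add_cancel)
      then show "x \<in> S n" unfolding a(3) using a(1) Sc(3) by blast
    qed
  qed
  then show "\<exists>n. \<forall>m\<ge>n. S m = S n" by blast
qed

lemma ideal_generator_induct [consumes 1, case_names zero adjoin]:
  assumes J: "ideal J R" and zero: "P {\<zero>}"
    and adj: "\<And>K y. ideal K R \<Longrightarrow> P K \<Longrightarrow> y \<in> carrier R \<Longrightarrow> P (adjoin R K y)"
  shows "P J"
proof -
  obtain A where A: "A \<subseteq> carrier R" "finite A" "J = Idl A" using finetely_gen[OF J] by auto
  from A(2,1) have "P (Idl A)"
  proof (induction A)
    case empty
    show ?case using zero by (simp add: genideal_empty)
  next
    case (insert y A)
    then show ?case using adj[of "Idl A" y] genideal_ideal[of A] genideal_insert[of A y] by auto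
  qed
  then show ?thesis using A by simp
qed

text \<open>All modules \<open>Ext\<^sup>i(R/J)\<close> are Noetherian. The induction runs over \<open>i\<close> and, for fixed \<open>i\<close>, over
  the number of generators of \<open>J\<close>; adjoining one generator involves cyclic modules only.\<close>

lemma acc_cohomology:
  assumes zero: "acc (Z {\<zero>} 0) (B {\<zero>} 0) 0" and exact: "\<And>k. Z {\<zero>} (Suc k) = B {\<zero>} (Suc k)"
    and J: "ideal J R"
  shows "acc (Z J i) (B J i) i"
  using J
proof (induction i arbitrary: J)
  case 0
  have "Z J 0 \<subseteq> Z {\<zero>} 0" using ideal_closed(1)[OF 0] by (intro Z_antimono) auto
  then show ?case using acc_mono[OF zero, of "Z J 0"] by (simp add: B_simps)
next
  case (Suc k)
  from Suc.prems show ?case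
  proof (induction J rule: ideal_generator_induct)
    case zero
    show ?case unfolding exact[of k] by (rule acc_refl)
  next
    case (adjoin K y)
    show ?case by (rule acc_adjoin) (use adjoin Suc.IH colon_ideal in auto)
  qed
qed

text \<open>The same exact sequence bounds the exponent needed for \<open>J + yR\<close> by those for \<open>J\<close> and for \<open>(J : y)\<close>. That the bound is explicit
  matters later, where \<open>y\<close> runs through the powers of one element while \<open>J\<close> and \<open>(J : y)\<close> stay fixed.\<close>

lemma annihilator_adjoin:
  assumes a: "a \<in> carrier R" and J: "ideal J R" and y: "y \<in> carrier R"
    and N: "\<And>z. z \<in> Z J (Suc k) \<Longrightarrow> a [^] (N::nat) \<odot>\<^bsub>G (Suc k)\<^esub> z \<in> B J (Suc k)"
    and N': "\<And>z. z \<in> Z (colon R J y) k \<Longrightarrow> a [^] (N'::nat) \<odot>\<^bsub>G k\<^esub> z \<in> B (colon R J y) k"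
    and z: "z \<in> Z (adjoin R J y) (Suc k)"
  shows "a [^] (N' + N) \<odot>\<^bsub>G (Suc k)\<^esub> z \<in> B (adjoin R J y) (Suc k)"
proof -
  have zJ: "z \<in> Z J (Suc k)" and yz: "y \<odot>\<^bsub>G (Suc k)\<^esub> z = \<zero>\<^bsub>G (Suc k)\<^esub>" and zc: "z \<in> carrier (G (Suc k))"
    using z Z_antimono[OF adjoin_superset(1)[OF J y]] adjoin_superset(2)[OF J y]
    by (auto simp: Z_def kill_def)
  obtain w where w: "w \<in> kill J k" "a [^] N \<odot>\<^bsub>G (Suc k)\<^esub> z = d k w"
    using N[OF zJ] by (auto simp: B_simps)
  have wc: "w \<in> carrier (G k)" using w kill_closed by auto
  have "d k (y \<odot>\<^bsub>G k\<^esub> w) = a [^] N \<odot>\<^bsub>G (Suc k)\<^esub> (y \<odot>\<^bsub>G (Suc k)\<^esub> z)"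
    using wc y a zc by (simp add: d_smult w(2)[symmetric] M.smult_lcomm)
  then have "y \<odot>\<^bsub>G k\<^esub> w \<in> Z (colon R J y) k"
    using smult_kill_colon[OF J y w(1)] yz a by (simp add: Z_def)
  from N'[OF this] have "y \<odot>\<^bsub>G k\<^esub> (a [^] N' \<odot>\<^bsub>G k\<^esub> w) \<in> B (colon R J y) k"
    using a y wc by (simp add: M.smult_lcomm)
  moreover have "a [^] N' \<odot>\<^bsub>G k\<^esub> w \<in> kill J k"
    using w a M.submodule_closed(5)[OF kill_submodule[OF ideal_subset[OF J]]] by simp
  ultimately have "d k (a [^] N' \<odot>\<^bsub>G k\<^esub> w) \<in> B (adjoin R J y) (Suc k)"
    using boundary_adjoin[OF J y] by blast
  then show ?thesis using wc zc a w(2)[symmetric]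
    by (simp add: d_smult M.smult_assoc1[symmetric] nat_pow_mult)
qed

text \<open>If powers of \<open>a\<close> kill the cohomology of the complex itself, they also kill \<open>Ext\<^sup>i(R/J)\<close>, by
  the induction of the previous finiteness result.\<close>

lemma annihilator_cohomology:
  assumes a: "a \<in> carrier R"
    and H: "\<And>i. i \<le> n \<Longrightarrow> \<exists>N::nat. \<forall>z\<in>Z {\<zero>} i. a [^] N \<odot>\<^bsub>G i\<^esub> z \<in> B {\<zero>} i"
    and i: "i \<le> n" and J: "ideal J R"
  shows "\<exists>N::nat. \<forall>z\<in>Z J i. a [^] N \<odot>\<^bsub>G i\<^esub> z \<in> B J i"
  using i J
proof (induction i arbitrary: J)
  case 0
  have "Z J 0 \<subseteq> Z {\<zero>} 0" using ideal_closed(1)[OF 0(2)] by (intro Z_antimono) auto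
  then show ?case using H[of 0] by (auto simp: B_simps)
next
  case (Suc k)
  from Suc.prems(2) show ?case
  proof (induction J rule: ideal_generator_induct)
    case zero
    show ?case by (rule H[OF Suc.prems(1)])
  next
    case (adjoin J y)
    then obtain N :: nat where N: "\<And>z. z \<in> Z J (Suc k) \<Longrightarrow> a [^] N \<odot>\<^bsub>G (Suc k)\<^esub> z \<in> B J (Suc k)" by blast
    obtain N' :: nat where N': "\<And>z. z \<in> Z (colon R J y) k \<Longrightarrow> a [^] N' \<odot>\<^bsub>G k\<^esub> z \<in> B (colon R J y) k"
      using Suc.IH[OF _ colon_ideal[of J y]] Suc.prems(1) adjoin.hyps by auto
    have "\<forall>z\<in>Z (adjoin R J y) (Suc k). a [^] (N' + N) \<odot>\<^bsub>G (Suc k)\<^esub> z \<in> B (adjoin R J y) (Suc k)"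
      using annihilator_adjoin[OF a adjoin.hyps N N'] by blast
    then show ?case by blast
  qed
qed

text \<open>Nakayama's lemma, localized at a prime \<open>P\<close>: if every element of \<open>Y\<close> is, up to a factor outside \<open>P\<close>, a multiple
  \<open>x e'\<close> of another element of \<open>Y\<close>, then \<open>Y\<close> vanishes at \<open>P\<close>. Starting from \<open>f 0 = e\<close>, choose
  \<open>f (n + 1)\<close> such that \<open>s' f n = x f (n + 1)\<close>: the elements that are locally multiples of \<open>f n\<close> form an ascending chain,
  and when it stops, \<open>f (n + 1)\<close> is locally a multiple of \<open>f n\<close>, say \<open>s f (n + 1) = t f n\<close>.
  Then \<open>(s s' - x t) f n = 0\<close> with \<open>s s' - x t\<close> outside \<open>P\<close>, and \<open>e\<close> vanishes at \<open>P\<close> along with \<open>f n\<close>.\<close>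

lemma nakayama:
  assumes acc: "acc (Z J i) (B J i) i" and J: "ideal J R" and P: "primeideal P R" and x: "x \<in> P"
    and Y: "Y \<subseteq> Z J i"
    and step: "\<And>e. e \<in> Y \<Longrightarrow> \<exists>s\<in>carrier R - P. \<exists>e'\<in>Y. s \<odot>\<^bsub>G i\<^esub> e \<ominus>\<^bsub>G i\<^esub> x \<odot>\<^bsub>G i\<^esub> e' \<in> B J i"
    and e: "e \<in> Y"
  shows "\<exists>s\<in>carrier R - P. s \<odot>\<^bsub>G i\<^esub> e \<in> B J i"
proof -
  interpret P: primeideal P R by (rule P)
  have Jc: "J \<subseteq> carrier R" by (rule ideal_subset[OF J])
  have xc: "x \<in> carrier R" using x by (rule P.Icarr)
  note Bc = M.submodule_closed[OF B_submodule[OF Jc, of i]]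
  note Zc = M.submodule_closed[OF Z_submodule[OF Jc, of i]]
  have "\<exists>f. \<forall>n. (f n \<in> Y \<and> (n = 0 \<longrightarrow> f n = e)) \<and>
      (\<exists>s\<in>carrier R - P. s \<odot>\<^bsub>G i\<^esub> f n \<ominus>\<^bsub>G i\<^esub> x \<odot>\<^bsub>G i\<^esub> f (Suc n) \<in> B J i)"
  proof (rule dependent_nat_choice)
    show "\<exists>v. v \<in> Y \<and> (0 = (0::nat) \<longrightarrow> v = e)" using e by auto
    fix v and n :: nat assume "v \<in> Y \<and> (n = 0 \<longrightarrow> v = e)"
    then show "\<exists>v'. (v' \<in> Y \<and> (Suc n = 0 \<longrightarrow> v' = e)) \<and>
        (\<exists>s\<in>carrier R - P. s \<odot>\<^bsub>G i\<^esub> v \<ominus>\<^bsub>G i\<^esub> x \<odot>\<^bsub>G i\<^esub> v' \<in> B J i)"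
      using step[of v] by auto
  qed
  then obtain f where f0: "f 0 = e" and fY: "\<And>n. f n \<in> Y"
    and f: "\<And>n::nat. \<exists>s\<in>carrier R - P. s \<odot>\<^bsub>G i\<^esub> f n \<ominus>\<^bsub>G i\<^esub> x \<odot>\<^bsub>G i\<^esub> f (Suc n) \<in> B J i" by metis
  have fc: "f n \<in> carrier (G i)" "f n \<in> Z J i" for n
    using fY[of n] Y Z_closed[of "f n" J i] by auto
  define S where "S n = {v \<in> Z J i. \<exists>s\<in>carrier R - P. \<exists>t\<in>carrier R. s \<odot>\<^bsub>G i\<^esub> v \<ominus>\<^bsub>G i\<^esub> t \<odot>\<^bsub>G i\<^esub> f n \<in> B J i}" for n
  have SI: "v \<in> S n" if "v \<in> Z J i" "s \<in> carrier R - P" "t \<in> carrier R"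
    "s \<odot>\<^bsub>G i\<^esub> v \<ominus>\<^bsub>G i\<^esub> t \<odot>\<^bsub>G i\<^esub> f n \<in> B J i" for s t v n
    using that unfolding S_def by blast
  have one: "\<one> \<in> carrier R - P" using primeideal_one_notin[OF P] by simp
  have S_Suc: "S n \<subseteq> S (Suc n)" for n
    proof
      fix v assume "v \<in> S n"
      then obtain s t where v: "v \<in> Z J i" "s \<in> carrier R - P" "t \<in> carrier R"
        "s \<odot>\<^bsub>G i\<^esub> v \<ominus>\<^bsub>G i\<^esub> t \<odot>\<^bsub>G i\<^esub> f n \<in> B J i" unfolding S_def by auto
      have vc: "v \<in> carrier (G i)" using v Z_closed by auto
      obtain s' where s': "s' \<in> carrier R - P" "s' \<odot>\<^bsub>G i\<^esub> f n \<ominus>\<^bsub>G i\<^esub> x \<odot>\<^bsub>G i\<^esub> f (Suc n) \<in> B J i"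
        using f by blast
      have "s' \<odot>\<^bsub>G i\<^esub> (s \<odot>\<^bsub>G i\<^esub> v \<ominus>\<^bsub>G i\<^esub> t \<odot>\<^bsub>G i\<^esub> f n) \<oplus>\<^bsub>G i\<^esub> t \<odot>\<^bsub>G i\<^esub> (s' \<odot>\<^bsub>G i\<^esub> f n \<ominus>\<^bsub>G i\<^esub> x \<odot>\<^bsub>G i\<^esub> f (Suc n))
         = (s' \<otimes> s) \<odot>\<^bsub>G i\<^esub> v \<ominus>\<^bsub>G i\<^esub> (t \<otimes> x) \<odot>\<^bsub>G i\<^esub> f (Suc n)"
        using v s' vc fc(1) xc
        by (simp add: M.smult_minus_distr M.smult_assoc1[symmetric] m_comm[of t s'])
           (simp add: a_minus_def M.a_assoc M.r_neg1)
      then have "(s' \<otimes> s) \<odot>\<^bsub>G i\<^esub> v \<ominus>\<^bsub>G i\<^esub> (t \<otimes> x) \<odot>\<^bsub>G i\<^esub> f (Suc n) \<in> B J i"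
        using Bc(3)[OF Bc(5)[OF _ v(4), of s'] Bc(5)[OF _ s'(2), of t]] v s' by simp
      then show "v \<in> S (Suc n)"
        by (rule SI[OF v(1) primeideal_prod_notin[OF P s'(1) v(2)] m_closed[OF v(3) xc]])
    qed
  have "\<exists>n. \<forall>m\<ge>n. S m = S n"
  proof (rule accD[OF acc])
    fix n
    show "submodule (S n) R (G i)"
    proof (rule M.submoduleI_cring)
      show "S n \<subseteq> carrier (G i)" unfolding S_def using Z_closed by auto
      show "\<zero>\<^bsub>G i\<^esub> \<in> S n"
        by (rule SI[OF Zc(1) one zero_closed]) (use Bc(1) fc[of n] in \<open>simp add: M.minus_self_eq_zero\<close>)
      fix v r assume "v \<in> S n"
      then obtain s t where v: "v \<in> Z J i" "s \<in> carrier R - P" "t \<in> carrier R"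
        "s \<odot>\<^bsub>G i\<^esub> v \<ominus>\<^bsub>G i\<^esub> t \<odot>\<^bsub>G i\<^esub> f n \<in> B J i" unfolding S_def by auto
      have vc: "v \<in> carrier (G i)" using v Z_closed by auto
      show "r \<odot>\<^bsub>G i\<^esub> v \<in> S n" if r: "r \<in> carrier R"
      proof -
        have "r \<odot>\<^bsub>G i\<^esub> (s \<odot>\<^bsub>G i\<^esub> v \<ominus>\<^bsub>G i\<^esub> t \<odot>\<^bsub>G i\<^esub> f n) = s \<odot>\<^bsub>G i\<^esub> (r \<odot>\<^bsub>G i\<^esub> v) \<ominus>\<^bsub>G i\<^esub> (r \<otimes> t) \<odot>\<^bsub>G i\<^esub> f n"
          using r v vc fc by (simp add: M.smult_minus_distr M.smult_lcomm[of r s] M.smult_assoc1)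
        then have "s \<odot>\<^bsub>G i\<^esub> (r \<odot>\<^bsub>G i\<^esub> v) \<ominus>\<^bsub>G i\<^esub> (r \<otimes> t) \<odot>\<^bsub>G i\<^esub> f n \<in> B J i"
          using Bc(5)[OF r v(4)] by simp
        then show ?thesis by (rule SI[OF Zc(5)[OF r v(1)] v(2) m_closed[OF r v(3)]])
      qed
      fix v' assume "v' \<in> S n"
      then obtain s' t' where v': "v' \<in> Z J i" "s' \<in> carrier R - P" "t' \<in> carrier R"
        "s' \<odot>\<^bsub>G i\<^esub> v' \<ominus>\<^bsub>G i\<^esub> t' \<odot>\<^bsub>G i\<^esub> f n \<in> B J i" unfolding S_def by auto
      have vc': "v' \<in> carrier (G i)" using v' Z_closed by auto
      have "s' \<odot>\<^bsub>G i\<^esub> (s \<odot>\<^bsub>G i\<^esub> v \<ominus>\<^bsub>G i\<^esub> t \<odot>\<^bsub>G i\<^esub> f n) \<oplus>\<^bsub>G i\<^esub> s \<odot>\<^bsub>G i\<^esub> (s' \<odot>\<^bsub>G i\<^esub> v' \<ominus>\<^bsub>G i\<^esub> t' \<odot>\<^bsub>G i\<^esub> f n)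
         = (s \<otimes> s') \<odot>\<^bsub>G i\<^esub> (v \<oplus>\<^bsub>G i\<^esub> v') \<ominus>\<^bsub>G i\<^esub> (s' \<otimes> t \<oplus> s \<otimes> t') \<odot>\<^bsub>G i\<^esub> f n"
        using v v' vc vc' fc[of n]
        by (simp add: M.smult_minus_distr M.smult_r_distr M.smult_l_distr m_comm[of s s']
            a_minus_def M.minus_add M.smult_r_minus M.smult_assoc1[symmetric] M.a_ac)
      then have "(s \<otimes> s') \<odot>\<^bsub>G i\<^esub> (v \<oplus>\<^bsub>G i\<^esub> v') \<ominus>\<^bsub>G i\<^esub> (s' \<otimes> t \<oplus> s \<otimes> t') \<odot>\<^bsub>G i\<^esub> f n \<in> B J i"
        using Bc(3)[OF Bc(5)[OF _ v(4), of s'] Bc(5)[OF _ v'(4), of s]] v v' by simp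
      then show "v \<oplus>\<^bsub>G i\<^esub> v' \<in> S n"
        by (rule SI[OF Zc(3)[OF v(1) v'(1)] primeideal_prod_notin[OF P v(2) v'(2)], rotated])
           (use v v' in auto)
    qed
    show "B J i \<subseteq> S n"
    proof
      fix b assume b: "b \<in> B J i"
      show "b \<in> S n"
        by (rule SI[OF _ one zero_closed])
           (use b B_subset_Z[OF Jc, of i] Bc(2)[OF b] Bc(4)[OF b Bc(1)] fc[of n] in auto)
    qed
    show "S n \<subseteq> Z J i" unfolding S_def by auto
    show "S n \<subseteq> S (Suc n)" by (rule S_Suc)
  qed
  then obtain n where n: "\<And>m. m \<ge> n \<Longrightarrow> S m = S n" by blast
  have f_in_S: "f n \<in> S n" for n
    by (rule SI[OF fc(2) one one_closed]) (use fc[of n] Bc(1) in \<open>simp add: M.minus_self_eq_zero\<close>)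
  have "f (Suc n) \<in> S n" using n[of "Suc n"] f_in_S[of "Suc n"] by simp
  then obtain s t where st: "s \<in> carrier R - P" "t \<in> carrier R"
    "s \<odot>\<^bsub>G i\<^esub> f (Suc n) \<ominus>\<^bsub>G i\<^esub> t \<odot>\<^bsub>G i\<^esub> f n \<in> B J i" unfolding S_def by auto
  obtain s' where s': "s' \<in> carrier R - P" "s' \<odot>\<^bsub>G i\<^esub> f n \<ominus>\<^bsub>G i\<^esub> x \<odot>\<^bsub>G i\<^esub> f (Suc n) \<in> B J i"
    using f by blast
  define w where "w = s \<otimes> s' \<ominus> x \<otimes> t"
  have wc: "w \<in> carrier R" unfolding w_def using st s' xc by auto
  have "w \<notin> P"
  proof
    assume "w \<in> P"
    moreover have "x \<otimes> t \<in> P" using x st by (simp add: P.I_r_closed)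
    ultimately have "w \<oplus> x \<otimes> t \<in> P" by (rule P.a_closed)
    moreover have "w \<oplus> x \<otimes> t = s \<otimes> s'" unfolding w_def using st s' xc by (simp add: minus_add_cancel)
    ultimately show False using primeideal_prod_notin[OF P st(1) s'(1)] by simp
  qed
  have "s \<odot>\<^bsub>G i\<^esub> (s' \<odot>\<^bsub>G i\<^esub> f n \<ominus>\<^bsub>G i\<^esub> x \<odot>\<^bsub>G i\<^esub> f (Suc n)) \<oplus>\<^bsub>G i\<^esub> x \<odot>\<^bsub>G i\<^esub> (s \<odot>\<^bsub>G i\<^esub> f (Suc n) \<ominus>\<^bsub>G i\<^esub> t \<odot>\<^bsub>G i\<^esub> f n)
    = w \<odot>\<^bsub>G i\<^esub> f n"
    unfolding w_def using st s' xc fc(1)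
    by (simp add: M.smult_minus_distr M.smult_minus_distl M.smult_assoc1[symmetric] m_comm[of x s])
       (simp add: a_minus_def M.a_assoc M.r_neg1)
  then have wn: "w \<odot>\<^bsub>G i\<^esub> f n \<in> B J i"
    using Bc(3)[OF Bc(5)[OF _ s'(2), of s] Bc(5)[OF _ st(3), of x]] st s' xc by simp
  have "S 0 \<subseteq> S n" by (rule lift_Suc_mono_le[of S, OF S_Suc]) simp
  then have "e \<in> S n" using f_in_S[of 0] f0 by auto
  then obtain s t where e: "e \<in> Z J i" "s \<in> carrier R - P" "t \<in> carrier R"
    "s \<odot>\<^bsub>G i\<^esub> e \<ominus>\<^bsub>G i\<^esub> t \<odot>\<^bsub>G i\<^esub> f n \<in> B J i" unfolding S_def by auto
  have ec: "e \<in> carrier (G i)" using e Z_closed by auto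
  have "w \<odot>\<^bsub>G i\<^esub> (s \<odot>\<^bsub>G i\<^esub> e \<ominus>\<^bsub>G i\<^esub> t \<odot>\<^bsub>G i\<^esub> f n) \<oplus>\<^bsub>G i\<^esub> t \<odot>\<^bsub>G i\<^esub> (w \<odot>\<^bsub>G i\<^esub> f n) = (w \<otimes> s) \<odot>\<^bsub>G i\<^esub> e"
    using e ec wc fc(1)
    by (simp add: M.smult_minus_distr M.smult_assoc1[symmetric] m_comm[of w t] M.minus_add_cancel)
  then have "(w \<otimes> s) \<odot>\<^bsub>G i\<^esub> e \<in> B J i"
    using Bc(3)[OF Bc(5)[OF wc e(4)] Bc(5)[OF e(3) wn]] by simp
  then show ?thesis using primeideal_prod_notin[OF P _ e(2), of w] wc \<open>w \<notin> P\<close> by blast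
qed

lemma colon_prime:
  assumes "primeideal p R" "y \<in> carrier R" "y \<notin> p"
  shows "colon R p y = p"
proof -
  have ip: "ideal p R" using assms(1) by (rule primeideal.axioms)
  have "r \<in> p" if "r \<in> carrier R" "r \<otimes> y \<in> p" for r
    using primeideal.I_prime[OF assms(1) that(1) assms(2) that(2)] assms(3) by blast
  then show ?thesis
    using colon_superset[OF ip assms(2)] by (auto simp: colon_def)
qed

text \<open>The class of \<open>e\<close> in \<open>Ext\<^sup>i(R/J)\<close> has an annihilator contained in \<open>P\<close>, that is, it does not vanish after
  localization at \<open>P\<close>. For \<open>P = J\<close> this says that its annihilator is exactly \<open>J\<close>.\<close>

definition survives_at :: "'a set \<Rightarrow> 'a set \<Rightarrow> nat \<Rightarrow> 'c \<Rightarrow> bool" where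
  "survives_at P J i e \<longleftrightarrow> e \<in> Z J i \<and> (\<forall>s\<in>carrier R - P. s \<odot>\<^bsub>G i\<^esub> e \<notin> B J i)"

text \<open>Passing to a larger prime and to the next cohomological degree. Were the image of the connecting map in
  \<open>Ext\<^bsup>j+1\<^esup>(R/(p + xR))\<close> zero at \<open>P\<close>, then \<open>Ext\<^sup>j(R/p)\<close> would be divisible by \<open>x\<close> at \<open>P\<close>, hence zero
  there by Nakayama's lemma. So a class survives at \<open>P\<close>; an ideal \<open>K\<close> that is maximal with this
  property for its own \<open>Ext\<^bsup>j+1\<^esup>(R/K)\<close> is prime, and every element outside \<open>K\<close> acts injectively on the class.\<close>

lemma survives_at_step:
  assumes acc: "\<And>J i. ideal J R \<Longrightarrow> acc (Z J i) (B J i) i"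
    and p: "primeideal p R" and P: "primeideal P R" and pP: "p \<subseteq> P" and x: "x \<in> P" "x \<notin> p"
    and e: "survives_at p p j e"
  shows "\<exists>q e'. primeideal q R \<and> p \<subseteq> q \<and> x \<in> q \<and> q \<subseteq> P \<and> survives_at q q (Suc j) e'"
proof -
  interpret P: primeideal P R by (rule P)
  interpret p: primeideal p R by (rule p)
  have ip: "ideal p R" by (rule p.is_ideal)
  have xc: "x \<in> carrier R" using x(1) by (rule P.Icarr)
  have cx: "colon R p x = p" by (rule colon_prime[OF p xc x(2)])
  have one: "\<one> \<in> carrier R - P" using primeideal_one_notin[OF P] by simp
  have ex: "\<exists>e'. survives_at P (adjoin R p x) (Suc j) e'"
  proof (rule ccontr)
    assume no: "\<not> ?thesis"
    have "\<exists>s\<in>carrier R - P. s \<odot>\<^bsub>G j\<^esub> e \<in> B p j"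
    proof (rule nakayama[OF acc[OF ip] ip P x(1) order_refl])
      show "e \<in> Z p j" using e by (simp add: survives_at_def)
      fix v assume v: "v \<in> Z p j"
      obtain w where w: "w \<in> kill p j" "x \<odot>\<^bsub>G j\<^esub> w = v" "d j w \<in> Z (adjoin R p x) (Suc j)"
        using connecting[OF ip xc, of v j] v cx by auto
      obtain s where s: "s \<in> carrier R - P" "s \<odot>\<^bsub>G (Suc j)\<^esub> d j w \<in> B (adjoin R p x) (Suc j)"
        using no w(3) by (auto simp: survives_at_def)
      obtain z where z: "z \<in> Z p j" "x \<odot>\<^bsub>G j\<^esub> z = s \<odot>\<^bsub>G j\<^esub> (x \<odot>\<^bsub>G j\<^esub> w)"
        using connecting_boundary[OF ip xc w(1) _ s(2)] s(1) by auto
      have "s \<odot>\<^bsub>G j\<^esub> v \<ominus>\<^bsub>G j\<^esub> x \<odot>\<^bsub>G j\<^esub> z = \<zero>\<^bsub>G j\<^esub>"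
        using z(2) w(2) Z_closed[OF v] s(1) by (simp add: M.minus_self_eq_zero)
      moreover have "\<zero>\<^bsub>G j\<^esub> \<in> B p j" by (rule M.submodule_closed(1)[OF B_submodule[OF ideal_subset[OF ip]]])
      ultimately show "\<exists>s\<in>carrier R - P. \<exists>e'\<in>Z p j. s \<odot>\<^bsub>G j\<^esub> v \<ominus>\<^bsub>G j\<^esub> x \<odot>\<^bsub>G j\<^esub> e' \<in> B p j"
        by (intro bexI[OF _ s(1)] bexI[OF _ z(1)]) simp
    qed
    then show False using e pP by (auto simp: survives_at_def)
  qed
  define A where "A = {J. ideal J R \<and> adjoin R p x \<subseteq> J \<and> (\<exists>e. survives_at P J (Suc j) e)}"
  have "\<exists>K\<in>A. \<forall>J\<in>A. K \<subseteq> J \<longrightarrow> J = K"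
  proof (rule ideal_maximal_element)
    show "A \<noteq> {}" using ex adjoin_ideal[OF ip xc] by (auto simp: A_def)
    show "\<And>J. J \<in> A \<Longrightarrow> ideal J R" by (simp add: A_def)
  qed
  then obtain K where K: "K \<in> A" "\<And>J. J \<in> A \<Longrightarrow> K \<subseteq> J \<Longrightarrow> J = K" by auto
  then have iK: "ideal K R" and sub: "adjoin R p x \<subseteq> K" by (auto simp: A_def)
  obtain z where z: "survives_at P K (Suc j) z" using K(1) by (auto simp: A_def)
  have zZ: "z \<in> Z K (Suc j)" and zn: "\<And>s. s \<in> carrier R - P \<Longrightarrow> s \<odot>\<^bsub>G (Suc j)\<^esub> z \<notin> B K (Suc j)"
    using z by (auto simp: survives_at_def)
  have zc: "z \<in> carrier (G (Suc j))" using Z_closed[OF zZ] .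
  note BK = M.submodule_closed[OF B_submodule[OF ideal_subset[OF iK], of "Suc j"]]
  have bigger: "\<exists>s\<in>carrier R - P. s \<odot>\<^bsub>G (Suc j)\<^esub> v \<in> B J (Suc j)"
    if "ideal J R" "K \<subseteq> J" "J \<noteq> K" "v \<in> Z J (Suc j)" for J v
  proof -
    have "J \<notin> A" using K(2)[of J] that by auto
    then show ?thesis using that sub by (auto simp: A_def survives_at_def)
  qed
  \<comment> \<open>Maximality of \<open>K\<close>: nothing supported at \<open>P\<close> comes from \<open>K + aR\<close>, so multiplication by an element \<open>a\<close> outside \<open>K\<close> does not
  kill the class, not even when its value is regarded in \<open>Ext\<^bsup>j+1\<^esup>(R/(K : a))\<close>.\<close>
  have torsion: False if a: "a \<in> carrier R" "a \<notin> K" and s: "s \<in> carrier R - P"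
    and b: "a \<odot>\<^bsub>G (Suc j)\<^esub> (s \<odot>\<^bsub>G (Suc j)\<^esub> z) \<in> B (colon R K a) (Suc j)" for a s
  proof -
    have sz: "s \<odot>\<^bsub>G (Suc j)\<^esub> z \<in> Z K (Suc j)"
      using zZ s M.submodule_closed(5)[OF Z_submodule[OF ideal_subset[OF iK]]] by simp
    obtain c where c: "c \<in> B K (Suc j)" "s \<odot>\<^bsub>G (Suc j)\<^esub> z \<ominus>\<^bsub>G (Suc j)\<^esub> c \<in> Z (adjoin R K a) (Suc j)"
      by (rule cocycle_reduce[OF iK a(1) sz b])
    obtain t where t: "t \<in> carrier R - P"
      "t \<odot>\<^bsub>G (Suc j)\<^esub> (s \<odot>\<^bsub>G (Suc j)\<^esub> z \<ominus>\<^bsub>G (Suc j)\<^esub> c) \<in> B (adjoin R K a) (Suc j)"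
      using bigger[OF adjoin_ideal[OF iK a(1)] adjoin_superset(1)[OF iK a(1)] _ c(2)]
        adjoin_superset(2)[OF iK a(1)] a(2) by auto
    then have "t \<odot>\<^bsub>G (Suc j)\<^esub> (s \<odot>\<^bsub>G (Suc j)\<^esub> z \<ominus>\<^bsub>G (Suc j)\<^esub> c) \<in> B K (Suc j)"
      using B_antimono[OF adjoin_superset(1)[OF iK a(1)]] by blast
    then have "t \<odot>\<^bsub>G (Suc j)\<^esub> (s \<odot>\<^bsub>G (Suc j)\<^esub> z \<ominus>\<^bsub>G (Suc j)\<^esub> c) \<oplus>\<^bsub>G (Suc j)\<^esub> t \<odot>\<^bsub>G (Suc j)\<^esub> c \<in> B K (Suc j)"
      using BK(3,5) c(1) t(1) by blast
    moreover have "t \<odot>\<^bsub>G (Suc j)\<^esub> (s \<odot>\<^bsub>G (Suc j)\<^esub> z \<ominus>\<^bsub>G (Suc j)\<^esub> c) \<oplus>\<^bsub>G (Suc j)\<^esub> t \<odot>\<^bsub>G (Suc j)\<^esub> c = (t \<otimes> s) \<odot>\<^bsub>G (Suc j)\<^esub> z"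
      using t s zc BK(2)[OF c(1)] by (simp add: M.smult_minus_distr M.minus_add_cancel M.smult_assoc1)
    ultimately show False using zn[OF primeideal_prod_notin[OF P t(1) s]] by simp
  qed
  have KP: "K \<subseteq> P"
  proof
    fix r assume r: "r \<in> K"
    then have rc: "r \<in> carrier R" using ideal_closed(2)[OF iK] by blast
    have "r \<odot>\<^bsub>G (Suc j)\<^esub> z = \<zero>\<^bsub>G (Suc j)\<^esub>" using zZ r by (simp add: Z_def kill_def)
    then show "r \<in> P" using zn[of r] rc BK(1) by auto
  qed
  have pK: "primeideal K R"
  proof (rule primeidealI[OF iK is_cring])
    show "carrier R \<noteq> K" using KP P.I_notcarr P.a_subset by blast
    fix a b assume ab: "a \<in> carrier R" "b \<in> carrier R" "a \<otimes> b \<in> K"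
    show "a \<in> K \<or> b \<in> K"
    proof (rule ccontr)
      assume n: "\<not> ?thesis"
      have az: "a \<odot>\<^bsub>G (Suc j)\<^esub> z \<in> Z (colon R K a) (Suc j)"
        using smult_kill_colon[OF iK ab(1)] zZ zc ab(1) by (auto simp: Z_def d_smult)
      have "colon R K a \<noteq> K" using ab n m_comm[of a b] by (auto simp: colon_def)
      then obtain s where s: "s \<in> carrier R - P" "s \<odot>\<^bsub>G (Suc j)\<^esub> (a \<odot>\<^bsub>G (Suc j)\<^esub> z) \<in> B (colon R K a) (Suc j)"
        using bigger[OF colon_ideal[OF iK ab(1)] colon_superset[OF iK ab(1)] _ az] by auto
      show False
        by (rule torsion[of a s]) (use n ab s zc in \<open>auto simp: M.smult_lcomm[of a s]\<close>)
    qed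
  qed
  have "survives_at K K (Suc j) z"
    unfolding survives_at_def
  proof (intro conjI ballI notI)
    show "z \<in> Z K (Suc j)" by (rule zZ)
    fix s assume s: "s \<in> carrier R - K" "s \<odot>\<^bsub>G (Suc j)\<^esub> z \<in> B K (Suc j)"
    show False
      by (rule torsion[of s \<one>]) (use s one zc colon_prime[OF pK, of s] in auto)
  qed
  moreover have "p \<subseteq> K" "x \<in> K" using sub adjoin_superset[OF ip xc] by auto
  ultimately show ?thesis using pK KP by blast
qed

text \<open>One exponent \<open>N\<close> that works for all the ideals \<open>p + a\<^sup>nR\<close> makes \<open>a\<^sup>N\<close> times \<open>Ext\<^sup>j(R/p)\<close> divisible by \<open>a\<close>
  within itself, so that Nakayama's lemma kills it. The ideal that matters is the one with \<open>n = N + 1\<close>, and the uniformity lets \<open>N\<close> be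
  known before \<open>n\<close> is chosen.\<close>

lemma survives_at_annihilator_contradiction:
  assumes acc: "acc (Z p j) (B p j) j"
    and p: "primeideal p R" and m: "primeideal m R" and pm: "p \<subseteq> m" and a: "a \<in> m" "a \<notin> p"
    and e: "survives_at p p j e"
    and N: "\<And>n z. z \<in> Z (adjoin R p (a [^] (n::nat))) (Suc j) \<Longrightarrow>
      a [^] (N::nat) \<odot>\<^bsub>G (Suc j)\<^esub> z \<in> B (adjoin R p (a [^] n)) (Suc j)"
  shows False
proof -
  interpret m: primeideal m R by (rule m)
  interpret p: primeideal p R by (rule p)
  have ip: "ideal p R" by (rule p.is_ideal)
  have ac: "a \<in> carrier R" using a(1) by (rule m.Icarr)
  have an: "a [^] (n::nat) \<notin> p" for n using primeideal_pow[OF p ac] a(2) by blast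
  define y where "y = a [^] Suc N"
  have y: "y \<in> carrier R" "colon R p y = p" using ac an colon_prime[OF p _ an, of "Suc N"] by (auto simp: y_def)
  define Y where "Y = (\<lambda>v. a [^] N \<odot>\<^bsub>G j\<^esub> v) ` Z p j"
  have one: "\<one> \<in> carrier R - m" using primeideal_one_notin[OF m] by simp
  note Zc = M.submodule_closed[OF Z_submodule[OF ideal_subset[OF ip], of j]]
  have eZ: "e \<in> Z p j" using e by (simp add: survives_at_def)
  have "\<exists>s\<in>carrier R - m. s \<odot>\<^bsub>G j\<^esub> (a [^] N \<odot>\<^bsub>G j\<^esub> e) \<in> B p j"
  proof (rule nakayama[OF acc ip m a(1), of Y])
    show "Y \<subseteq> Z p j" unfolding Y_def using Zc(5) ac by auto
    show "a [^] N \<odot>\<^bsub>G j\<^esub> e \<in> Y" unfolding Y_def using eZ by auto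
    fix u assume "u \<in> Y"
    then obtain v where v: "v \<in> Z p j" "u = a [^] N \<odot>\<^bsub>G j\<^esub> v" unfolding Y_def by auto
    obtain w where w: "w \<in> kill p j" "y \<odot>\<^bsub>G j\<^esub> w = v" "d j w \<in> Z (adjoin R p y) (Suc j)"
      using connecting[OF ip y(1), of v j] v y(2) by auto
    obtain z where z: "z \<in> Z p j" "y \<odot>\<^bsub>G j\<^esub> z = a [^] N \<odot>\<^bsub>G j\<^esub> (y \<odot>\<^bsub>G j\<^esub> w)"
      using connecting_boundary[OF ip y(1) w(1), of "a [^] N"] N[of "d j w" "Suc N"] w(3) ac
      by (auto simp: y_def)
    have "y \<odot>\<^bsub>G j\<^esub> z = a \<odot>\<^bsub>G j\<^esub> (a [^] N \<odot>\<^bsub>G j\<^esub> z)"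
      unfolding y_def using Zc(2)[OF z(1)] ac by (simp add: M.smult_assoc1[symmetric] m_comm[of _ a])
    then have "u = a \<odot>\<^bsub>G j\<^esub> (a [^] N \<odot>\<^bsub>G j\<^esub> z)" using z(2) w(2) v(2) by simp
    then have "\<one> \<odot>\<^bsub>G j\<^esub> u \<ominus>\<^bsub>G j\<^esub> a \<odot>\<^bsub>G j\<^esub> (a [^] N \<odot>\<^bsub>G j\<^esub> z) = \<zero>\<^bsub>G j\<^esub>"
      using Zc(2)[OF z(1)] ac by (simp add: M.minus_self_eq_zero)
    moreover have "a [^] N \<odot>\<^bsub>G j\<^esub> z \<in> Y" unfolding Y_def using z by auto
    moreover have "\<zero>\<^bsub>G j\<^esub> \<in> B p j" by (rule M.submodule_closed(1)[OF B_submodule[OF ideal_subset[OF ip]]])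
    ultimately show "\<exists>s\<in>carrier R - m. \<exists>e'\<in>Y. s \<odot>\<^bsub>G j\<^esub> u \<ominus>\<^bsub>G j\<^esub> a \<odot>\<^bsub>G j\<^esub> e' \<in> B p j"
      by (intro bexI[OF _ one] bexI[of _ "a [^] N \<odot>\<^bsub>G j\<^esub> z"]) simp_all
  qed
  then obtain s where s: "s \<in> carrier R - m" "s \<odot>\<^bsub>G j\<^esub> (a [^] N \<odot>\<^bsub>G j\<^esub> e) \<in> B p j" by blast
  then have "(s \<otimes> a [^] N) \<odot>\<^bsub>G j\<^esub> e \<in> B p j" using ac Zc(2)[OF eZ] by (simp add: M.smult_assoc1)
  moreover have "s \<otimes> a [^] N \<in> carrier R - p"
    using primeideal_prod_notin[OF p, of s "a [^] N"] s(1) pm ac an by auto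
  ultimately show False using e by (auto simp: survives_at_def)
qed

end

section \<open>Injective modules and modules of finite length\<close>

lemma chain_length_ge:
  assumes "\<And>i. i \<le> n \<Longrightarrow> c i \<in> F" "\<And>i. i < n \<Longrightarrow> c i \<subset> c (Suc i)"
  shows "enat n \<le> chain_length F"
  unfolding chain_length_def using assms by (intro Sup_upper) blast

text \<open>The supremum of lengths is attained at every finite value: if all chains had length at most \<open>n - 1\<close>, so would be the
  supremum.\<close>

lemma chain_length_ge_imp:
  assumes "enat n \<le> chain_length F" "n > 0"
  shows "\<exists>c. (\<forall>i\<le>n. c i \<in> F) \<and> (\<forall>i<n. c i \<subset> c (Suc i))"
proof (rule ccontr)
  assume no: "\<not> ?thesis"
  have "chain_length F \<le> enat (n - 1)"
    unfolding chain_length_def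
  proof (rule Sup_least)
    fix l assume "l \<in> {enat n | n. \<exists>c :: nat \<Rightarrow> 'a set. (\<forall>i\<le>n. c i \<in> F) \<and> (\<forall>i<n. c i \<subset> c (Suc i))}"
    then obtain k c where k: "l = enat k" "\<forall>i\<le>k. c i \<in> F" "\<forall>i<k. c i \<subset> c (Suc i)" by blast
    have "k < n"
    proof (rule ccontr)
      assume "\<not> k < n"
      then have "(\<forall>i\<le>n. c i \<in> F) \<and> (\<forall>i<n. c i \<subset> c (Suc i))" using k by auto
      then show False using no by blast
    qed
    then show "l \<le> enat (n - 1)" using k by simp
  qed
  then have "enat n \<le> enat (n - 1)" using assms(1) by (rule order_trans[rotated])
  then show False using assms(2) by simp
qed

lemma (in module) abelian_subgroup_of_submodule:
  assumes "submodule N R M" shows "abelian_subgroup N M"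
  using assms M.abelian_group_axioms
  by (intro abelian_subgroupI3 additive_subgroup.intro) (simp_all add: submodule_def)

lemma (in module) image_submodule_quotient:
  assumes N: "submodule N R M" and C: "submodule C R M"
  shows "submodule ((\<lambda>x. N +>\<^bsub>M\<^esub> x) ` C) R (quotient_module M N)"
proof -
  interpret N: abelian_subgroup N M by (rule abelian_subgroup_of_submodule[OF N])
  note n = submodule_closed[OF N] and c = submodule_closed[OF C]
  let ?Q = "quotient_module M N"
  have Q: "subgroup H (add_monoid ?Q) \<longleftrightarrow> subgroup H (M A_Mod N)" for H
    by (simp add: subgroup_def m_inv_def quotient_module_def A_FactGroup_def')
  have smult: "r \<odot>\<^bsub>?Q\<^esub> (N +>\<^bsub>M\<^esub> x) = N +>\<^bsub>M\<^esub> (r \<odot>\<^bsub>M\<^esub> x)" if r: "r \<in> carrier R" and x: "x \<in> carrier M" for r x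
  proof -
    have "N +>\<^bsub>M\<^esub> (r \<odot>\<^bsub>M\<^esub> u) = N +>\<^bsub>M\<^esub> (r \<odot>\<^bsub>M\<^esub> x)" if u: "u \<in> N +>\<^bsub>M\<^esub> x" for u
    proof -
      obtain h where h: "h \<in> N" "u = h \<oplus>\<^bsub>M\<^esub> x" using u by (auto simp: a_r_coset_def')
      have "r \<odot>\<^bsub>M\<^esub> u = r \<odot>\<^bsub>M\<^esub> h \<oplus>\<^bsub>M\<^esub> r \<odot>\<^bsub>M\<^esub> x" using h r x n by (simp add: smult_r_distr)
      then have "r \<odot>\<^bsub>M\<^esub> u \<in> N +>\<^bsub>M\<^esub> (r \<odot>\<^bsub>M\<^esub> x)" using n(5)[OF r h(1)] by (auto simp: a_r_coset_def')
      then show ?thesis using M.a_repr_independence[of "r \<odot>\<^bsub>M\<^esub> u" N "r \<odot>\<^bsub>M\<^esub> x"] r x N.a_subgroup by simp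
    qed
    then have "(\<Union>u\<in>N +>\<^bsub>M\<^esub> x. N +>\<^bsub>M\<^esub> (r \<odot>\<^bsub>M\<^esub> u)) = N +>\<^bsub>M\<^esub> (r \<odot>\<^bsub>M\<^esub> x)"
      using N.a_rcos_self[OF x] by (intro UN_constant_eq) blast+
    then show ?thesis by (simp add: quotient_module_def)
  qed
  have "subgroup ((\<lambda>x. N +>\<^bsub>M\<^esub> x) ` C) (add_monoid ?Q)"
    unfolding Q
  proof
    show "(\<lambda>x. N +>\<^bsub>M\<^esub> x) ` C \<subseteq> carrier (M A_Mod N)"
      using c(2) M.a_rcosetsI[OF N.a_subset] by (auto simp: A_FactGroup_def')
    have "N +>\<^bsub>M\<^esub> \<zero>\<^bsub>M\<^esub> = N" by (rule M.a_coset_add_zero[OF N.a_subset])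
    then show "\<one>\<^bsub>M A_Mod N\<^esub> \<in> (\<lambda>x. N +>\<^bsub>M\<^esub> x) ` C" using c(1) by (auto simp: A_FactGroup_def' intro: image_eqI[of _ _ "\<zero>\<^bsub>M\<^esub>"])
  next
    fix U V assume U: "U \<in> (\<lambda>x. N +>\<^bsub>M\<^esub> x) ` C"
    then obtain x where x: "x \<in> C" "U = N +>\<^bsub>M\<^esub> x" by auto
    have "U \<in> carrier (M A_Mod N)" using x c(2) M.a_rcosetsI[OF N.a_subset] by (auto simp: A_FactGroup_def')
    then have "inv\<^bsub>M A_Mod N\<^esub> U = N +>\<^bsub>M\<^esub> (\<ominus>\<^bsub>M\<^esub> x)"
      using N.a_inv_FactGroup N.a_rcos_inv[of x] x c(2) by simp
    then show "inv\<^bsub>M A_Mod N\<^esub> U \<in> (\<lambda>x. N +>\<^bsub>M\<^esub> x) ` C" using submoduleE(3)[OF C x(1)] by auto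
    assume "V \<in> (\<lambda>x. N +>\<^bsub>M\<^esub> x) ` C"
    then obtain y where y: "y \<in> C" "V = N +>\<^bsub>M\<^esub> y" by auto
    have "U \<otimes>\<^bsub>M A_Mod N\<^esub> V = N +>\<^bsub>M\<^esub> (x \<oplus>\<^bsub>M\<^esub> y)" using x y c(2) N.a_rcos_sum by simp
    then show "U \<otimes>\<^bsub>M A_Mod N\<^esub> V \<in> (\<lambda>x. N +>\<^bsub>M\<^esub> x) ` C" using c(3)[OF x(1) y(1)] by auto
  qed
  then show ?thesis
    unfolding submodule_def submodule_axioms_def using smult c(2,5) by auto
qed

text \<open>In a torsion module of finite length the exponents are bounded: the submodules killed by \<open>a\<^sup>k\<close> modulo \<open>N\<close> ascend
  with \<open>k\<close>, and once two consecutive ones agree, all later ones do.\<close>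

lemma (in module) finite_length_torsion_exponent:
  assumes N: "submodule N R M" and a: "a \<in> carrier R"
    and torsion: "\<And>x. x \<in> carrier M \<Longrightarrow> \<exists>n::nat. a [^] n \<odot>\<^bsub>M\<^esub> x \<in> N"
    and len: "module_length R (quotient_module M N) < \<infinity>"
  shows "\<exists>n::nat. \<forall>x\<in>carrier M. a [^] n \<odot>\<^bsub>M\<^esub> x \<in> N"
proof -
  interpret N: abelian_subgroup N M by (rule abelian_subgroup_of_submodule[OF N])
  note n = submodule_closed[OF N]
  define C where "C k = {x \<in> carrier M. a [^] (k::nat) \<odot>\<^bsub>M\<^esub> x \<in> N}" for k
  have C: "submodule (C k) R M" for k
    by (rule submoduleI_cring)
       (use a n in \<open>auto simp: C_def smult_r_distr smult_lcomm[of "a [^] k"]\<close>)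
  have C_Suc: "C k \<subseteq> C (Suc k)" for k
  proof
    fix x assume x: "x \<in> C k"
    then have "a \<odot>\<^bsub>M\<^esub> (a [^] k \<odot>\<^bsub>M\<^esub> x) \<in> N" using n(5)[OF a] by (simp add: C_def)
    then show "x \<in> C (Suc k)"
      using x a nat_pow_Suc2[OF a, of k] by (simp add: C_def smult_assoc1 del: nat_pow_Suc)
  qed
  have NC: "N \<subseteq> C k" for k using a n by (auto simp: C_def)
  have "\<exists>k. C (Suc k) = C k"
  proof (rule ccontr)
    assume no: "\<not> ?thesis"
    define D where "D k = (\<lambda>x. N +>\<^bsub>M\<^esub> x) ` C k" for k
    have "D k \<subset> D (Suc k)" for k
    proof -
      obtain x where x: "x \<in> C (Suc k)" "x \<notin> C k" using no C_Suc by blast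
      have "N +>\<^bsub>M\<^esub> x \<notin> D k"
      proof
        assume "N +>\<^bsub>M\<^esub> x \<in> D k"
        then obtain z where z: "z \<in> C k" "N +>\<^bsub>M\<^esub> x = N +>\<^bsub>M\<^esub> z" unfolding D_def by auto
        have "x \<in> N +>\<^bsub>M\<^esub> z" using N.a_rcos_self[of x] x z(2) by (auto simp: C_def)
        then obtain h where "h \<in> N" "x = h \<oplus>\<^bsub>M\<^esub> z" by (auto simp: a_r_coset_def')
        then show False using x(2) NC[of k] submodule_closed(3)[OF C[of k], of h z] z(1) by blast
      qed
      moreover have "N +>\<^bsub>M\<^esub> x \<in> D (Suc k)" using x(1) by (auto simp: D_def)
      moreover have "D k \<subseteq> D (Suc k)" using C_Suc by (auto simp: D_def)
      ultimately show ?thesis by blast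
    qed
    moreover have "submodule (D k) R (quotient_module M N)" for k
      unfolding D_def by (rule image_submodule_quotient[OF N C])
    ultimately have "enat k \<le> module_length R (quotient_module M N)" for k
      unfolding module_length_def by (intro chain_length_ge[of _ D]) auto
    then show False using len by (metis enat_ord_simps(2) enat.exhaust leD lessI less_infinityE)
  qed
  then obtain k where k: "C (Suc k) = C k" by blast
  have stable: "C (k + l) = C k" for l
  proof (induction l)
    case (Suc l)
    have "C (Suc (k + l)) \<subseteq> C k"
    proof
      fix x assume x: "x \<in> C (Suc (k + l))"
      then have xc: "x \<in> carrier M" by (simp add: C_def)
      have "a [^] (k + l) \<odot>\<^bsub>M\<^esub> (a \<odot>\<^bsub>M\<^esub> x) \<in> N"
        using x xc a by (simp add: C_def smult_assoc1)
      then have "a \<odot>\<^bsub>M\<^esub> x \<in> C k" using Suc.IH xc a by (auto simp: C_def)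
      then have "x \<in> C (Suc k)" using xc a by (simp add: C_def smult_assoc1)
      then show "x \<in> C k" using k by simp
    qed
    moreover have "C k \<subseteq> C (Suc (k + l))" using Suc.IH C_Suc[of "k + l"] by auto
    ultimately show ?case by auto
  qed simp
  have "a [^] k \<odot>\<^bsub>M\<^esub> x \<in> N" if x: "x \<in> carrier M" for x
  proof -
    obtain l :: nat where "a [^] l \<odot>\<^bsub>M\<^esub> x \<in> N" using torsion[OF x] by blast
    then have "x \<in> C l" using x by (simp add: C_def)
    moreover have "C l \<subseteq> C (k + l)" using lift_Suc_mono_le[of C, OF C_Suc] by simp
    ultimately have "x \<in> C k" using stable[of l] by auto
    then show ?thesis by (simp add: C_def)
  qed
  then show ?thesis by blast
qed

lemma (in abelian_group) add_eq_add_minus: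
  assumes "a \<in> carrier G" "b \<in> carrier G" "c \<in> carrier G" "e \<in> carrier G" "a \<oplus> b = c \<oplus> e"
  shows "b \<ominus> e = c \<ominus> a"
proof -
  have "b \<ominus> e = ((b \<ominus> e) \<oplus> a) \<ominus> a" using assms(1-4) by (simp add: minus_add_cancel)
  also have "(b \<ominus> e) \<oplus> a = (a \<oplus> b) \<ominus> e" using assms(1-4) by (simp add: minus_eq a_ac)
  also have "\<dots> = c" using assms by (simp add: minus_add_cancel)
  finally show ?thesis .
qed

lemma (in cring) ring_as_module_module: "module R (ring_as_module R)"
proof (rule moduleI[OF is_cring])
  show "abelian_group (ring_as_module R)"
    by (rule abelian_groupI)
       (auto simp: ring_as_module_def a_ac intro!: bexI[of _ "\<ominus> x" for x] l_neg)
qed (auto simp: ring_as_module_def l_distr r_distr m_assoc)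

lemma (in cring) ideal_submodule_ring_as_module:
  assumes "ideal A R" shows "submodule A R (ring_as_module R)"
proof -
  interpret B: module R "ring_as_module R" by (rule ring_as_module_module)
  show ?thesis
    by (rule B.submoduleI_cring) (use ideal_closed[OF assms] in \<open>auto simp: ring_as_module_def\<close>)
qed

text \<open>Injectivity, applied to the inclusion of \<open>A\<close> into \<open>R\<close>; a homomorphism on \<open>R\<close> is determined by its value at 1.\<close>

lemma (in cring) injective_module_extends:
  assumes E: "injective_module R E" and A: "ideal A R"
    and f: "\<And>x. x \<in> A \<Longrightarrow> f x \<in> carrier E"
    "\<And>x y. x \<in> A \<Longrightarrow> y \<in> A \<Longrightarrow> f (x \<oplus> y) = f x \<oplus>\<^bsub>E\<^esub> f y"
    "\<And>r x. r \<in> carrier R \<Longrightarrow> x \<in> A \<Longrightarrow> f (r \<otimes> x) = r \<odot>\<^bsub>E\<^esub> f x"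
  shows "\<exists>e\<in>carrier E. \<forall>x\<in>A. f x = x \<odot>\<^bsub>E\<^esub> e"
proof -
  let ?B = "ring_as_module R"
  have "f \<in> linear_maps R (?B\<lparr>carrier := A\<rparr>) E"
    using f by (auto simp: linear_maps_def ring_as_module_def)
  then obtain g where g: "g \<in> linear_maps R ?B E" "\<And>x. x \<in> A \<Longrightarrow> g x = f x"
    using E ring_as_module_module ideal_submodule_ring_as_module[OF A]
    unfolding injective_module_def by blast
  have "f x = x \<odot>\<^bsub>E\<^esub> g \<one>" if x: "x \<in> A" for x
  proof -
    have xc: "x \<in> carrier R" using ideal_closed(2)[OF A x] .
    have "\<forall>r\<in>carrier R. \<forall>z\<in>carrier R. g (r \<otimes> z) = r \<odot>\<^bsub>E\<^esub> g z"
      using g(1) by (auto simp: linear_maps_def ring_as_module_def)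
    then have "g (x \<otimes> \<one>) = x \<odot>\<^bsub>E\<^esub> g \<one>" using xc one_closed by blast
    then show ?thesis using g(2)[OF x] xc by simp
  qed
  moreover have "g \<one> \<in> carrier E" using g(1) by (auto simp: linear_maps_def ring_as_module_def)
  ultimately show ?thesis by blast
qed

text \<open>The homomorphism to be extended is defined on \<open>J + yR\<close> and sends \<open>j + r y\<close> to \<open>r e\<close>; it is well defined because
  \<open>(J : y)\<close> kills \<open>e\<close>.\<close>

lemma (in cring) injective_module_divisible:
  assumes E: "injective_module R E" and J: "ideal J R" and y: "y \<in> carrier R" and e: "e \<in> carrier E"
    and kill: "\<And>r. r \<in> colon R J y \<Longrightarrow> r \<odot>\<^bsub>E\<^esub> e = \<zero>\<^bsub>E\<^esub>"
  shows "\<exists>e'\<in>carrier E. (\<forall>r\<in>J. r \<odot>\<^bsub>E\<^esub> e' = \<zero>\<^bsub>E\<^esub>) \<and> y \<odot>\<^bsub>E\<^esub> e' = e"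
proof -
  interpret E: module R E using E by (simp add: injective_module_def)
  note Jc = ideal_closed[OF J]
  have wd: "r \<odot>\<^bsub>E\<^esub> e = r' \<odot>\<^bsub>E\<^esub> e"
    if "j \<in> J" "j' \<in> J" "r \<in> carrier R" "r' \<in> carrier R" "j \<oplus> r \<otimes> y = j' \<oplus> r' \<otimes> y" for j j' r r'
  proof -
    have jc: "j \<in> carrier R" "j' \<in> carrier R" using that Jc by auto
    have "(r \<ominus> r') \<otimes> y = j' \<ominus> j"
      using add_eq_add_minus[of j "r \<otimes> y" j' "r' \<otimes> y"] that jc y
      by (simp add: minus_eq l_distr l_minus)
    then have "r \<ominus> r' \<in> colon R J y" using that Jc by (auto simp: colon_def)
    then have "r \<odot>\<^bsub>E\<^esub> e \<ominus>\<^bsub>E\<^esub> r' \<odot>\<^bsub>E\<^esub> e = \<zero>\<^bsub>E\<^esub>" using kill that e by (simp add: E.smult_minus_distl[symmetric])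
    then show ?thesis using E.M.eq_of_minus_eq_zero that e by simp
  qed
  define f where "f x = (THE v. \<exists>j\<in>J. \<exists>r\<in>carrier R. x = j \<oplus> r \<otimes> y \<and> v = r \<odot>\<^bsub>E\<^esub> e)" for x
  have f: "f (j \<oplus> r \<otimes> y) = r \<odot>\<^bsub>E\<^esub> e" if "j \<in> J" "r \<in> carrier R" for j r
    unfolding f_def
  proof (rule the_equality)
    show "\<exists>j'\<in>J. \<exists>r'\<in>carrier R. j \<oplus> r \<otimes> y = j' \<oplus> r' \<otimes> y \<and> r \<odot>\<^bsub>E\<^esub> e = r' \<odot>\<^bsub>E\<^esub> e"
      using that by blast
    fix v assume "\<exists>j'\<in>J. \<exists>r'\<in>carrier R. j \<oplus> r \<otimes> y = j' \<oplus> r' \<otimes> y \<and> v = r' \<odot>\<^bsub>E\<^esub> e"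
    then obtain j' r' where v: "j' \<in> J" "r' \<in> carrier R" "j \<oplus> r \<otimes> y = j' \<oplus> r' \<otimes> y" "v = r' \<odot>\<^bsub>E\<^esub> e" by blast
    show "v = r \<odot>\<^bsub>E\<^esub> e" using wd[OF that(1) v(1) that(2) v(2,3)] v(4) by simp
  qed
  note iA = adjoin_ideal[OF J y]
  have "\<exists>e'\<in>carrier E. \<forall>x\<in>adjoin R J y. f x = x \<odot>\<^bsub>E\<^esub> e'"
  proof (rule injective_module_extends[OF E iA])
    fix x assume "x \<in> adjoin R J y"
    then obtain j r where x: "j \<in> J" "r \<in> carrier R" "x = j \<oplus> r \<otimes> y" by (auto simp: adjoin_def)
    show "f x \<in> carrier E" using x f e by simp
    have jc: "j \<in> carrier R" using x Jc by auto
    { fix x' assume "x' \<in> adjoin R J y"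
      then obtain j' r' where x': "j' \<in> J" "r' \<in> carrier R" "x' = j' \<oplus> r' \<otimes> y" by (auto simp: adjoin_def)
      have jc': "j' \<in> carrier R" using x' Jc by auto
      have "x \<oplus> x' = (j \<oplus> j') \<oplus> (r \<oplus> r') \<otimes> y" using x x' jc jc' y by (simp add: l_distr a_ac)
      then show "f (x \<oplus> x') = f x \<oplus>\<^bsub>E\<^esub> f x'" using x x' f Jc e by (simp add: E.smult_l_distr) }
    { fix t assume t: "t \<in> carrier R"
      have "t \<otimes> x = t \<otimes> j \<oplus> (t \<otimes> r) \<otimes> y" using x t jc y by (simp add: r_distr m_assoc)
      then show "f (t \<otimes> x) = t \<odot>\<^bsub>E\<^esub> f x" using x t f Jc e by (simp add: E.smult_assoc1) }
  qed
  then obtain e' where e': "e' \<in> carrier E" "\<And>x. x \<in> adjoin R J y \<Longrightarrow> f x = x \<odot>\<^bsub>E\<^esub> e'" by blast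
  have "r \<odot>\<^bsub>E\<^esub> e' = \<zero>\<^bsub>E\<^esub>" if "r \<in> J" for r
  proof -
    have "r \<in> adjoin R J y" using adjoin_superset(1)[OF J y] that by blast
    then show ?thesis using e'(2) f[OF that zero_closed] that Jc e y by simp
  qed
  moreover have "y \<odot>\<^bsub>E\<^esub> e' = e"
  proof -
    have "y \<in> adjoin R J y" by (rule adjoin_superset(2)[OF J y])
    then show ?thesis using e'(2) f[OF Jc(1) one_closed] e y by simp
  qed
  ultimately show ?thesis using e'(1) by blast
qed

section \<open>Local cohomology of a Noetherian local domain\<close>

sublocale noetherian_domain \<subseteq> noetherian_cring
  by unfold_locales

locale noetherian_local_domain = noetherian_domain +
  fixes m
  assumes maximal: "maximalideal m R" and unique: "maximalideal m' R \<Longrightarrow> m' = m"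

context noetherian_local_domain
begin

lemma m_ideal: "ideal m R" using maximal by (rule maximalideal.axioms)

lemma m_prime: "primeideal m R" by (rule maximalideal_prime[OF maximal])

lemma m_closed [simp]: "a \<in> m \<Longrightarrow> a \<in> carrier R" using ideal_closed(2)[OF m_ideal] .

lemma proper_ideal_subset_m:
  assumes "ideal I R" "I \<noteq> carrier R"
  shows "I \<subseteq> m"
proof -
  define A where "A = {J. ideal J R \<and> I \<subseteq> J \<and> J \<noteq> carrier R}"
  have "\<exists>M\<in>A. \<forall>J\<in>A. M \<subseteq> J \<longrightarrow> J = M"
    by (rule ideal_maximal_element) (use assms in \<open>auto simp: A_def\<close>)
  then obtain M where M: "M \<in> A" "\<And>J. J \<in> A \<Longrightarrow> M \<subseteq> J \<Longrightarrow> J = M" by blast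
  have "maximalideal M R"
  proof (rule maximalidealI)
    show "ideal M R" "carrier R \<noteq> M" using M(1) by (auto simp: A_def)
    fix J assume J: "ideal J R" "M \<subseteq> J" "J \<subseteq> carrier R"
    show "J = M \<or> J = carrier R" using M(1) M(2)[of J] J by (auto simp: A_def)
  qed
  then show ?thesis using unique M(1) by (auto simp: A_def)
qed

lemma unit_if_notin_m:
  assumes "a \<in> carrier R" "a \<notin> m" shows "a \<in> Units R"
proof -
  have "PIdl a = carrier R"
    using proper_ideal_subset_m[OF cgenideal_ideal[OF assms(1)]] cgenideal_self[OF assms(1)] assms(2) by blast
  then obtain b where "b \<in> carrier R" "\<one> = b \<otimes> a" by (auto simp: cgenideal_def)
  then show ?thesis using assms(1) m_comm[of a b] unfolding Units_def by auto
qed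

lemma prime_subset_m: "primeideal P R \<Longrightarrow> P \<subseteq> m"
  using proper_ideal_subset_m primeideal.I_notcarr primeideal.axioms(1) by blast

end

locale resolved_domain = noetherian_local_domain +
  fixes \<epsilon> :: "'a \<Rightarrow> 'c" and E :: "nat \<Rightarrow> ('a, 'c) module" and d :: "nat \<Rightarrow> 'c \<Rightarrow> 'c"
  assumes res: "injective_resolution R (ring_as_module R) \<epsilon> E d"
begin

lemma E_injective: "injective_module R (E i)"
  using res by (simp add: injective_resolution_def)

lemma eps: "\<epsilon> \<in> linear_maps R (ring_as_module R) (E 0)"
  and d_lin: "d i \<in> linear_maps R (E i) (E (Suc i))"
  and eps_inj: "inj_on \<epsilon> (carrier R)"
  and eps_image: "\<epsilon> ` carrier R = {x \<in> carrier (E 0). d 0 x = \<zero>\<^bsub>E 1\<^esub>}"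
  and exact: "d i ` carrier (E i) = {x \<in> carrier (E (Suc i)). d (Suc i) x = \<zero>\<^bsub>E (Suc (Suc i))\<^esub>}"
  using res by (simp_all add: injective_resolution_def) (simp_all add: ring_as_module_def)

end

sublocale resolved_domain \<subseteq> divisible_complex R E d
proof (rule divisible_complex.intro[OF noetherian_cring_axioms], rule divisible_complex_axioms.intro, goal_cases)
  case (1 i)
  show ?case using E_injective by (simp add: injective_module_def)
next
  case (2 i)
  show ?case by (rule d_lin)
next
  case (3 x i)
  then show ?case using exact[of i] by blast
next
  case (4 J y e i)
  then show ?case by (rule injective_module_divisible[OF E_injective])
qed

context resolved_domain
begin

lemma eps_simps: "x \<in> carrier R \<Longrightarrow> \<epsilon> x \<in> carrier (E 0)"
  "x \<in> carrier R \<Longrightarrow> y \<in> carrier R \<Longrightarrow> \<epsilon> (x \<oplus> y) = \<epsilon> x \<oplus>\<^bsub>E 0\<^esub> \<epsilon> y"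
  "x \<in> carrier R \<Longrightarrow> y \<in> carrier R \<Longrightarrow> \<epsilon> (x \<otimes> y) = x \<odot>\<^bsub>E 0\<^esub> \<epsilon> y"
  "x \<in> carrier R \<Longrightarrow> d 0 (\<epsilon> x) = \<zero>\<^bsub>E 1\<^esub>"
  using eps eps_image by (auto simp: linear_maps_def ring_as_module_def)

lemma eps_zero: "\<epsilon> \<zero> = \<zero>\<^bsub>E 0\<^esub>"
  using eps_simps(3)[of \<zero> \<zero>] eps_simps(1) by simp

lemma kill_zero: "kill {\<zero>} i = carrier (E i)"
  by (auto simp: kill_def)

lemma Z_zero_0: "Z {\<zero>} 0 = \<epsilon> ` carrier R"
  by (simp add: Z_def kill_zero eps_image)

lemma Z_zero_Suc: "Z {\<zero>} (Suc k) = B {\<zero>} (Suc k)"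
  by (simp add: Z_def B_simps kill_zero exact)

text \<open>Here the domain enters through its Noetherian property: \<open>Ext\<^sup>0(R/0)\<close> is \<open>R\<close> itself, and submodules correspond to ideals under \<open>\<epsilon>\<close>.\<close>

lemma acc_zero: "acc (Z {\<zero>} 0) (B {\<zero>} 0) 0"
  unfolding acc_def
proof (intro allI impI)
  fix S :: "nat \<Rightarrow> 'c set"
  assume *: "\<forall>n. submodule (S n) R (E 0) \<and> B {\<zero>} 0 \<subseteq> S n \<and> S n \<subseteq> Z {\<zero>} 0 \<and> S n \<subseteq> S (Suc n)"
  then have S: "\<And>n. submodule (S n) R (E 0)" "\<And>n. S n \<subseteq> \<epsilon> ` carrier R" "\<And>n. S n \<subseteq> S (Suc n)"
    by (auto simp: Z_zero_0)
  define I where "I n = {x \<in> carrier R. \<epsilon> x \<in> S n}" for n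
  have SI: "S n = \<epsilon> ` I n" for n using S(2)[of n] by (auto simp: I_def)
  have "\<exists>n. \<forall>m\<ge>n. I m = I n"
  proof (rule ideal_sequence_stabilizes)
    fix n
    note c = M.submodule_closed[OF S(1)[of n]]
    show "ideal (I n) R"
      by (rule idealI_cring) (auto simp: I_def eps_simps eps_zero c)
    show "I n \<subseteq> I (Suc n)" using S(3) by (auto simp: I_def)
  qed
  then show "\<exists>n. \<forall>m\<ge>n. S m = S n" unfolding SI by metis
qed

lemma acc_Z: "ideal J R \<Longrightarrow> acc (Z J i) (B J i) i"
  by (rule acc_cohomology[OF acc_zero Z_zero_Suc])

text \<open>The subcomplex of \<open>m\<close>-torsion elements, whose cohomology is local cohomology.\<close>

definition \<Gamma> :: "nat \<Rightarrow> ('a, 'c) module" where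
  "\<Gamma> i = E i\<lparr>carrier := torsion R m (E i)\<rparr>"

lemma torsion_submodule: "submodule (torsion R m (E i)) R (E i)"
proof (rule M.submoduleI_cring)
  have pc: "r \<in> carrier R" if "r \<in> ideal_power R m n" for r n
    using ideal_closed(2)[OF ideal_power_ideal[OF m_ideal] that] .
  show "torsion R m (E i) \<subseteq> carrier (E i)" by (auto simp: torsion_def)
  show "\<zero>\<^bsub>E i\<^esub> \<in> torsion R m (E i)" using pc by (auto simp: torsion_def)
  fix x assume x: "x \<in> torsion R m (E i)"
  then obtain n where n: "x \<in> carrier (E i)" "\<And>r. r \<in> ideal_power R m n \<Longrightarrow> r \<odot>\<^bsub>E i\<^esub> x = \<zero>\<^bsub>E i\<^esub>"
    by (auto simp: torsion_def)
  show "a \<odot>\<^bsub>E i\<^esub> x \<in> torsion R m (E i)" if a: "a \<in> carrier R" for a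
    using n a pc by (auto simp: torsion_def M.smult_lcomm[of _ a] intro!: exI[of _ n])
  fix y assume y: "y \<in> torsion R m (E i)"
  then obtain n' where n': "y \<in> carrier (E i)" "\<And>r. r \<in> ideal_power R m n' \<Longrightarrow> r \<odot>\<^bsub>E i\<^esub> y = \<zero>\<^bsub>E i\<^esub>"
    by (auto simp: torsion_def)
  have "\<forall>r\<in>ideal_power R m (n + n'). r \<odot>\<^bsub>E i\<^esub> (x \<oplus>\<^bsub>E i\<^esub> y) = \<zero>\<^bsub>E i\<^esub>"
  proof
    fix r assume r: "r \<in> ideal_power R m (n + n')"
    have "r \<in> ideal_power R m n" "r \<in> ideal_power R m n'"
      using r ideal_power_antimono[OF m_ideal, of n "n + n'"] ideal_power_antimono[OF m_ideal, of n' "n + n'"] by auto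
    then show "r \<odot>\<^bsub>E i\<^esub> (x \<oplus>\<^bsub>E i\<^esub> y) = \<zero>\<^bsub>E i\<^esub>"
      using n n' pc[OF r] by (simp add: M.smult_r_distr)
  qed
  then show "x \<oplus>\<^bsub>E i\<^esub> y \<in> torsion R m (E i)" using n(1) n'(1) by (auto simp: torsion_def)
qed

lemma d_torsion: "x \<in> torsion R m (E i) \<Longrightarrow> d i x \<in> torsion R m (E (Suc i))"
proof -
  assume "x \<in> torsion R m (E i)"
  then obtain n where n: "x \<in> carrier (E i)" "\<And>r. r \<in> ideal_power R m n \<Longrightarrow> r \<odot>\<^bsub>E i\<^esub> x = \<zero>\<^bsub>E i\<^esub>"
    by (auto simp: torsion_def)
  have "r \<odot>\<^bsub>E (Suc i)\<^esub> d i x = \<zero>\<^bsub>E (Suc i)\<^esub>" if "r \<in> ideal_power R m n" for r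
    using n that ideal_closed(2)[OF ideal_power_ideal[OF m_ideal] that] d_smult[of r x i] by simp
  then show ?thesis using n(1) by (auto simp: torsion_def)
qed

text \<open>The torsion part of an injective module is again divisible. Enlarge \<open>J\<close> to an ideal \<open>K\<close> that is maximal
  among those for which \<open>(K : y)\<close> still kills \<open>e\<close>, and solve the equation for \<open>K\<close>. By maximality \<open>K\<close> is the whole
  annihilator of the solution \<open>e'\<close>. If some \<open>r \<in> m\<close> had no power in \<open>K\<close>, a high power \<open>c\<close> of \<open>r\<close> would
  satisfy \<open>c y \<in> K\<close> and \<open>(K : c\<^sup>2) = (K : c)\<close>, and \<open>K + cR\<close> would be a larger admissible ideal. So \<open>K\<close>
  contains a power of \<open>m\<close>, and \<open>e'\<close> is a torsion element.\<close>

lemma torsion_divisible: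
  assumes J: "ideal J R" and y: "y \<in> carrier R" and e: "e \<in> torsion R m (E i)"
    and ann: "\<And>r. r \<in> colon R J y \<Longrightarrow> r \<odot>\<^bsub>E i\<^esub> e = \<zero>\<^bsub>E i\<^esub>"
  shows "\<exists>e'\<in>torsion R m (E i). (\<forall>r\<in>J. r \<odot>\<^bsub>E i\<^esub> e' = \<zero>\<^bsub>E i\<^esub>) \<and> y \<odot>\<^bsub>E i\<^esub> e' = e"
proof -
  obtain s where ec: "e \<in> carrier (E i)" and s: "\<And>r. r \<in> ideal_power R m s \<Longrightarrow> r \<odot>\<^bsub>E i\<^esub> e = \<zero>\<^bsub>E i\<^esub>"
    using e by (auto simp: torsion_def)
  define A where "A = {K. ideal K R \<and> J \<subseteq> K \<and> (\<forall>r\<in>colon R K y. r \<odot>\<^bsub>E i\<^esub> e = \<zero>\<^bsub>E i\<^esub>)}"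
  have "\<exists>K\<in>A. \<forall>I\<in>A. K \<subseteq> I \<longrightarrow> I = K"
    by (rule ideal_maximal_element) (use J ann in \<open>auto simp: A_def\<close>)
  then obtain K where K: "K \<in> A" "\<And>I. I \<in> A \<Longrightarrow> K \<subseteq> I \<Longrightarrow> I = K" by blast
  then have iK: "ideal K R" and JK: "J \<subseteq> K" by (auto simp: A_def)
  have "e \<in> kill (colon R K y) i" using K(1) ec by (auto simp: A_def kill_def)
  then obtain e' where e': "e' \<in> kill K i" "y \<odot>\<^bsub>E i\<^esub> e' = e" by (rule kill_divisible[OF iK y])
  have e'c: "e' \<in> carrier (E i)" using e' kill_closed by auto
  define K' where "K' = {r \<in> carrier R. r \<odot>\<^bsub>E i\<^esub> e' = \<zero>\<^bsub>E i\<^esub>}"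
  have iK': "ideal K' R"
    by (rule idealI_cring) (use e'c in \<open>auto simp: K'_def M.smult_l_distr M.smult_assoc1\<close>)
  have KK': "K \<subseteq> K'" using e' ideal_closed(2)[OF iK] by (auto simp: K'_def kill_def)
  have "r \<odot>\<^bsub>E i\<^esub> e = \<zero>\<^bsub>E i\<^esub>" if "r \<in> colon R K' y" for r
    using that e'(2) e'c y by (auto simp: colon_def K'_def M.smult_assoc1)
  then have "K' \<in> A" using iK' JK KK' by (auto simp: A_def)
  then have K'K: "K' = K" using K(2) KK' by blast
  have "\<exists>n. ideal_power R m n \<subseteq> K"
  proof (rule ideal_power_subset_of_nilpotent[OF m_ideal iK])
    fix r assume r: "r \<in> m"
    then have rc: "r \<in> carrier R" by simp
    have "\<exists>n::nat. \<forall>l\<ge>n. colon R K (r [^] l) = colon R K (r [^] n)"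
    proof (rule ideal_sequence_stabilizes[of "\<lambda>l. colon R K (r [^] l)"])
      fix n :: nat
      show "ideal (colon R K (r [^] n)) R" using colon_ideal[OF iK] rc by simp
      show "colon R K (r [^] n) \<subseteq> colon R K (r [^] Suc n)"
        using rc ideal_closed(5)[OF iK] by (auto simp: colon_def m_assoc[symmetric])
    qed
    then obtain n0 :: nat where n0: "\<And>l. l \<ge> n0 \<Longrightarrow> colon R K (r [^] l) = colon R K (r [^] n0)" by blast
    define l where "l = max n0 s"
    define c where "c = r [^] l"
    have cc: "c \<in> carrier R" using rc by (simp add: c_def)
    \<comment> \<open>This is where the exponent has to lie beyond the point at which the ideals \<open>(K : r\<^sup>l)\<close> become constant.\<close>
    have stable: "u \<otimes> c \<in> K" if u: "u \<in> carrier R" "u \<otimes> (c \<otimes> c) \<in> K" for u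
    proof -
      have "u \<in> colon R K (r [^] (l + l))" using u rc by (simp add: colon_def c_def nat_pow_mult)
      then have "u \<in> colon R K (r [^] l)" using n0[of l] n0[of "l + l"] by (simp add: l_def)
      then show ?thesis by (simp add: colon_def c_def)
    qed
    have "c \<in> ideal_power R m s"
      using pow_in_ideal_power[OF m_ideal r, of l] ideal_power_antimono[OF m_ideal, of s l]
      by (auto simp: c_def l_def)
    then have "(c \<otimes> y) \<odot>\<^bsub>E i\<^esub> e' = \<zero>\<^bsub>E i\<^esub>" using s e'(2) e'c cc y by (simp add: M.smult_assoc1)
    then have cy: "c \<otimes> y \<in> K" using K'K cc y by (auto simp: K'_def)
    have "v \<odot>\<^bsub>E i\<^esub> e = \<zero>\<^bsub>E i\<^esub>" if vc: "v \<in> colon R (adjoin R K c) y" for v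
    proof -
      obtain k u where v: "v \<in> carrier R" "k \<in> K" "u \<in> carrier R" "v \<otimes> y = k \<oplus> u \<otimes> c"
        using vc by (auto simp: colon_def adjoin_def)
      have kc: "k \<in> carrier R" using v ideal_closed(2)[OF iK] by auto
      have "u \<otimes> (c \<otimes> c) = v \<otimes> (c \<otimes> y) \<ominus> k \<otimes> c"
      proof -
        have "v \<otimes> (c \<otimes> y) = (v \<otimes> y) \<otimes> c" using v(1) y cc by (simp add: m_comm[of c y] m_assoc)
        also have "\<dots> = k \<otimes> c \<oplus> u \<otimes> (c \<otimes> c)" using v kc cc by (simp add: l_distr m_assoc)
        finally show ?thesis using v kc cc y by (simp add: a_comm[of "k \<otimes> c"] minus_add_cancel)
      qed
      then have "u \<otimes> (c \<otimes> c) \<in> K" using v cy cc ideal_closed(5,6,7)[OF iK] by auto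
      then have "u \<otimes> c \<in> K" using stable v by blast
      then have "v \<otimes> y \<in> K" using v ideal_closed(3)[OF iK] by auto
      then show ?thesis using K(1) v by (auto simp: A_def colon_def)
    qed
    then have "adjoin R K c \<in> A"
      using adjoin_ideal[OF iK cc] adjoin_superset(1)[OF iK cc] JK by (auto simp: A_def)
    then have "adjoin R K c = K" using K(2) adjoin_superset(1)[OF iK cc] by blast
    then show "\<exists>n::nat. r [^] n \<in> K" using adjoin_superset(2)[OF iK cc] by (auto simp: c_def)
  qed
  then obtain n where "ideal_power R m n \<subseteq> K" by blast
  then have "e' \<in> torsion R m (E i)" using e' by (auto simp: torsion_def kill_def)
  then show ?thesis using e' JK by (auto simp: kill_def)
qed

lemma \<Gamma>_complex: "divisible_complex R \<Gamma> d"
proof (rule divisible_complex.intro[OF noetherian_cring_axioms], rule divisible_complex_axioms.intro, goal_cases)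
  case (1 i)
  show ?case
    unfolding \<Gamma>_def by (rule submodule.submodule_is_module[OF torsion_submodule mod])
next
  case (2 i)
  show ?case
    using d_torsion M.submodule_closed(2)[OF torsion_submodule]
    by (auto simp: linear_maps_def \<Gamma>_def d_add d_smult)
next
  case (3 x i)
  then show ?case
    using M.submodule_closed(2)[OF torsion_submodule] by (auto simp: \<Gamma>_def d_d)
next
  case (4 J y e i)
  then show ?case using torsion_divisible[of J y e i] by (simp add: \<Gamma>_def)
qed

end

sublocale resolved_domain \<subseteq> G: divisible_complex R \<Gamma> d
  by (rule \<Gamma>_complex)

context resolved_domain
begin

lemma G_kill: "G.kill J i = kill J i \<inter> torsion R m (E i)"
  using M.submodule_closed(2)[OF torsion_submodule] by (auto simp: G.kill_def kill_def \<Gamma>_def)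

lemma G_Z: "G.Z J i = Z J i \<inter> torsion R m (E i)"
  by (auto simp: G.Z_def Z_def G_kill) (auto simp: \<Gamma>_def)

lemma kill_torsion:
  assumes "ideal_power R m s \<subseteq> J" shows "kill J i \<subseteq> torsion R m (E i)"
  using assms by (auto simp: kill_def torsion_def)

text \<open>For an ideal that contains a power of \<open>m\<close>, everything killed by it is torsion, so the torsion subcomplex computes the same
  \<open>Ext\<close> groups as the resolution.\<close>

lemma G_B:
  assumes "ideal_power R m s \<subseteq> J" shows "G.B J i = B J i"
  using kill_torsion[OF assms] by (cases i) (auto simp: G.B_simps B_simps G_kill, auto simp: \<Gamma>_def)

lemma coboundaries_eq: "coboundaries R m E d i = G.B {\<zero>} i"
  using M.submodule_closed(2)[OF torsion_submodule]
  by (cases i) (auto simp: coboundaries_def G.B_simps G_kill kill_zero, auto simp: \<Gamma>_def)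

lemma cocycles_eq: "cocycles R m E d i = G.Z {\<zero>} i"
  using M.submodule_closed(2)[OF torsion_submodule]
  by (auto simp: cocycles_def G_Z Z_def kill_zero)

text \<open>Finite length of local cohomology enters the proof only through this consequence.\<close>

lemma local_cohomology_annihilator:
  assumes a: "a \<in> m" and len: "module_length R (local_cohomology R m E d i) < \<infinity>"
  shows "\<exists>N::nat. \<forall>z\<in>G.Z {\<zero>} i. a [^] N \<odot>\<^bsub>\<Gamma> i\<^esub> z \<in> G.B {\<zero>} i"
proof -
  have z: "{\<zero>} \<subseteq> carrier R" by simp
  have sZ: "submodule (G.Z {\<zero>} i) R (E i)"
    unfolding G_Z
  proof (rule M.submoduleI_cring)
    note c = M.submodule_closed[OF Z_submodule[OF z, of i]] M.submodule_closed[OF torsion_submodule[of i]]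
    show "Z {\<zero>} i \<inter> torsion R m (E i) \<subseteq> carrier (E i)" using c by blast
  qed (use M.submodule_closed[OF Z_submodule[OF z, of i]] M.submodule_closed[OF torsion_submodule[of i]] in auto)
  have BZ: "G.B {\<zero>} i \<subseteq> G.Z {\<zero>} i" by (rule G.B_subset_Z[OF z])
  note Bc = G.M.submodule_closed[OF G.B_submodule[OF z, of i]]
  interpret Q: module R "E i\<lparr>carrier := G.Z {\<zero>} i\<rparr>"
    by (rule submodule.submodule_is_module[OF sZ mod])
  have sB: "submodule (G.B {\<zero>} i) R (E i\<lparr>carrier := G.Z {\<zero>} i\<rparr>)"
    by (rule Q.submoduleI_cring) (use BZ Bc in \<open>auto simp: \<Gamma>_def\<close>)
  have "\<exists>n::nat. \<forall>x\<in>carrier (E i\<lparr>carrier := G.Z {\<zero>} i\<rparr>). a [^] n \<odot>\<^bsub>E i\<lparr>carrier := G.Z {\<zero>} i\<rparr>\<^esub> x \<in> G.B {\<zero>} i"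
  proof (rule Q.finite_length_torsion_exponent[OF sB])
    show "a \<in> carrier R" using a by simp
    show "module_length R (quotient_module (E i\<lparr>carrier := G.Z {\<zero>} i\<rparr>) (G.B {\<zero>} i)) < \<infinity>"
      using len by (simp add: local_cohomology_def cocycles_eq coboundaries_eq)
    fix x assume "x \<in> carrier (E i\<lparr>carrier := G.Z {\<zero>} i\<rparr>)"
    then obtain n where "\<And>r. r \<in> ideal_power R m n \<Longrightarrow> r \<odot>\<^bsub>E i\<^esub> x = \<zero>\<^bsub>E i\<^esub>"
      by (auto simp: G_Z torsion_def)
    then have "a [^] n \<odot>\<^bsub>E i\<^esub> x = \<zero>\<^bsub>E i\<^esub>" using pow_in_ideal_power[OF m_ideal a] by blast
    then show "\<exists>n::nat. a [^] n \<odot>\<^bsub>E i\<lparr>carrier := G.Z {\<zero>} i\<rparr>\<^esub> x \<in> G.B {\<zero>} i"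
      using Bc(1) by (auto simp: \<Gamma>_def intro!: exI[of _ n])
  qed
  then show ?thesis by (simp add: \<Gamma>_def)
qed

text \<open>Chains of primes that end in \<open>P\<close>; they keep track of the dimension while the cohomological degree grows.\<close>

definition chain_to :: "nat \<Rightarrow> 'a set \<Rightarrow> bool" where
  "chain_to n P \<longleftrightarrow> (\<exists>c. (\<forall>i\<le>n. c i \<in> Spec R) \<and> (\<forall>i<n. c i \<subset> c (Suc i)) \<and> c n = P)"

lemma chain_to_Suc:
  assumes "chain_to n P" "primeideal Q R" "P \<subset> Q"
  shows "chain_to (Suc n) Q"
proof -
  obtain c where c: "\<forall>i\<le>n. c i \<in> Spec R" "\<forall>i<n. c i \<subset> c (Suc i)" "c n = P"
    using assms(1) by (auto simp: chain_to_def)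
  have "\<forall>i\<le>Suc n. (c(Suc n := Q)) i \<in> Spec R" using c(1) assms(2) by (auto simp: Spec_def le_Suc_eq)
  moreover have "\<forall>i<Suc n. (c(Suc n := Q)) i \<subset> (c(Suc n := Q)) (Suc i)"
    using c(2,3) assms(3) by (auto simp: less_Suc_eq)
  ultimately show ?thesis unfolding chain_to_def by (metis fun_upd_same)
qed

lemma chain_to_krull_dim: "chain_to n P \<Longrightarrow> enat n \<le> krull_dim R"
proof -
  assume "chain_to n P"
  then obtain c where c: "\<forall>i\<le>n. c i \<in> Spec R" "\<forall>i<n. c i \<subset> c (Suc i)" by (auto simp: chain_to_def)
  show ?thesis unfolding krull_dim_def by (rule chain_length_ge[of n c]) (use c in auto)
qed

lemma chain_to_of_height:
  assumes "primeideal p R" "enat 2 \<le> height R p"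
  shows "chain_to 2 p"
proof -
  obtain c where c: "\<forall>i\<le>2. c i \<in> {q \<in> Spec R. q \<subseteq> p}" "\<forall>i<2. c i \<subset> c (Suc i)"
    using chain_length_ge_imp[of 2 "{q \<in> Spec R. q \<subseteq> p}"] assms(2) unfolding height_def by auto
  have "c 1 \<subset> c 2" using c(2)[rule_format, of 1] by (simp add: numeral_2_eq_2)
  moreover have "c 2 \<subseteq> p" using c(1) by auto
  ultimately have 1: "c 1 \<subset> p" by blast
  have "chain_to 1 (c 1)" unfolding chain_to_def using c by (intro exI[of _ c]) auto
  from chain_to_Suc[OF this assms(1) 1] show ?thesis by (simp add: numeral_2_eq_2)
qed

text \<open>Since \<open>(xR : b) = p\<close>, multiplication by \<open>b/x\<close> maps \<open>p\<close> to \<open>R\<close>. Extend it to a homomorphism from \<open>R\<close> to \<open>E 0\<close>,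
  given by an element \<open>e\<close>; the class of \<open>d e\<close> in \<open>Ext\<^sup>1(R/p)\<close> is the obstruction to realizing \<open>b/x\<close> by an element
  of \<open>R\<close>, and \<open>s\<close> kills it only if \<open>s b \<in> xR\<close>.\<close>

lemma survives_at_of_colon:
  assumes p: "primeideal p R" and x: "x \<in> p" "x \<noteq> \<zero>" and b: "b \<in> carrier R"
    and col: "colon R (PIdl x) b = p"
  shows "\<exists>z. survives_at p p 1 z"
proof -
  interpret p: primeideal p R by (rule p)
  have xc: "x \<in> carrier R" using x(1) by (rule p.Icarr)
  define q where "q r = (THE c. c \<in> carrier R \<and> r \<otimes> b = c \<otimes> x)" for r
  have uniq: "c = c'" if "c \<in> carrier R" "c' \<in> carrier R" "c \<otimes> x = c' \<otimes> x" for c c'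
    using that m_rcancel[OF x(2) xc] by blast
  have q_eq: "q r = c" if "c \<in> carrier R" "r \<otimes> b = c \<otimes> x" for r c
    unfolding q_def using that uniq by (intro the_equality) auto
  have q: "q r \<in> carrier R" "r \<otimes> b = q r \<otimes> x" if r: "r \<in> p" for r
  proof -
    have "r \<in> colon R (PIdl x) b" using r col by simp
    then obtain c where c: "c \<in> carrier R" "r \<otimes> b = c \<otimes> x" by (auto simp: colon_def cgenideal_def)
    then show "q r \<in> carrier R" "r \<otimes> b = q r \<otimes> x" using q_eq[OF c] by simp_all
  qed
  have "\<exists>e\<in>carrier (E 0). \<forall>r\<in>p. \<epsilon> (q r) = r \<odot>\<^bsub>E 0\<^esub> e"
  proof (rule injective_module_extends[OF E_injective p.is_ideal])
    fix r s assume r: "r \<in> p"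
    show "\<epsilon> (q r) \<in> carrier (E 0)" using q r eps_simps by blast
    have rc: "r \<in> carrier R" using r p.Icarr by blast
    { assume s: "s \<in> p"
      have sc: "s \<in> carrier R" using s p.Icarr by blast
      have "q (r \<oplus> s) = q r \<oplus> q s"
        by (rule q_eq) (use q[OF r] q[OF s] rc sc b xc in \<open>auto simp: l_distr\<close>)
      then show "\<epsilon> (q (r \<oplus> s)) = \<epsilon> (q r) \<oplus>\<^bsub>E 0\<^esub> \<epsilon> (q s)" using q r s eps_simps by simp }
    { assume s: "s \<in> carrier R"
      have "q (s \<otimes> r) = s \<otimes> q r"
        by (rule q_eq) (use q[OF r] s rc b xc in \<open>auto simp: m_assoc\<close>)
      then show "\<epsilon> (q (s \<otimes> r)) = s \<odot>\<^bsub>E 0\<^esub> \<epsilon> (q r)" using q r s eps_simps by simp }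
  qed
  then obtain e where e: "e \<in> carrier (E 0)" "\<And>r. r \<in> p \<Longrightarrow> \<epsilon> (q r) = r \<odot>\<^bsub>E 0\<^esub> e" by blast
  have "d 0 e \<in> Z p 1"
  proof -
    have "r \<odot>\<^bsub>E 1\<^esub> d 0 e = \<zero>\<^bsub>E 1\<^esub>" if r: "r \<in> p" for r
    proof -
      have rc: "r \<in> carrier R" using r p.Icarr by blast
      have "r \<odot>\<^bsub>E 1\<^esub> d 0 e = d 0 (r \<odot>\<^bsub>E 0\<^esub> e)" using d_smult[OF rc e(1)] by simp
      also have "\<dots> = d 0 (\<epsilon> (q r))" using e(2)[OF r] by simp
      finally show ?thesis using eps_simps(4)[OF q(1)[OF r]] by simp
    qed
    then show ?thesis using d_closed[OF e(1)] d_d[OF e(1)] by (simp add: Z_def kill_def)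
  qed
  moreover have "s \<odot>\<^bsub>E 1\<^esub> d 0 e \<notin> B p 1" if s: "s \<in> carrier R - p" for s
  proof
    assume "s \<odot>\<^bsub>E 1\<^esub> d 0 e \<in> B p 1"
    then obtain u where u: "u \<in> kill p 0" "s \<odot>\<^bsub>E 1\<^esub> d 0 e = d 0 u" using B_simps(2)[of p 0] by auto
    have uc: "u \<in> carrier (E 0)" using u kill_closed by auto
    have sc: "s \<in> carrier R" using s by simp
    have "d 0 (s \<odot>\<^bsub>E 0\<^esub> e \<ominus>\<^bsub>E 0\<^esub> u) = \<zero>\<^bsub>E 1\<^esub>"
      using u uc e(1) sc d_smult[OF sc e(1)] by (simp add: d_minus M.minus_self_eq_zero)
    then have "s \<odot>\<^bsub>E 0\<^esub> e \<ominus>\<^bsub>E 0\<^esub> u \<in> \<epsilon> ` carrier R" using uc e(1) sc by (simp add: eps_image)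
    then obtain v where v: "v \<in> carrier R" "s \<odot>\<^bsub>E 0\<^esub> e \<ominus>\<^bsub>E 0\<^esub> u = \<epsilon> v" by auto
    have "x \<odot>\<^bsub>E 0\<^esub> u = \<zero>\<^bsub>E 0\<^esub>" using u(1) x(1) by (simp add: kill_def)
    then have "x \<odot>\<^bsub>E 0\<^esub> \<epsilon> v = s \<odot>\<^bsub>E 0\<^esub> (x \<odot>\<^bsub>E 0\<^esub> e)"
      unfolding v(2)[symmetric] using xc sc e(1) uc
      by (simp add: M.smult_minus_distr M.smult_lcomm[of x s]) (simp add: a_minus_def)
    also have "x \<odot>\<^bsub>E 0\<^esub> e = \<epsilon> (q x)" using e(2)[OF x(1)] by simp
    also have "q x = b" by (rule q_eq) (use b xc m_comm in auto)
    finally have "\<epsilon> (x \<otimes> v) = \<epsilon> (s \<otimes> b)" using eps_simps xc v(1) sc b by simp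
    then have "s \<otimes> b = v \<otimes> x"
      using inj_onD[OF eps_inj, of "x \<otimes> v" "s \<otimes> b"] xc v(1) sc b m_comm[of x v] by simp
    then have "s \<in> colon R (PIdl x) b" using sc v(1) by (auto simp: colon_def cgenideal_def)
    then show False using col s by simp
  qed
  ultimately show ?thesis by (auto simp: survives_at_def)
qed

text \<open>Among all primes different from \<open>m\<close> that carry such a class and end a chain whose length exceeds the degree, take a maximal
  one. The climbing step leaves no prime between it and \<open>m\<close>. For \<open>a \<in> m\<close> outside it, adjoining a power of \<open>a\<close>
  then gives an ideal that contains a power of \<open>m\<close>, whose \<open>Ext\<close> groups are therefore controlled by local
  cohomology in degrees below the dimension.\<close>

lemma no_survives_at_below_m:
  assumes fin: "\<And>i. enat i < krull_dim R \<Longrightarrow> module_length R (local_cohomology R m E d i) < \<infinity>"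
    and p: "primeideal p R" "p \<noteq> m" and f: "survives_at p p j z" and c: "chain_to (Suc j) p"
  shows False
proof -
  define A where "A = {p. primeideal p R \<and> p \<noteq> m \<and> (\<exists>j z. survives_at p p j z \<and> chain_to (Suc j) p)}"
  have "\<exists>P\<in>A. \<forall>Q\<in>A. P \<subseteq> Q \<longrightarrow> Q = P"
    by (rule ideal_maximal_element) (use p f c in \<open>auto simp: A_def primeideal.axioms\<close>)
  then obtain P where PA: "P \<in> A" and Pmax: "\<And>Q. Q \<in> A \<Longrightarrow> P \<subseteq> Q \<Longrightarrow> Q = P" by blast
  then obtain i e where P: "primeideal P R" "P \<noteq> m" and e: "survives_at P P i e" and ch: "chain_to (Suc i) P"
    by (auto simp: A_def)
  have iP: "ideal P R" using P(1) by (rule primeideal.axioms)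
  have Pm: "P \<subset> m" using prime_subset_m[OF P(1)] P(2) by blast
  have between: "Q = m" if Q: "primeideal Q R" "P \<subset> Q" for Q
  proof (rule ccontr)
    assume Qm: "Q \<noteq> m"
    obtain x where x: "x \<in> Q" "x \<notin> P" using Q(2) by blast
    obtain q e' where q: "primeideal q R" "P \<subseteq> q" "x \<in> q" "q \<subseteq> Q" "survives_at q q (Suc i) e'"
      using survives_at_step[OF acc_Z P(1) Q(1) _ x e] Q(2) by blast
    have "chain_to (Suc (Suc i)) q" using chain_to_Suc[OF ch q(1)] q(2,3) x(2) by blast
    moreover have "q \<noteq> m" using q(4) Qm prime_subset_m[OF Q(1)] by blast
    ultimately have "q \<in> A" using q by (auto simp: A_def)
    then show False using Pmax[of q] q(2,3) x(2) by blast
  qed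
  obtain a where a: "a \<in> m" "a \<notin> P" using Pm by blast
  have ac: "a \<in> carrier R" using a(1) by simp
  have an: "a [^] (n::nat) \<notin> P" for n using primeideal_pow[OF P(1) ac] a(2) by blast
  have primary: "\<exists>s. ideal_power R m s \<subseteq> adjoin R P (a [^] (n::nat))" for n
  proof (rule ideal_power_subset_of_primes[OF m_ideal])
    show "ideal (adjoin R P (a [^] n)) R" using adjoin_ideal[OF iP] ac by simp
    fix Q assume Q: "primeideal Q R" "adjoin R P (a [^] n) \<subseteq> Q"
    have "a [^] n \<in> Q" "P \<subseteq> Q" using adjoin_superset[OF iP, of "a [^] n"] Q(2) ac by auto
    then have "a \<in> Q" using primeideal_pow[OF Q(1) ac] by blast
    then have "P \<subset> Q" using \<open>P \<subseteq> Q\<close> a(2) by blast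
    then show "m \<subseteq> Q" using between[OF Q(1)] by simp
  qed
  have dim: "enat l < krull_dim R" if l: "l \<le> Suc i" for l
  proof -
    have "enat (Suc (Suc i)) \<le> krull_dim R" by (rule chain_to_krull_dim[OF chain_to_Suc[OF ch m_prime Pm]])
    then show ?thesis using l by (meson enat_ord_simps(2) le_imp_less_Suc order_less_le_trans)
  qed
  have ann: "\<exists>N::nat. \<forall>z\<in>G.Z P l. a [^] N \<odot>\<^bsub>\<Gamma> l\<^esub> z \<in> G.B P l" if "l \<le> Suc i" for l
    by (rule G.annihilator_cohomology[OF ac local_cohomology_annihilator[OF a(1) fin[OF dim]] that iP])
  \<comment> \<open>The exponents for \<open>P\<close> in the degrees \<open>i\<close> and \<open>i + 1\<close> add up to one that works for all the ideals \<open>P + a\<^sup>nR\<close>, because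
  \<open>(P : a\<^sup>n) = P\<close>.\<close>
  obtain N :: nat where N: "\<And>z. z \<in> G.Z P (Suc i) \<Longrightarrow> a [^] N \<odot>\<^bsub>\<Gamma> (Suc i)\<^esub> z \<in> G.B P (Suc i)"
    using ann[of "Suc i"] by blast
  obtain N' :: nat where N': "\<And>z. z \<in> G.Z P i \<Longrightarrow> a [^] N' \<odot>\<^bsub>\<Gamma> i\<^esub> z \<in> G.B P i"
    using ann[of i] by auto
  show False
  proof (rule survives_at_annihilator_contradiction[OF acc_Z[OF iP] P(1) m_prime _ a e])
    show "P \<subseteq> m" using Pm by blast
    fix n z assume z: "z \<in> Z (adjoin R P (a [^] (n::nat))) (Suc i)"
    obtain s where s: "ideal_power R m s \<subseteq> adjoin R P (a [^] n)" using primary by blast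
    have "z \<in> G.Z (adjoin R P (a [^] n)) (Suc i)"
      using z kill_torsion[OF s, of "Suc i"] by (auto simp: G_Z Z_def)
    from G.annihilator_adjoin[OF ac iP _ N _ this, of N'] N' colon_prime[OF P(1) _ an[of n]] ac
    have "a [^] (N' + N) \<odot>\<^bsub>\<Gamma> (Suc i)\<^esub> z \<in> G.B (adjoin R P (a [^] n)) (Suc i)" by simp
    then show "a [^] (N' + N) \<odot>\<^bsub>E (Suc i)\<^esub> z \<in> B (adjoin R P (a [^] n)) (Suc i)"
      by (simp add: G_B[OF s]) (simp add: \<Gamma>_def)
  qed
qed

lemma no_colon_prime:
  assumes fin: "\<And>i. enat i < krull_dim R \<Longrightarrow> module_length R (local_cohomology R m E d i) < \<infinity>"
    and p: "primeideal p R" "p \<noteq> m" "enat 2 \<le> height R p"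
    and x: "x \<in> p" "x \<noteq> \<zero>" and b: "b \<in> carrier R"
  shows "colon R (PIdl x) b \<noteq> p"
proof
  assume "colon R (PIdl x) b = p"
  from survives_at_of_colon[OF p(1) x b this] obtain z where z: "survives_at p p 1 z" by blast
  have "chain_to (Suc 1) p" using chain_to_of_height[OF p(1,3)] by (simp add: numeral_2_eq_2)
  then show False using no_survives_at_below_m[OF fin p(1,2) z] by blast
qed

end

section \<open>Localizations of domains and the Frobenius map\<close>

text \<open>All rings of fractions that occur are localizations of domains away from zero, where equality of fractions
  is cross multiplication.\<close>

locale domain_localization = domain +
  fixes S
  assumes S_subset: "S \<subseteq> carrier R" and S_one: "\<one> \<in> S" and S_mult: "s \<in> S \<Longrightarrow> t \<in> S \<Longrightarrow> s \<otimes> t \<in> S"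
    and S_zero: "\<zero> \<notin> S"
begin

abbreviation fr where "fr \<equiv> fraction R S"
abbreviation L where "L \<equiv> localization R S"

lemma S_closed [simp]: "s \<in> S \<Longrightarrow> s \<in> carrier R" using S_subset by blast

lemma S_mult_closed [simp]: "s \<in> S \<Longrightarrow> t \<in> S \<Longrightarrow> s \<otimes> t \<in> S" by (rule S_mult)

lemma S_cancel: "s \<in> S \<Longrightarrow> a \<in> carrier R \<Longrightarrow> b \<in> carrier R \<Longrightarrow> s \<otimes> a = s \<otimes> b \<longleftrightarrow> a = b"
  using m_lcancel[of s a b] S_zero by auto

lemma fr_def: "a \<in> carrier R \<Longrightarrow> s \<in> S \<Longrightarrow> fr a s = {(b, t). b \<in> carrier R \<and> t \<in> S \<and> t \<otimes> a = s \<otimes> b}"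
proof -
  assume a: "a \<in> carrier R" "s \<in> S"
  have "(\<exists>u\<in>S. u \<otimes> (t \<otimes> a \<ominus> s \<otimes> b) = \<zero>) \<longleftrightarrow> t \<otimes> a = s \<otimes> b" if "b \<in> carrier R" "t \<in> S" for b t
  proof
    assume "\<exists>u\<in>S. u \<otimes> (t \<otimes> a \<ominus> s \<otimes> b) = \<zero>"
    then obtain u where u: "u \<in> S" "u \<otimes> (t \<otimes> a \<ominus> s \<otimes> b) = \<zero>" by blast
    then have "t \<otimes> a \<ominus> s \<otimes> b = \<zero>" using a that S_zero integral[of u "t \<otimes> a \<ominus> s \<otimes> b"] by auto
    then show "t \<otimes> a = s \<otimes> b" using eq_of_minus_eq_zero[of "t \<otimes> a" "s \<otimes> b"] a that by simp
  next
    assume "t \<otimes> a = s \<otimes> b"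
    then show "\<exists>u\<in>S. u \<otimes> (t \<otimes> a \<ominus> s \<otimes> b) = \<zero>"
      using a that S_one by (intro bexI[of _ \<one>]) (auto simp: minus_self_eq_zero)
  qed
  then show ?thesis by (auto simp: fraction_def)
qed

lemma fr_self: "a \<in> carrier R \<Longrightarrow> s \<in> S \<Longrightarrow> (a, s) \<in> fr a s"
  by (auto simp: fr_def)

lemma fr_eq_iff:
  assumes "a \<in> carrier R" "s \<in> S" "b \<in> carrier R" "t \<in> S"
  shows "fr a s = fr b t \<longleftrightarrow> t \<otimes> a = s \<otimes> b"
proof
  assume "fr a s = fr b t"
  then have "(b, t) \<in> fr a s" using fr_self assms by simp
  then show "t \<otimes> a = s \<otimes> b" using assms by (simp add: fr_def)
next
  assume eq: "t \<otimes> a = s \<otimes> b"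
  have "v \<otimes> a = s \<otimes> c \<longleftrightarrow> v \<otimes> b = t \<otimes> c" if "c \<in> carrier R" "v \<in> S" for c v
  proof -
    have "v \<otimes> a = s \<otimes> c \<longleftrightarrow> t \<otimes> (v \<otimes> a) = t \<otimes> (s \<otimes> c)" using S_cancel assms that by simp
    also have "t \<otimes> (v \<otimes> a) = s \<otimes> (v \<otimes> b)"
      using eq assms that by (metis S_closed m_lcomm)
    also have "t \<otimes> (s \<otimes> c) = s \<otimes> (t \<otimes> c)" using assms that by (simp add: m_lcomm)
    also have "s \<otimes> (v \<otimes> b) = s \<otimes> (t \<otimes> c) \<longleftrightarrow> v \<otimes> b = t \<otimes> c" using S_cancel assms that by simp
    finally show ?thesis .
  qed
  then show "fr a s = fr b t" using assms by (auto simp: fr_def)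
qed

lemma L_carrier: "carrier L = {fr a s | a s. a \<in> carrier R \<and> s \<in> S}"
  and L_one: "\<one>\<^bsub>L\<^esub> = fr \<one> \<one>" and L_zero: "\<zero>\<^bsub>L\<^esub> = fr \<zero> \<one>"
  by (simp_all add: localization_def)

lemma L_carrierE:
  assumes "x \<in> carrier L"
  obtains a s where "a \<in> carrier R" "s \<in> S" "x = fr a s"
  using assms by (auto simp: L_carrier)

lemma fr_closed [simp]: "a \<in> carrier R \<Longrightarrow> s \<in> S \<Longrightarrow> fr a s \<in> carrier L"
  by (auto simp: L_carrier)

text \<open>The operations of the localization are unions over representatives; the union is a single class as soon as
  its members do not depend on the representatives.\<close>

lemma UN_fr_eq:
  assumes a: "a \<in> carrier R" "s \<in> S" "b \<in> carrier R" "t \<in> S"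
    and f: "\<And>a' s' b' t'. \<lbrakk>a' \<in> carrier R; s' \<in> S; b' \<in> carrier R; t' \<in> S; s' \<otimes> a = s \<otimes> a'; t' \<otimes> b = t \<otimes> b'\<rbrakk> \<Longrightarrow> f a' s' b' t' = c"
  shows "(\<Union>(a', s')\<in>fr a s. \<Union>(b', t')\<in>fr b t. f a' s' b' t') = c"
proof -
  have inner: "(\<Union>(b', t')\<in>fr b t. f a' s' b' t') = c" if "(a', s') \<in> fr a s" for a' s'
  proof (rule UN_constant_eq[of "(b, t)"])
    show "(b, t) \<in> fr b t" using fr_self a by simp
    show "\<forall>x\<in>fr b t. (case x of (b', t') \<Rightarrow> f a' s' b' t') = c"
      using that a f by (auto simp: fr_def)
  qed
  show ?thesis
  proof (rule UN_constant_eq[of "(a, s)"])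
    show "(a, s) \<in> fr a s" using fr_self a by simp
    show "\<forall>x\<in>fr a s. (case x of (a', s') \<Rightarrow> \<Union>(b', t')\<in>fr b t. f a' s' b' t') = c"
      using inner by (simp add: split_beta)
  qed
qed

lemma fr_mult:
  assumes "a \<in> carrier R" "s \<in> S" "b \<in> carrier R" "t \<in> S"
  shows "fr a s \<otimes>\<^bsub>L\<^esub> fr b t = fr (a \<otimes> b) (s \<otimes> t)"
proof -
  have "(\<Union>(a', s')\<in>fr a s. \<Union>(b', t')\<in>fr b t. fr (a' \<otimes> b') (s' \<otimes> t')) = fr (a \<otimes> b) (s \<otimes> t)"
  proof (rule UN_fr_eq[OF assms])
    fix a' s' b' t' assume *: "a' \<in> carrier R" "s' \<in> S" "b' \<in> carrier R" "t' \<in> S"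
      "s' \<otimes> a = s \<otimes> a'" "t' \<otimes> b = t \<otimes> b'"
    have "(s \<otimes> t) \<otimes> (a' \<otimes> b') = (s \<otimes> a') \<otimes> (t \<otimes> b')" using * assms by (simp add: m_ac)
    also have "\<dots> = (s' \<otimes> a) \<otimes> (t' \<otimes> b)" using * by simp
    also have "\<dots> = (s' \<otimes> t') \<otimes> (a \<otimes> b)" using *(1-4) assms by (simp add: m_ac)
    finally show "fr (a' \<otimes> b') (s' \<otimes> t') = fr (a \<otimes> b) (s \<otimes> t)"
      using *(1-4) assms by (subst fr_eq_iff) auto
  qed
  then show ?thesis by (simp add: localization_def)
qed

lemma fr_add:
  assumes "a \<in> carrier R" "s \<in> S" "b \<in> carrier R" "t \<in> S"
  shows "fr a s \<oplus>\<^bsub>L\<^esub> fr b t = fr (t \<otimes> a \<oplus> s \<otimes> b) (s \<otimes> t)"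
proof -
  have "(\<Union>(a', s')\<in>fr a s. \<Union>(b', t')\<in>fr b t. fr (t' \<otimes> a' \<oplus> s' \<otimes> b') (s' \<otimes> t')) = fr (t \<otimes> a \<oplus> s \<otimes> b) (s \<otimes> t)"
  proof (rule UN_fr_eq[OF assms])
    fix a' s' b' t' assume *: "a' \<in> carrier R" "s' \<in> S" "b' \<in> carrier R" "t' \<in> S"
      "s' \<otimes> a = s \<otimes> a'" "t' \<otimes> b = t \<otimes> b'"
    have "(s \<otimes> t) \<otimes> (t' \<otimes> a' \<oplus> s' \<otimes> b') = (t \<otimes> t') \<otimes> (s \<otimes> a') \<oplus> (s \<otimes> s') \<otimes> (t \<otimes> b')"
      using *(1-4) assms by (simp add: m_ac r_distr)
    also have "\<dots> = (t \<otimes> t') \<otimes> (s' \<otimes> a) \<oplus> (s \<otimes> s') \<otimes> (t' \<otimes> b)" using * by simp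
    also have "\<dots> = (s' \<otimes> t') \<otimes> (t \<otimes> a \<oplus> s \<otimes> b)" using *(1-4) assms by (simp add: m_ac r_distr)
    finally show "fr (t' \<otimes> a' \<oplus> s' \<otimes> b') (s' \<otimes> t') = fr (t \<otimes> a \<oplus> s \<otimes> b) (s \<otimes> t)"
      using *(1-4) assms by (subst fr_eq_iff) auto
  qed
  then show ?thesis by (simp add: localization_def)
qed

lemma L_cring: "cring L"
proof (rule cringI)
  show "abelian_group L"
  proof (rule abelian_groupI)
    fix x y z assume "x \<in> carrier L" "y \<in> carrier L" "z \<in> carrier L"
    then obtain a s b t c u where 1: "a \<in> carrier R" "s \<in> S" "x = fr a s" "b \<in> carrier R" "t \<in> S" "y = fr b t"
      "c \<in> carrier R" "u \<in> S" "z = fr c u" by (auto elim!: L_carrierE)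
    then show "x \<oplus>\<^bsub>L\<^esub> y \<in> carrier L" by (simp add: fr_add)
    show "x \<oplus>\<^bsub>L\<^esub> y = y \<oplus>\<^bsub>L\<^esub> x" using 1 by (simp add: fr_add m_comm a_comm)
    show "x \<oplus>\<^bsub>L\<^esub> y \<oplus>\<^bsub>L\<^esub> z = x \<oplus>\<^bsub>L\<^esub> (y \<oplus>\<^bsub>L\<^esub> z)"
      using 1 by (simp add: fr_add r_distr m_ac a_assoc)
    show "\<zero>\<^bsub>L\<^esub> \<oplus>\<^bsub>L\<^esub> x = x" using 1 S_one by (simp add: L_zero fr_add)
    show "\<exists>y\<in>carrier L. y \<oplus>\<^bsub>L\<^esub> x = \<zero>\<^bsub>L\<^esub>"
      using 1 S_one by (intro bexI[of _ "fr (\<ominus> a) s"]) (auto simp: L_zero fr_add fr_eq_iff r_minus l_neg)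
  qed (use S_one in \<open>auto simp: L_zero\<close>)
  show "Group.comm_monoid L"
  proof (rule comm_monoidI)
    fix x y z assume "x \<in> carrier L" "y \<in> carrier L" "z \<in> carrier L"
    then obtain a s b t c u where 1: "a \<in> carrier R" "s \<in> S" "x = fr a s" "b \<in> carrier R" "t \<in> S" "y = fr b t"
      "c \<in> carrier R" "u \<in> S" "z = fr c u" by (auto elim!: L_carrierE)
    then show "x \<otimes>\<^bsub>L\<^esub> y \<in> carrier L" by (simp add: fr_mult)
    show "x \<otimes>\<^bsub>L\<^esub> y = y \<otimes>\<^bsub>L\<^esub> x" using 1 by (simp add: fr_mult m_comm)
    show "x \<otimes>\<^bsub>L\<^esub> y \<otimes>\<^bsub>L\<^esub> z = x \<otimes>\<^bsub>L\<^esub> (y \<otimes>\<^bsub>L\<^esub> z)" using 1 by (simp add: fr_mult m_assoc)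
    show "\<one>\<^bsub>L\<^esub> \<otimes>\<^bsub>L\<^esub> x = x" using 1 S_one by (simp add: L_one fr_mult)
  qed (use S_one in \<open>auto simp: L_one\<close>)
  fix x y z assume "x \<in> carrier L" "y \<in> carrier L" "z \<in> carrier L"
  then obtain a s b t c u where 1: "a \<in> carrier R" "s \<in> S" "x = fr a s" "b \<in> carrier R" "t \<in> S" "y = fr b t"
    "c \<in> carrier R" "u \<in> S" "z = fr c u" by (auto elim!: L_carrierE)
  then show "(x \<oplus>\<^bsub>L\<^esub> y) \<otimes>\<^bsub>L\<^esub> z = x \<otimes>\<^bsub>L\<^esub> z \<oplus>\<^bsub>L\<^esub> y \<otimes>\<^bsub>L\<^esub> z"
    by (simp add: fr_mult fr_add fr_eq_iff l_distr r_distr m_ac)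
qed

lemma fr_zero_iff: "a \<in> carrier R \<Longrightarrow> s \<in> S \<Longrightarrow> fr a s = \<zero>\<^bsub>L\<^esub> \<longleftrightarrow> a = \<zero>"
  using S_one by (auto simp: L_zero fr_eq_iff)

lemma L_domain: "domain L"
proof (rule domain.intro[OF L_cring], rule domain_axioms.intro)
  show "\<one>\<^bsub>L\<^esub> \<noteq> \<zero>\<^bsub>L\<^esub>" using S_one fr_zero_iff[of \<one> \<one>] by (simp add: L_one)
  fix x y assume *: "x \<otimes>\<^bsub>L\<^esub> y = \<zero>\<^bsub>L\<^esub>" "x \<in> carrier L" "y \<in> carrier L"
  then obtain a s b t where 1: "a \<in> carrier R" "s \<in> S" "x = fr a s" "b \<in> carrier R" "t \<in> S" "y = fr b t"
    by (auto elim!: L_carrierE)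
  then show "x = \<zero>\<^bsub>L\<^esub> \<or> y = \<zero>\<^bsub>L\<^esub>" using *(1) integral[of a b] by (auto simp: fr_mult fr_zero_iff)
qed

lemma fr_one_hom: "(\<lambda>a. fr a \<one>) \<in> ring_hom R L"
  by (rule ring_hom_memI) (use S_one in \<open>auto simp: fr_mult fr_add L_one\<close>)

lemma fr_one_inj: "inj_on (\<lambda>a. fr a \<one>) (carrier R)"
  by (rule inj_onI) (use S_one in \<open>auto simp: fr_eq_iff\<close>)

end

lemma (in domain) regular_elements_eq: "regular_elements R = carrier R - {\<zero>}"
  using integral one_not_zero by (auto simp: regular_elements_def dest: bspec[OF _ one_closed])

context domain
begin

lemma domain_localization_nonzero: "domain_localization R (carrier R - {\<zero>})"
  by unfold_locales (auto simp: integral_iff)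

interpretation Q: domain_localization R "carrier R - {\<zero>}"
  by (rule domain_localization_nonzero)

lemma total_quotient_ring_eq: "total_quotient_ring R = localization R (carrier R - {\<zero>})"
  by (simp add: total_quotient_ring_def regular_elements_eq)

lemma to_total_quotient_ring_eq: "to_total_quotient_ring R a = fraction R (carrier R - {\<zero>}) a \<one>"
  by (simp add: to_total_quotient_ring_def regular_elements_eq)

lemma total_quotient_ring_field: "field (total_quotient_ring R)"
proof -
  interpret T: domain "total_quotient_ring R" unfolding total_quotient_ring_eq by (rule Q.L_domain)
  show ?thesis
  proof (rule T.cring_fieldI)
    show "Units (total_quotient_ring R) = carrier (total_quotient_ring R) - {\<zero>\<^bsub>total_quotient_ring R\<^esub>}"
    proof
      show "Units (total_quotient_ring R) \<subseteq> carrier (total_quotient_ring R) - {\<zero>\<^bsub>total_quotient_ring R\<^esub>}"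
      proof
        fix x assume x: "x \<in> Units (total_quotient_ring R)"
        have "x \<noteq> \<zero>\<^bsub>total_quotient_ring R\<^esub>"
        proof
          assume "x = \<zero>\<^bsub>total_quotient_ring R\<^esub>"
          then show False using T.Units_r_inv[OF x] T.Units_inv_closed[OF x] T.one_not_zero by simp
        qed
        then show "x \<in> carrier (total_quotient_ring R) - {\<zero>\<^bsub>total_quotient_ring R\<^esub>}" using x by auto
      qed
      show "carrier (total_quotient_ring R) - {\<zero>\<^bsub>total_quotient_ring R\<^esub>} \<subseteq> Units (total_quotient_ring R)"
      proof
        fix x assume x: "x \<in> carrier (total_quotient_ring R) - {\<zero>\<^bsub>total_quotient_ring R\<^esub>}"
        then obtain a s where a: "a \<in> carrier R" "s \<in> carrier R - {\<zero>}" "x = Q.fr a s"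
          unfolding total_quotient_ring_eq by (auto elim!: Q.L_carrierE)
        then have a0: "a \<in> carrier R - {\<zero>}" using x by (auto simp: total_quotient_ring_eq Q.fr_zero_iff)
        have "Q.fr s a \<otimes>\<^bsub>total_quotient_ring R\<^esub> x = \<one>\<^bsub>total_quotient_ring R\<^esub>"
          using a a0 by (simp add: total_quotient_ring_eq Q.fr_mult Q.L_one Q.fr_eq_iff m_comm integral_iff)
        moreover have "Q.fr s a \<in> carrier (total_quotient_ring R)" using a a0 by (simp add: total_quotient_ring_eq)
        ultimately show "x \<in> Units (total_quotient_ring R)"
          using x T.m_comm[of x "Q.fr s a"] by (auto simp: Units_def)
      qed
    qed
  qed
qed

end

context cring
begin

lemma add_pow_zero_of_dvd:
  assumes "[p] \<cdot> \<one> = \<zero>" "(p::nat) dvd n" "a \<in> carrier R" shows "[n] \<cdot> a = \<zero>"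
proof -
  obtain k where k: "n = p * k" using assms(2) by blast
  have "[n] \<cdot> a = ([n] \<cdot> \<one>) \<otimes> a" using assms(3) add_pow_ldistr[of \<one> a n] by simp
  also have "[n] \<cdot> \<one> = [k] \<cdot> ([p] \<cdot> \<one>)" using add.nat_pow_pow[of \<one> k p] by (simp add: k mult.commute)
  also have "\<dots> = \<zero>" using assms(1) by simp
  finally show ?thesis using assms(3) by simp
qed

lemma binomial_theorem:
  assumes x: "x \<in> carrier R" and y: "y \<in> carrier R"
  shows "(x \<oplus> y) [^] (n::nat) = (\<Oplus>k\<in>{..n}. [(n choose k)] \<cdot> (x [^] k \<otimes> y [^] (n - k)))"
proof (induction n)
  case 0
  then show ?case by simp
next
  case (Suc n)
  define t where "t c k = [c] \<cdot> (x [^] k \<otimes> y [^] (Suc n - k))" for c k :: nat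
  have tc: "t c k \<in> carrier R" for c k using x y by (simp add: t_def)
  define S where "S = (\<Oplus>k\<in>{..n}. [(n choose k)] \<cdot> (x [^] k \<otimes> y [^] (n - k)))"
  have Sx: "x \<otimes> S = (\<Oplus>k\<in>{..n}. t (n choose k) (Suc k))"
  proof -
    have "x \<otimes> S = (\<Oplus>k\<in>{..n}. x \<otimes> ([(n choose k)] \<cdot> (x [^] k \<otimes> y [^] (n - k))))"
      unfolding S_def using x y by (intro finsum_rdistr) auto
    also have "\<dots> = (\<Oplus>k\<in>{..n}. t (n choose k) (Suc k))"
      by (rule finsum_cong') (use x y in \<open>auto simp: t_def add_pow_rdistr m_assoc[symmetric] m_comm[of x]\<close>)
    finally show ?thesis .
  qed
  have Sy: "y \<otimes> S = (\<Oplus>k\<in>{..n}. t (n choose k) k)"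
  proof -
    have "y \<otimes> S = (\<Oplus>k\<in>{..n}. y \<otimes> ([(n choose k)] \<cdot> (x [^] k \<otimes> y [^] (n - k))))"
      unfolding S_def using x y by (intro finsum_rdistr) auto
    also have "\<dots> = (\<Oplus>k\<in>{..n}. t (n choose k) k)"
      by (rule finsum_cong')
         (use x y in \<open>auto simp: t_def add_pow_rdistr Suc_diff_le m_assoc m_lcomm[of y] m_comm[of y]\<close>)
    finally show ?thesis .
  qed
  have split: "t (Suc n choose Suc k) (Suc k) = t (n choose k) (Suc k) \<oplus> t (n choose Suc k) (Suc k)" for k
    unfolding t_def using x y by (simp add: add.nat_pow_mult)
  have "(\<Oplus>k\<in>{..Suc n}. t (Suc n choose k) k) = (\<Oplus>k\<in>{..n}. t (Suc n choose Suc k) (Suc k)) \<oplus> t 1 0"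
    using finsum_Suc2[of "\<lambda>k. t (Suc n choose k) k" n] tc by (simp del: binomial_Suc_Suc)
  also have "(\<Oplus>k\<in>{..n}. t (Suc n choose Suc k) (Suc k)) = x \<otimes> S \<oplus> (\<Oplus>k\<in>{..n}. t (n choose Suc k) (Suc k))"
    unfolding split Sx using tc by (intro finsum_addf) auto
  also have "\<dots> \<oplus> t 1 0 = x \<otimes> S \<oplus> ((\<Oplus>k\<in>{..n}. t (n choose Suc k) (Suc k)) \<oplus> t (n choose 0) 0)"
    using tc x y by (simp add: a_assoc S_def)
  also have "(\<Oplus>k\<in>{..n}. t (n choose Suc k) (Suc k)) \<oplus> t (n choose 0) 0 = (\<Oplus>k\<in>{..Suc n}. t (n choose k) k)"
    using finsum_Suc2[of "\<lambda>k. t (n choose k) k" n] tc by simp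
  also have "\<dots> = t (n choose Suc n) (Suc n) \<oplus> y \<otimes> S"
    unfolding Sy using finsum_Suc[of "\<lambda>k. t (n choose k) k" n] tc by simp
  also have "t (n choose Suc n) (Suc n) = \<zero>" by (simp add: t_def binomial_eq_0)
  finally have "(\<Oplus>k\<in>{..Suc n}. t (Suc n choose k) k) = (x \<oplus> y) \<otimes> S"
    using x y by (simp add: l_distr S_def)
  moreover have "(x \<oplus> y) [^] Suc n = (x \<oplus> y) \<otimes> S" using Suc x y by (simp add: S_def m_comm)
  ultimately show ?case by (simp add: t_def)
qed

text \<open>The inner binomial coefficients are divisible by \<open>p\<close>.\<close>

lemma frobenius_add:
  assumes p: "Factorial_Ring.prime (p::nat)" and char: "[p] \<cdot> \<one> = \<zero>" and x: "x \<in> carrier R" and y: "y \<in> carrier R"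
  shows "(x \<oplus> y) [^] p = x [^] p \<oplus> y [^] p"
proof -
  define t where "t k = [(p choose k)] \<cdot> (x [^] k \<otimes> y [^] (p - k))" for k
  have tc: "t k \<in> carrier R" for k using x y by (simp add: t_def)
  have p0: "p > 0" using p by (simp add: prime_gt_0_nat)
  have "(\<Oplus>k\<in>{..p}. t k) = (\<Oplus>k\<in>{0, p}. t k)"
  proof (rule add.finprod_mono_neutral_cong_right)
    show "t k = \<zero>" if "k \<in> {..p} - {0, p}" for k
      using that unfolding t_def using dvd_choose_prime[of _ p] p x y by (auto intro!: add_pow_zero_of_dvd[OF char])
  qed (use tc in auto)
  also have "\<dots> = t 0 \<oplus> t p" using p0 tc by simp
  finally have "(\<Oplus>k\<in>{..p}. t k) = y [^] p \<oplus> x [^] p" using x y by (simp add: t_def)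
  then show ?thesis using binomial_theorem[OF x y, of p] x y by (simp add: t_def a_comm)
qed

lemma frobenius_pow_add:
  assumes p: "Factorial_Ring.prime (p::nat)" and char: "[p] \<cdot> \<one> = \<zero>" and x: "x \<in> carrier R" and y: "y \<in> carrier R"
  shows "(x \<oplus> y) [^] (p ^ n) = x [^] (p ^ n) \<oplus> y [^] (p ^ n)"
proof (induction n)
  case 0
  then show ?case using x y by simp
next
  case (Suc n)
  have "(x \<oplus> y) [^] (p ^ Suc n) = ((x \<oplus> y) [^] (p ^ n)) [^] p" using x y by (simp add: nat_pow_pow mult.commute)
  also have "\<dots> = (x [^] (p ^ n)) [^] p \<oplus> (y [^] (p ^ n)) [^] p"
    using Suc frobenius_add[OF p char] x y by simp
  finally show ?case using x y by (simp add: nat_pow_pow mult.commute)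
qed

lemma frobenius_pow_minus:
  assumes p: "Factorial_Ring.prime (p::nat)" and char: "[p] \<cdot> \<one> = \<zero>" and x: "x \<in> carrier R" and y: "y \<in> carrier R"
  shows "(x \<ominus> y) [^] (p ^ n) = x [^] (p ^ n) \<ominus> y [^] (p ^ n)"
proof -
  have "x [^] (p ^ n) = (x \<ominus> y) [^] (p ^ n) \<oplus> y [^] (p ^ n)"
    using frobenius_pow_add[OF p char, of "x \<ominus> y" y n] x y by (simp add: minus_add_cancel)
  then show ?thesis using x y by (simp add: minus_add_cancel)
qed

end

lemma ring_char_eq_prime:
  assumes "ring K" "\<one>\<^bsub>K\<^esub> \<noteq> \<zero>\<^bsub>K\<^esub>" "Factorial_Ring.prime (p::nat)" "[p] \<cdot>\<^bsub>K\<^esub> \<one>\<^bsub>K\<^esub> = \<zero>\<^bsub>K\<^esub>"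
  shows "ring_char K = p"
proof -
  interpret K: ring K by fact
  define l where "l = (LEAST n::nat. n > 0 \<and> [n] \<cdot>\<^bsub>K\<^esub> \<one>\<^bsub>K\<^esub> = \<zero>\<^bsub>K\<^esub>)"
  have ex: "p > 0 \<and> [p] \<cdot>\<^bsub>K\<^esub> \<one>\<^bsub>K\<^esub> = \<zero>\<^bsub>K\<^esub>" using assms(3,4) by (simp add: prime_gt_0_nat)
  have l: "l > 0 \<and> [l] \<cdot>\<^bsub>K\<^esub> \<one>\<^bsub>K\<^esub> = \<zero>\<^bsub>K\<^esub>" unfolding l_def using LeastI[of "\<lambda>n. n > 0 \<and> [n] \<cdot>\<^bsub>K\<^esub> \<one>\<^bsub>K\<^esub> = \<zero>\<^bsub>K\<^esub>", OF ex] by simp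
  have min: "l \<le> n" if "n > 0" "[n] \<cdot>\<^bsub>K\<^esub> \<one>\<^bsub>K\<^esub> = \<zero>\<^bsub>K\<^esub>" for n :: nat
    unfolding l_def using that by (intro Least_le) simp
  have "[p] \<cdot>\<^bsub>K\<^esub> \<one>\<^bsub>K\<^esub> = [(l * (p div l))] \<cdot>\<^bsub>K\<^esub> \<one>\<^bsub>K\<^esub> \<oplus>\<^bsub>K\<^esub> [(p mod l)] \<cdot>\<^bsub>K\<^esub> \<one>\<^bsub>K\<^esub>"
    by (subst K.add.nat_pow_mult) simp_all
  moreover have "[(l * (p div l))] \<cdot>\<^bsub>K\<^esub> \<one>\<^bsub>K\<^esub> = [(p div l)] \<cdot>\<^bsub>K\<^esub> ([l] \<cdot>\<^bsub>K\<^esub> \<one>\<^bsub>K\<^esub>)"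
    by (subst K.add.nat_pow_pow) simp_all
  ultimately have "[(p mod l)] \<cdot>\<^bsub>K\<^esub> \<one>\<^bsub>K\<^esub> = \<zero>\<^bsub>K\<^esub>" using ex l by simp
  then have "p mod l = 0" using min[of "p mod l"] l by (metis mod_less_divisor not_gr_zero not_le)
  then have "l dvd p" by auto
  moreover have "l \<noteq> 1" using l assms(2) by auto
  ultimately have "l = p" using assms(3) by (metis prime_nat_iff)
  then show ?thesis using ex unfolding ring_char_def l_def by auto
qed

lemma ring_char_prime_imp:
  assumes "Factorial_Ring.prime (ring_char R)"
  shows "[(ring_char R)] \<cdot>\<^bsub>R\<^esub> \<one>\<^bsub>R\<^esub> = \<zero>\<^bsub>R\<^esub>"
proof -
  have ex: "\<exists>n::nat. n > 0 \<and> [n] \<cdot>\<^bsub>R\<^esub> \<one>\<^bsub>R\<^esub> = \<zero>\<^bsub>R\<^esub>"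
  proof (rule ccontr)
    assume "\<not> ?thesis"
    then have "ring_char R = 0" unfolding ring_char_def by (simp only: if_False)
    then show False using assms by simp
  qed
  then show ?thesis unfolding ring_char_def using LeastI_ex[OF ex] by simp
qed

section \<open>Residue fields and their maps\<close>

context cring
begin

lemma quot_simps:
  assumes "ideal p R"
  shows "carrier (R Quot p) = {p +> a | a. a \<in> carrier R}" "\<zero>\<^bsub>R Quot p\<^esub> = p" "\<one>\<^bsub>R Quot p\<^esub> = p +> \<one>"
    "\<And>a b. a \<in> carrier R \<Longrightarrow> b \<in> carrier R \<Longrightarrow> (p +> a) \<otimes>\<^bsub>R Quot p\<^esub> (p +> b) = p +> (a \<otimes> b)"
    "\<And>a b. a \<in> carrier R \<Longrightarrow> b \<in> carrier R \<Longrightarrow> (p +> a) \<oplus>\<^bsub>R Quot p\<^esub> (p +> b) = p +> (a \<oplus> b)"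
    "\<And>a. a \<in> carrier R \<Longrightarrow> p +> a = p \<longleftrightarrow> a \<in> p"
    "\<And>a b. a \<in> carrier R \<Longrightarrow> b \<in> carrier R \<Longrightarrow> p +> a = p +> b \<longleftrightarrow> a \<ominus> b \<in> p"
proof -
  interpret p: ideal p R by fact
  show "carrier (R Quot p) = {p +> a | a. a \<in> carrier R}" by (auto simp: FactRing_def A_RCOSETS_def' a_r_coset_def')
  show "\<zero>\<^bsub>R Quot p\<^esub> = p" "\<one>\<^bsub>R Quot p\<^esub> = p +> \<one>" by (simp_all add: FactRing_def)
  show "(p +> a) \<otimes>\<^bsub>R Quot p\<^esub> (p +> b) = p +> (a \<otimes> b)" if "a \<in> carrier R" "b \<in> carrier R" for a b
    using that by (simp add: FactRing_def p.rcoset_mult_add)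
  show "(p +> a) \<oplus>\<^bsub>R Quot p\<^esub> (p +> b) = p +> (a \<oplus> b)" if "a \<in> carrier R" "b \<in> carrier R" for a b
    using that by (simp add: FactRing_def p.a_rcos_sum)
  show eq: "p +> a = p +> b \<longleftrightarrow> a \<ominus> b \<in> p" if "a \<in> carrier R" "b \<in> carrier R" for a b
    using quotient_eq_iff_same_a_r_cos[OF assms that] by simp
  show "p +> a = p \<longleftrightarrow> a \<in> p" if "a \<in> carrier R" for a
  proof -
    have "p +> \<zero> = p" using a_coset_add_zero[OF p.a_subset] .
    then show ?thesis using eq[OF that zero_closed] that by (simp add: a_minus_def)
  qed
qed

context
  fixes p assumes p: "primeideal p R"
begin

interpretation p: primeideal p R by (rule p)

interpretation D: domain "R Quot p" by (rule p.quotient_is_domain)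

interpretation Q: domain_localization "R Quot p" "carrier (R Quot p) - {\<zero>\<^bsub>R Quot p\<^esub>}"
  by (rule D.domain_localization_nonzero)

lemma coset_nonzero: "s \<in> carrier R - p \<Longrightarrow> p +> s \<in> carrier (R Quot p) - {\<zero>\<^bsub>R Quot p\<^esub>}"
  using quot_simps[OF p.is_ideal] by auto

lemma coset_closed: "a \<in> carrier R \<Longrightarrow> p +> a \<in> carrier (R Quot p)"
  using quot_simps[OF p.is_ideal] by auto

lemma residue_fraction_eq:
  "residue_fraction R p a s = fraction (R Quot p) (carrier (R Quot p) - {\<zero>\<^bsub>R Quot p\<^esub>}) (p +> a) (p +> s)"
  by (simp add: residue_fraction_def D.regular_elements_eq)

lemma residue_field_eq: "residue_field R p = localization (R Quot p) (carrier (R Quot p) - {\<zero>\<^bsub>R Quot p\<^esub>})"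
  by (simp add: residue_field_def D.total_quotient_ring_eq)

lemma residue_field_field: "field (residue_field R p)"
  unfolding residue_field_def by (rule D.total_quotient_ring_field)

lemma residue_field_carrierE:
  assumes "x \<in> carrier (residue_field R p)"
  obtains a s where "a \<in> carrier R" "s \<in> carrier R - p" "x = residue_fraction R p a s"
proof -
  obtain u v where u: "u \<in> carrier (R Quot p)" "v \<in> carrier (R Quot p) - {\<zero>\<^bsub>R Quot p\<^esub>}" "x = Q.fr u v"
    using assms unfolding residue_field_eq by (rule Q.L_carrierE)
  obtain a where a: "a \<in> carrier R" "u = p +> a" using u(1) quot_simps(1)[OF p.is_ideal] by auto
  obtain s where s: "s \<in> carrier R" "v = p +> s" using u(2) quot_simps(1)[OF p.is_ideal] by auto
  have "v \<noteq> p" using u(2) unfolding quot_simps(2)[OF p.is_ideal] by simp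
  then have "s \<in> carrier R - p" using quot_simps(6)[OF p.is_ideal s(1)] s by simp
  moreover have "x = residue_fraction R p a s" unfolding residue_fraction_eq u(3) a(2) s(2) ..
  ultimately show ?thesis using that[OF a(1)] by blast
qed

lemma residue_fraction_closed:
  "a \<in> carrier R \<Longrightarrow> s \<in> carrier R - p \<Longrightarrow> residue_fraction R p a s \<in> carrier (residue_field R p)"
  unfolding residue_field_eq residue_fraction_eq by (intro Q.fr_closed coset_closed coset_nonzero)

lemma residue_fraction_eq_iff:
  assumes "a \<in> carrier R" "s \<in> carrier R - p" "b \<in> carrier R" "t \<in> carrier R - p"
  shows "residue_fraction R p a s = residue_fraction R p b t \<longleftrightarrow> t \<otimes> a \<ominus> s \<otimes> b \<in> p"
  unfolding residue_fraction_eq Q.fr_eq_iff[OF coset_closed[OF assms(1)] coset_nonzero[OF assms(2)] coset_closed[OF assms(3)] coset_nonzero[OF assms(4)]]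
  using assms by (simp add: quot_simps(4,7)[OF p.is_ideal])

lemma residue_fraction_mult:
  assumes "a \<in> carrier R" "s \<in> carrier R - p" "b \<in> carrier R" "t \<in> carrier R - p"
  shows "residue_fraction R p a s \<otimes>\<^bsub>residue_field R p\<^esub> residue_fraction R p b t = residue_fraction R p (a \<otimes> b) (s \<otimes> t)"
  unfolding residue_fraction_eq residue_field_eq Q.fr_mult[OF coset_closed[OF assms(1)] coset_nonzero[OF assms(2)] coset_closed[OF assms(3)] coset_nonzero[OF assms(4)]]
  using assms by (simp add: quot_simps(4,5)[OF p.is_ideal])

lemma residue_fraction_add:
  assumes "a \<in> carrier R" "s \<in> carrier R - p" "b \<in> carrier R" "t \<in> carrier R - p"
  shows "residue_fraction R p a s \<oplus>\<^bsub>residue_field R p\<^esub> residue_fraction R p b t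
    = residue_fraction R p (t \<otimes> a \<oplus> s \<otimes> b) (s \<otimes> t)"
  unfolding residue_fraction_eq residue_field_eq Q.fr_add[OF coset_closed[OF assms(1)] coset_nonzero[OF assms(2)] coset_closed[OF assms(3)] coset_nonzero[OF assms(4)]]
  using assms by (simp add: quot_simps(4,5)[OF p.is_ideal])

lemma residue_fraction_one: "\<one>\<^bsub>residue_field R p\<^esub> = residue_fraction R p \<one> \<one>"
  unfolding residue_fraction_eq residue_field_eq by (simp add: Q.L_one quot_simps(3)[OF p.is_ideal])

lemma residue_fraction_pow:
  assumes "a \<in> carrier R" "s \<in> carrier R - p"
  shows "residue_fraction R p a s [^]\<^bsub>residue_field R p\<^esub> (n::nat) = residue_fraction R p (a [^] n) (s [^] n)
    \<and> s [^] n \<in> carrier R - p"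
proof (induction n)
  case 0
  then show ?case using primeideal_one_notin[OF p] by (simp add: residue_fraction_one)
next
  case (Suc n)
  then show ?case using assms residue_fraction_mult[of "a [^] n" "s [^] n" a s]
      primeideal_prod_notin[OF p, of "s [^] n" s] by simp
qed

lemma residue_field_char:
  assumes "[(c::nat)] \<cdot> \<one> = \<zero>" shows "[c] \<cdot>\<^bsub>residue_field R p\<^esub> \<one>\<^bsub>residue_field R p\<^esub> = \<zero>\<^bsub>residue_field R p\<^esub>"
proof -
  interpret K: field "residue_field R p" by (rule residue_field_field)
  have one: "\<one> \<in> carrier R - p" using primeideal_one_notin[OF p] by simp
  have hom: "(\<lambda>a. residue_fraction R p a \<one>) \<in> ring_hom R (residue_field R p)"
    by (rule ring_hom_memI)
       (use one in \<open>auto simp: residue_fraction_closed residue_fraction_mult residue_fraction_add residue_fraction_one\<close>)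
  interpret h: ring_hom_ring R "residue_field R p" "\<lambda>a. residue_fraction R p a \<one>"
    by (rule ring_hom_ringI2[OF ring_axioms K.ring_axioms hom])
  have "[n] \<cdot>\<^bsub>residue_field R p\<^esub> \<one>\<^bsub>residue_field R p\<^esub> = residue_fraction R p ([n] \<cdot> \<one>) \<one>" for n :: nat
    by (induction n) simp_all
  from this[of c] show ?thesis unfolding assms h.hom_zero .
qed

end

end

lemma contraction_prime:
  assumes "cring A" "cring B" "f \<in> ring_hom A B" "primeideal q B"
  shows "primeideal (contraction f A q) A"
proof -
  interpret A: cring A by fact
  interpret B: cring B by fact
  interpret f: ring_hom_cring A B f by (intro ring_hom_cring.intro ring_hom_cring_axioms.intro) fact+
  interpret q: primeideal q B by fact
  show ?thesis
  proof (rule primeidealI)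
    show "ideal (contraction f A q) A"
      by (rule A.idealI_cring) (auto simp: contraction_def q.I_l_closed)
    show "cring A" by fact
    show "carrier A \<noteq> contraction f A q"
    proof
      assume "carrier A = contraction f A q"
      then have "\<one>\<^bsub>A\<^esub> \<in> contraction f A q" using A.one_closed by blast
      then show False using B.primeideal_one_notin[OF assms(4)] by (simp add: contraction_def)
    qed
    fix a b assume "a \<in> carrier A" "b \<in> carrier A" "a \<otimes>\<^bsub>A\<^esub> b \<in> contraction f A q"
    then show "a \<in> contraction f A q \<or> b \<in> contraction f A q"
      using q.I_prime[of "f a" "f b"] by (auto simp: contraction_def)
  qed
qed

text \<open>The definite description in the definition of the map is legitimate: equal fractions have equal images, because
  the difference of the cross products lies in the contracted prime.\<close>

lemma residue_map_hom:
  assumes "cring A" "cring B" "f \<in> ring_hom A B" "primeideal q B"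
  shows "\<And>a s. a \<in> carrier A \<Longrightarrow> s \<in> carrier A - contraction f A q \<Longrightarrow>
      residue_map f A B q (residue_fraction A (contraction f A q) a s) = residue_fraction B q (f a) (f s)" (is "PROP ?val")
    and "residue_map f A B q \<in> ring_hom (residue_field A (contraction f A q)) (residue_field B q)"
proof -
  interpret A: cring A by fact
  interpret B: cring B by fact
  interpret f: ring_hom_cring A B f by (intro ring_hom_cring.intro ring_hom_cring_axioms.intro) fact+
  let ?p = "contraction f A q"
  have p: "primeideal ?p A" by (rule contraction_prime[OF assms])
  have iq: "ideal q B" using assms(4) by (rule primeideal.axioms)
  have fs: "f s \<in> carrier B - q" if "s \<in> carrier A - ?p" for s using that by (auto simp: contraction_def)
  have wd: "residue_fraction B q (f a) (f s) = residue_fraction B q (f b) (f t)"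
    if *: "a \<in> carrier A" "s \<in> carrier A - ?p" "b \<in> carrier A" "t \<in> carrier A - ?p"
      "residue_fraction A ?p a s = residue_fraction A ?p b t" for a s b t
  proof -
    have "t \<otimes>\<^bsub>A\<^esub> a \<ominus>\<^bsub>A\<^esub> s \<otimes>\<^bsub>A\<^esub> b \<in> ?p" using A.residue_fraction_eq_iff[OF p *(1-4)] *(5) by simp
    then have "f (t \<otimes>\<^bsub>A\<^esub> a \<ominus>\<^bsub>A\<^esub> s \<otimes>\<^bsub>A\<^esub> b) \<in> q" by (simp add: contraction_def)
    then have "f t \<otimes>\<^bsub>B\<^esub> f a \<ominus>\<^bsub>B\<^esub> f s \<otimes>\<^bsub>B\<^esub> f b \<in> q" using * by (simp add: a_minus_def)
    then show ?thesis using B.residue_fraction_eq_iff[OF assms(4) _ fs[OF *(2)] _ fs[OF *(4)]] * by simp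
  qed
  show val: "residue_map f A B q (residue_fraction A ?p a s) = residue_fraction B q (f a) (f s)"
    if *: "a \<in> carrier A" "s \<in> carrier A - ?p" for a s
    unfolding residue_map_def
  proof (rule the_equality)
    show "\<exists>b\<in>carrier A. \<exists>t\<in>carrier A - ?p. residue_fraction A ?p a s = residue_fraction A ?p b t \<and>
        residue_fraction B q (f a) (f s) = residue_fraction B q (f b) (f t)" using * by blast
    fix v assume "\<exists>b\<in>carrier A. \<exists>t\<in>carrier A - ?p. residue_fraction A ?p a s = residue_fraction A ?p b t \<and>
        v = residue_fraction B q (f b) (f t)"
    then obtain b t where bt: "b \<in> carrier A" "t \<in> carrier A - ?p"
      "residue_fraction A ?p a s = residue_fraction A ?p b t" "v = residue_fraction B q (f b) (f t)" by blast
    show "v = residue_fraction B q (f a) (f s)" using wd[OF * bt(1-3)] bt(4) by simp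
  qed
  show "residue_map f A B q \<in> ring_hom (residue_field A ?p) (residue_field B q)"
  proof (rule ring_hom_memI)
    have oneA: "\<one>\<^bsub>A\<^esub> \<in> carrier A - ?p" using A.primeideal_one_notin[OF p] by simp
    show "residue_map f A B q \<one>\<^bsub>residue_field A ?p\<^esub> = \<one>\<^bsub>residue_field B q\<^esub>"
      using val[OF A.one_closed oneA] A.residue_fraction_one[OF p] B.residue_fraction_one[OF assms(4)] by simp
    fix x y assume x: "x \<in> carrier (residue_field A ?p)" and y: "y \<in> carrier (residue_field A ?p)"
    obtain a s where a: "a \<in> carrier A" "s \<in> carrier A - ?p" "x = residue_fraction A ?p a s"
      using A.residue_field_carrierE[OF p x] by blast
    show "residue_map f A B q x \<in> carrier (residue_field B q)"
      using val[OF a(1,2)] a B.residue_fraction_closed[OF assms(4) _ fs[OF a(2)], of "f a"] by simp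
    obtain b t where b: "b \<in> carrier A" "t \<in> carrier A - ?p" "y = residue_fraction A ?p b t"
      using A.residue_field_carrierE[OF p y] by blast
    have st: "s \<otimes>\<^bsub>A\<^esub> t \<in> carrier A - ?p" by (rule A.primeideal_prod_notin[OF p a(2) b(2)])
    have c: "s \<in> carrier A" "t \<in> carrier A" using a b by auto
    show "residue_map f A B q (x \<otimes>\<^bsub>residue_field A ?p\<^esub> y) = residue_map f A B q x \<otimes>\<^bsub>residue_field B q\<^esub> residue_map f A B q y"
      unfolding a(3) b(3) A.residue_fraction_mult[OF p a(1,2) b(1,2)] val[OF a(1,2)] val[OF b(1,2)]
      using val[OF _ st, of "a \<otimes>\<^bsub>A\<^esub> b"] B.residue_fraction_mult[OF assms(4) _ fs[OF a(2)] _ fs[OF b(2)], of "f a" "f b"] a(1) b(1) c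
      by simp
    show "residue_map f A B q (x \<oplus>\<^bsub>residue_field A ?p\<^esub> y) = residue_map f A B q x \<oplus>\<^bsub>residue_field B q\<^esub> residue_map f A B q y"
      unfolding a(3) b(3) A.residue_fraction_add[OF p a(1,2) b(1,2)] val[OF a(1,2)] val[OF b(1,2)]
      using val[OF _ st, of "t \<otimes>\<^bsub>A\<^esub> a \<oplus>\<^bsub>A\<^esub> s \<otimes>\<^bsub>A\<^esub> b"] B.residue_fraction_add[OF assms(4) _ fs[OF a(2)] _ fs[OF b(2)], of "f a" "f b"] a(1) b(1) c
      by simp
  qed
qed

section \<open>Weak normality means closed under roots of p-power order\<close>

context domain
begin

interpretation Q: domain_localization R "carrier R - {\<zero>}"
  by (rule domain_localization_nonzero)

lemma to_Q_hom: "to_total_quotient_ring R \<in> ring_hom R (total_quotient_ring R)"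
  using Q.fr_one_hom unfolding to_total_quotient_ring_eq[abs_def] total_quotient_ring_eq .

lemma to_Q_inj: "inj_on (to_total_quotient_ring R) (carrier R)"
  using Q.fr_one_inj unfolding to_total_quotient_ring_eq[abs_def] .

end

text \<open>The equation is \<open>X\<^sup>n - r = 0\<close>.\<close>

lemma (in cring) monic_power_integral:
  assumes f: "f \<in> ring_hom A R" and A: "domain A" and b: "b \<in> carrier R" and r: "r \<in> carrier A"
    and n: "n > 0" and eq: "b [^] (n::nat) = f r"
  shows "integral_element f A R b"
proof -
  interpret A: domain A by (rule A)
  interpret f: ring_hom_cring A R f
    by (intro ring_hom_cring.intro ring_hom_cring_axioms.intro) (fact is_cring A.is_cring f)+
  obtain k where k: "n = Suc k" using n by (cases n) auto
  define p where "p = \<one>\<^bsub>A\<^esub> # (replicate k \<zero>\<^bsub>A\<^esub> @ [\<ominus>\<^bsub>A\<^esub> r])"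
  have "p \<in> carrier (poly_ring A)"
    unfolding univ_poly_carrier[symmetric] polynomial_def p_def using r by auto
  moreover have "ring.eval R (map f p) b = \<zero>"
  proof -
    have "map f p = monom \<one> k @ [\<ominus> f r]" unfolding p_def monom_def using r by simp
    moreover have "eval (monom \<one> k @ [\<ominus> f r]) b = eval (monom \<one> k) b \<otimes> b [^] length [\<ominus> f r] \<oplus> eval [\<ominus> f r] b"
      by (rule eval_append) (use r b monom_in_carrier[of \<one> k] in auto)
    moreover have "eval (monom \<one> k) b = b [^] k" using eval_monom[of \<one> b k] b by simp
    ultimately show ?thesis using b r eq by (simp add: k r_neg)
  qed
  moreover have "p \<noteq> []" "lead_coeff p = \<one>\<^bsub>A\<^esub>" by (simp_all add: p_def)
  ultimately show ?thesis unfolding integral_element_def by blast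
qed

locale char_p_domain = domain +
  fixes p :: nat
  assumes p: "Factorial_Ring.prime p" and char: "[p] \<cdot> \<one> = \<zero>"
begin

abbreviation QR where "QR \<equiv> total_quotient_ring R"
abbreviation \<iota> where "\<iota> \<equiv> to_total_quotient_ring R"

text \<open>The largest purely inseparable extension of \<open>R\<close> inside its field of fractions.\<close>

definition root_closure :: "('a \<times> 'a) set set" where
  "root_closure = {s \<in> carrier QR. \<exists>n. s [^]\<^bsub>QR\<^esub> (p ^ n) \<in> \<iota> ` carrier R}"

end

sublocale char_p_domain \<subseteq> Q: field "total_quotient_ring R"
  by (rule total_quotient_ring_field)

sublocale char_p_domain \<subseteq> i: ring_hom_ring R "total_quotient_ring R" "to_total_quotient_ring R"
  by (rule ring_hom_ringI2[OF ring_axioms Q.ring_axioms to_Q_hom])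

context char_p_domain
begin

lemma char_Q: "[p] \<cdot>\<^bsub>QR\<^esub> \<one>\<^bsub>QR\<^esub> = \<zero>\<^bsub>QR\<^esub>"
proof -
  have "[n] \<cdot>\<^bsub>QR\<^esub> \<one>\<^bsub>QR\<^esub> = \<iota> ([n] \<cdot> \<one>)" for n :: nat by (induction n) simp_all
  from this[of p] show ?thesis unfolding char i.hom_zero .
qed

lemma p_pos: "p ^ n > 0" using p by (simp add: prime_gt_0_nat)

lemma image_pow: "x \<in> \<iota> ` carrier R \<Longrightarrow> x [^]\<^bsub>QR\<^esub> (k::nat) \<in> \<iota> ` carrier R"
  by (auto simp: i.hom_nat_pow[symmetric])

lemma root_closureI: "s \<in> carrier QR \<Longrightarrow> s [^]\<^bsub>QR\<^esub> (p ^ n) \<in> \<iota> ` carrier R \<Longrightarrow> s \<in> root_closure"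
  by (auto simp: root_closure_def)

lemma root_closure_mono:
  assumes "s \<in> carrier QR" "s [^]\<^bsub>QR\<^esub> (p ^ n) \<in> \<iota> ` carrier R" "n \<le> k"
  shows "s [^]\<^bsub>QR\<^esub> (p ^ k) \<in> \<iota> ` carrier R"
proof -
  have "s [^]\<^bsub>QR\<^esub> (p ^ k) = (s [^]\<^bsub>QR\<^esub> (p ^ n)) [^]\<^bsub>QR\<^esub> (p ^ (k - n))"
    using assms(1,3) by (simp add: Q.nat_pow_pow power_add[symmetric])
  then show ?thesis using image_pow[OF assms(2)] by simp
qed

lemma root_closure_common:
  assumes "s \<in> root_closure" "t \<in> root_closure"
  obtains n where "s \<in> carrier QR" "t \<in> carrier QR" "s [^]\<^bsub>QR\<^esub> (p ^ n) \<in> \<iota> ` carrier R" "t [^]\<^bsub>QR\<^esub> (p ^ n) \<in> \<iota> ` carrier R"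
proof -
  obtain n k where "s \<in> carrier QR" "t \<in> carrier QR" "s [^]\<^bsub>QR\<^esub> (p ^ n) \<in> \<iota> ` carrier R" "t [^]\<^bsub>QR\<^esub> (p ^ k) \<in> \<iota> ` carrier R"
    using assms by (auto simp: root_closure_def)
  then show ?thesis using that[of "max n k"] root_closure_mono[of s n "max n k"] root_closure_mono[of t k "max n k"] by simp
qed

lemma image_subring: "subring (\<iota> ` carrier R) QR"
  by (rule i.img_is_subring[OF carrier_is_subring])

lemma root_closure_subring: "subring root_closure QR"
proof (rule Q.subringI)
  note im = subringE[OF image_subring]
  show "root_closure \<subseteq> carrier QR" by (auto simp: root_closure_def)
  show "\<one>\<^bsub>QR\<^esub> \<in> root_closure" using im(3) by (intro root_closureI[of _ 0]) auto
  fix s assume s: "s \<in> root_closure"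
  { fix t assume t: "t \<in> root_closure"
    obtain n where n: "s \<in> carrier QR" "t \<in> carrier QR" "s [^]\<^bsub>QR\<^esub> (p ^ n) \<in> \<iota> ` carrier R" "t [^]\<^bsub>QR\<^esub> (p ^ n) \<in> \<iota> ` carrier R"
      by (rule root_closure_common[OF s t])
    show "s \<otimes>\<^bsub>QR\<^esub> t \<in> root_closure"
      using n im(6)[OF n(3,4)] by (intro root_closureI[of _ n]) (auto simp: Q.nat_pow_distrib)
    show "s \<oplus>\<^bsub>QR\<^esub> t \<in> root_closure"
      using n im(7)[OF n(3,4)] by (intro root_closureI[of _ n]) (auto simp: Q.frobenius_pow_add[OF p char_Q]) }
  obtain n where n: "s \<in> carrier QR" "s [^]\<^bsub>QR\<^esub> (p ^ n) \<in> \<iota> ` carrier R" using s by (auto simp: root_closure_def)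
  have "(\<zero>\<^bsub>QR\<^esub> \<ominus>\<^bsub>QR\<^esub> s) [^]\<^bsub>QR\<^esub> (p ^ n) = \<ominus>\<^bsub>QR\<^esub> (s [^]\<^bsub>QR\<^esub> (p ^ n))"
    using Q.frobenius_pow_minus[OF p char_Q Q.zero_closed n(1), of n] n(1) p_pos[of n]
    by (simp add: Q.nat_pow_zero a_minus_def)
  moreover have "\<zero>\<^bsub>QR\<^esub> \<ominus>\<^bsub>QR\<^esub> s = \<ominus>\<^bsub>QR\<^esub> s" using n(1) by (simp add: a_minus_def)
  ultimately show "\<ominus>\<^bsub>QR\<^esub> s \<in> root_closure"
    using n im(5)[OF n(2)] by (intro root_closureI[of _ n]) auto
qed

abbreviation TR where "TR \<equiv> QR\<lparr>carrier := root_closure\<rparr>"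

lemma TR_domain: "domain TR"
  by (rule Q.subring_is_domain[OF root_closure_subring])

lemma TR_pow: "x [^]\<^bsub>TR\<^esub> (n::nat) = x [^]\<^bsub>QR\<^esub> n"
  by (simp add: Q.nat_pow_consistent[symmetric])

lemma image_root_closure: "x \<in> carrier R \<Longrightarrow> \<iota> x \<in> root_closure"
  by (rule root_closureI[of _ 0]) auto

lemma i_hom_TR: "\<iota> \<in> ring_hom R TR"
  by (rule ring_hom_memI) (auto simp: image_root_closure)

lemma TR_power:
  assumes "s \<in> root_closure"
  obtains n r where "r \<in> carrier R" "s [^]\<^bsub>QR\<^esub> (p ^ n) = \<iota> r"
  using assms by (auto simp: root_closure_def)

text \<open>A prime of the extension contains \<open>s\<close> if and only if it contains the powers of \<open>s\<close>, so it is determined by its contraction;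
  conversely, the elements with a power with exponent \<open>p^n\<close> in a prime of \<open>R\<close> form a prime.\<close>

lemma root_closure_Spec_bij: "bij_betw (contraction \<iota> R) (Spec TR) (Spec R)"
proof -
  interpret T: domain TR by (rule TR_domain)
  have mem_iff: "s \<in> q \<longleftrightarrow> r \<in> contraction \<iota> R q"
    if q: "primeideal q TR" and s: "s \<in> root_closure" and r: "r \<in> carrier R" "s [^]\<^bsub>QR\<^esub> (p ^ n) = \<iota> r" for q s r n
  proof -
    have iq: "ideal q TR" using q by (rule primeideal.axioms)
    have "s \<in> q \<longleftrightarrow> s [^]\<^bsub>TR\<^esub> (p ^ n) \<in> q"
    proof
      assume "s \<in> q"
      moreover obtain k where "p ^ n = Suc k" using p_pos[of n] by (cases "p ^ n") auto
      ultimately show "s [^]\<^bsub>TR\<^esub> (p ^ n) \<in> q"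
        using T.ideal_closed(6)[OF iq, of s "s [^]\<^bsub>TR\<^esub> k"] T.nat_pow_closed[of s k] s by simp
    next
      assume "s [^]\<^bsub>TR\<^esub> (p ^ n) \<in> q"
      then show "s \<in> q" using T.primeideal_pow[OF q, of s "p ^ n"] s by simp
    qed
    then show ?thesis using r by (simp add: TR_pow contraction_def)
  qed
  show ?thesis
  proof (rule bij_betwI')
    fix q q' assume "q \<in> Spec TR" "q' \<in> Spec TR"
    then have q: "primeideal q TR" "primeideal q' TR" by (auto simp: Spec_def)
    show "contraction \<iota> R q = contraction \<iota> R q' \<longleftrightarrow> q = q'"
    proof
      assume eq: "contraction \<iota> R q = contraction \<iota> R q'"
      have sub: "q \<subseteq> root_closure" "q' \<subseteq> root_closure"
        using q T.ideal_closed(2)[OF primeideal.axioms(1)] by fastforce+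
      have "s \<in> q \<longleftrightarrow> s \<in> q'" if s: "s \<in> root_closure" for s
      proof -
        obtain n r where r: "r \<in> carrier R" "s [^]\<^bsub>QR\<^esub> (p ^ n) = \<iota> r" by (rule TR_power[OF s])
        show ?thesis using mem_iff[OF q(1) s r] mem_iff[OF q(2) s r] eq by simp
      qed
      then show "q = q'" using sub by blast
    qed simp
  next
    fix q assume "q \<in> Spec TR"
    then show "contraction \<iota> R q \<in> Spec R"
      using contraction_prime[OF is_cring T.is_cring i_hom_TR] by (auto simp: Spec_def)
  next
    fix P assume "P \<in> Spec R"
    then have P: "primeideal P R" by (simp add: Spec_def)
    interpret P: primeideal P R by (rule P)
    define q where "q = {s \<in> root_closure. \<exists>n. s [^]\<^bsub>QR\<^esub> (p ^ n) \<in> \<iota> ` P}"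
    have inj: "x = y" if "x \<in> carrier R" "y \<in> carrier R" "\<iota> x = \<iota> y" for x y
      using inj_onD[OF to_Q_inj that(3) that(1,2)] .
    have q_iff: "s \<in> q \<longleftrightarrow> r \<in> P" if s: "s \<in> root_closure" and r: "r \<in> carrier R" "s [^]\<^bsub>QR\<^esub> (p ^ n) = \<iota> r" for s r n
    proof
      assume "r \<in> P" then show "s \<in> q" using s r by (auto simp: q_def)
    next
      assume "s \<in> q"
      then obtain k u where u: "u \<in> P" "s [^]\<^bsub>QR\<^esub> (p ^ k) = \<iota> u" by (auto simp: q_def)
      have sc: "s \<in> carrier QR" using s by (auto simp: root_closure_def)
      have uc: "u \<in> carrier R" using u(1) by (rule P.Icarr)
      have "\<iota> (r [^] (p ^ k)) = (s [^]\<^bsub>QR\<^esub> (p ^ n)) [^]\<^bsub>QR\<^esub> (p ^ k)" using r by (simp add: i.hom_nat_pow)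
      also have "\<dots> = (s [^]\<^bsub>QR\<^esub> (p ^ k)) [^]\<^bsub>QR\<^esub> (p ^ n)" using sc by (simp add: Q.nat_pow_pow mult.commute)
      also have "\<dots> = \<iota> (u [^] (p ^ n))" using u uc by (simp add: i.hom_nat_pow)
      finally have "r [^] (p ^ k) = u [^] (p ^ n)" using inj r(1) uc by simp
      moreover obtain l where "p ^ n = Suc l" using p_pos[of n] by (cases "p ^ n") auto
      ultimately have "r [^] (p ^ k) \<in> P" using u(1) uc by (simp add: P.I_l_closed)
      then show "r \<in> P" using primeideal_pow[OF P r(1)] by blast
    qed
    have Tcarr: "s \<in> carrier QR" if "s \<in> root_closure" for s using that by (auto simp: root_closure_def)
    note im = subringE[OF root_closure_subring]
    have pq: "primeideal q TR"
    proof (rule primeidealI)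
      show "cring TR" by (rule T.is_cring)
      show "ideal q TR"
      proof (rule T.idealI_cring)
        show "q \<subseteq> carrier TR" by (auto simp: q_def)
        have "\<zero>\<^bsub>QR\<^esub> [^]\<^bsub>QR\<^esub> (p ^ 0) = \<iota> \<zero>" by simp
        then have "\<zero>\<^bsub>QR\<^esub> \<in> q" using q_iff[of "\<zero>\<^bsub>QR\<^esub>" \<zero> 0] im(2) by simp
        then show "\<zero>\<^bsub>TR\<^esub> \<in> q" by simp
        fix s assume "s \<in> q"
        then have s: "s \<in> root_closure" "s \<in> q" by (auto simp: q_def)
        { fix t assume "t \<in> q"
          then have t: "t \<in> root_closure" "t \<in> q" by (auto simp: q_def)
          obtain n where n: "s [^]\<^bsub>QR\<^esub> (p ^ n) \<in> \<iota> ` carrier R" "t [^]\<^bsub>QR\<^esub> (p ^ n) \<in> \<iota> ` carrier R"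
            by (rule root_closure_common[OF s(1) t(1)])
          then obtain a b where ab: "a \<in> carrier R" "s [^]\<^bsub>QR\<^esub> (p ^ n) = \<iota> a" "b \<in> carrier R" "t [^]\<^bsub>QR\<^esub> (p ^ n) = \<iota> b" by auto
          have P': "a \<in> P" "b \<in> P" using q_iff[OF s(1) ab(1,2)] q_iff[OF t(1) ab(3,4)] s t by auto
          have "(s \<oplus>\<^bsub>QR\<^esub> t) [^]\<^bsub>QR\<^esub> (p ^ n) = \<iota> (a \<oplus> b)"
            using Tcarr[OF s(1)] Tcarr[OF t(1)] ab by (simp add: Q.frobenius_pow_add[OF p char_Q])
          then show "s \<oplus>\<^bsub>TR\<^esub> t \<in> q"
            using q_iff[of "s \<oplus>\<^bsub>QR\<^esub> t" "a \<oplus> b" n] im(7)[OF s(1) t(1)] P' ab by simp }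
        { fix t assume t: "t \<in> carrier TR"
          obtain n where n: "s [^]\<^bsub>QR\<^esub> (p ^ n) \<in> \<iota> ` carrier R" "t [^]\<^bsub>QR\<^esub> (p ^ n) \<in> \<iota> ` carrier R"
            by (rule root_closure_common[OF s(1), of t]) (use t in auto)
          then obtain a b where ab: "a \<in> carrier R" "s [^]\<^bsub>QR\<^esub> (p ^ n) = \<iota> a" "b \<in> carrier R" "t [^]\<^bsub>QR\<^esub> (p ^ n) = \<iota> b" by auto
          have P': "a \<in> P" using q_iff[OF s(1) ab(1,2)] s by auto
          have "(t \<otimes>\<^bsub>QR\<^esub> s) [^]\<^bsub>QR\<^esub> (p ^ n) = \<iota> (b \<otimes> a)"
            using Tcarr[OF s(1)] Tcarr[of t] t ab by (simp add: Q.nat_pow_distrib)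
          then show "t \<otimes>\<^bsub>TR\<^esub> s \<in> q"
            using q_iff[of "t \<otimes>\<^bsub>QR\<^esub> s" "b \<otimes> a" n] im(6)[of t s] s(1) t P' ab by (simp add: P.I_l_closed) }
      qed
      show "carrier TR \<noteq> q"
      proof
        assume "carrier TR = q"
        then have "\<one>\<^bsub>QR\<^esub> \<in> q" using im(3) by simp
        then show False using q_iff[of "\<one>\<^bsub>QR\<^esub>" \<one> 0] im(3) primeideal_one_notin[OF P] by simp
      qed
      fix s t assume st: "s \<in> carrier TR" "t \<in> carrier TR" "s \<otimes>\<^bsub>TR\<^esub> t \<in> q"
      then have s: "s \<in> root_closure" "t \<in> root_closure" by auto
      obtain n where n: "s [^]\<^bsub>QR\<^esub> (p ^ n) \<in> \<iota> ` carrier R" "t [^]\<^bsub>QR\<^esub> (p ^ n) \<in> \<iota> ` carrier R"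
        by (rule root_closure_common[OF s])
      then obtain a b where ab: "a \<in> carrier R" "s [^]\<^bsub>QR\<^esub> (p ^ n) = \<iota> a" "b \<in> carrier R" "t [^]\<^bsub>QR\<^esub> (p ^ n) = \<iota> b" by auto
      have "(s \<otimes>\<^bsub>QR\<^esub> t) [^]\<^bsub>QR\<^esub> (p ^ n) = \<iota> (a \<otimes> b)"
        using Tcarr[OF s(1)] Tcarr[OF s(2)] ab by (simp add: Q.nat_pow_distrib)
      then have "a \<otimes> b \<in> P" using q_iff[of "s \<otimes>\<^bsub>QR\<^esub> t" "a \<otimes> b" n] im(6)[OF s] st ab by simp
      then have "a \<in> P \<or> b \<in> P" using P.I_prime ab by blast
      then show "s \<in> q \<or> t \<in> q" using q_iff[OF s(1) ab(1,2)] q_iff[OF s(2) ab(3,4)] by auto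
    qed
    have "contraction \<iota> R q = P"
    proof -
      have "\<iota> x \<in> q \<longleftrightarrow> x \<in> P" if "x \<in> carrier R" for x
        using q_iff[of "\<iota> x" x 0] image_root_closure that by simp
      then show ?thesis using P.a_subset by (auto simp: contraction_def)
    qed
    then show "\<exists>q\<in>Spec TR. P = contraction \<iota> R q" using pq by (auto simp: Spec_def)
  qed
qed

text \<open>Numerator and denominator of an element of the residue field have powers in \<open>R\<close> with a common exponent \<open>p^n\<close>.\<close>

lemma root_closure_residue_purely_inseparable:
  assumes q: "primeideal q TR"
  shows "purely_inseparable (residue_field R (contraction \<iota> R q)) (residue_field TR q) (residue_map \<iota> R TR q)"
proof -
  interpret T: domain TR by (rule TR_domain)
  let ?P = "contraction \<iota> R q"
  have P: "primeideal ?P R" by (rule contraction_prime[OF is_cring T.is_cring i_hom_TR q])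
  interpret K: field "residue_field TR q" by (rule T.residue_field_field[OF q])
  have "[n] \<cdot>\<^bsub>TR\<^esub> \<one>\<^bsub>TR\<^esub> = [n] \<cdot>\<^bsub>QR\<^esub> \<one>\<^bsub>QR\<^esub>" for n :: nat
    by (induction n) (simp_all add: add_pow_def)
  then have "[p] \<cdot>\<^bsub>TR\<^esub> \<one>\<^bsub>TR\<^esub> = \<zero>\<^bsub>TR\<^esub>" using char_Q by simp
  then have "ring_char (residue_field TR q) = p"
    using ring_char_eq_prime[OF K.ring_axioms K.one_not_zero p] T.residue_field_char[OF q] by simp
  then have exponent: "max 1 (ring_char (residue_field TR q)) = p" using prime_gt_0_nat[OF p] by simp
  have "\<exists>n::nat. x [^]\<^bsub>residue_field TR q\<^esub> (p ^ n) \<in> residue_map \<iota> R TR q ` carrier (residue_field R ?P)"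
    if x: "x \<in> carrier (residue_field TR q)" for x
  proof -
    obtain b t where bt: "b \<in> carrier TR" "t \<in> carrier TR - q" "x = residue_fraction TR q b t"
      by (rule T.residue_field_carrierE[OF q x])
    obtain n where n: "b [^]\<^bsub>QR\<^esub> (p ^ n) \<in> \<iota> ` carrier R" "t [^]\<^bsub>QR\<^esub> (p ^ n) \<in> \<iota> ` carrier R"
      by (rule root_closure_common[of b t]) (use bt in auto)
    then obtain a s where as: "a \<in> carrier R" "b [^]\<^bsub>QR\<^esub> (p ^ n) = \<iota> a" "s \<in> carrier R" "t [^]\<^bsub>QR\<^esub> (p ^ n) = \<iota> s" by auto
    have pw: "x [^]\<^bsub>residue_field TR q\<^esub> (p ^ n) = residue_fraction TR q (\<iota> a) (\<iota> s)" and "\<iota> s \<notin> q"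
      using T.residue_fraction_pow[OF q bt(1,2), of "p ^ n"] bt(3) as by (auto simp: TR_pow)
    then have s: "s \<in> carrier R - ?P" using as by (simp add: contraction_def)
    have "x [^]\<^bsub>residue_field TR q\<^esub> (p ^ n) = residue_map \<iota> R TR q (residue_fraction R ?P a s)"
      unfolding pw residue_map_hom(1)[OF is_cring T.is_cring i_hom_TR q as(1) s] ..
    moreover have "residue_fraction R ?P a s \<in> carrier (residue_field R ?P)"
      by (rule residue_fraction_closed[OF P as(1) s])
    ultimately show ?thesis by blast
  qed
  then show ?thesis
    unfolding purely_inseparable_def exponent
    using residue_field_field[OF P] K.field_axioms residue_map_hom(2)[OF is_cring T.is_cring i_hom_TR q] by blast
qed

lemma root_closure_weakly_subintegral: "weakly_subintegral_subextension R root_closure"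
proof -
  interpret T: domain TR by (rule TR_domain)
  have integralT: "integral_element \<iota> R TR b" if b: "b \<in> root_closure" for b
  proof -
    obtain n r where r: "r \<in> carrier R" "b [^]\<^bsub>QR\<^esub> (p ^ n) = \<iota> r" by (rule TR_power[OF b])
    show ?thesis by (rule T.monic_power_integral[OF i_hom_TR domain_axioms _ r(1) p_pos[of n]]) (use b r in \<open>auto simp: TR_pow\<close>)
  qed
  have integralQ: "integral_element \<iota> R QR b" if b: "b \<in> root_closure" for b
  proof -
    obtain n r where r: "r \<in> carrier R" "b [^]\<^bsub>QR\<^esub> (p ^ n) = \<iota> r" by (rule TR_power[OF b])
    show ?thesis by (rule Q.monic_power_integral[OF to_Q_hom domain_axioms _ r(1) p_pos[of n]]) (use b r in \<open>auto simp: root_closure_def\<close>)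
  qed
  have "integral_extension \<iota> R TR"
    unfolding integral_extension_def
    using is_cring T.is_cring i_hom_TR to_Q_inj integralT by auto
  then have "weakly_subintegral \<iota> R TR"
    unfolding weakly_subintegral_def using root_closure_Spec_bij root_closure_residue_purely_inseparable by (auto simp: Spec_def)
  then show ?thesis
    unfolding weakly_subintegral_subextension_def integral_closure_in_quotients_def
    using root_closure_subring image_root_closure integralQ subringE(1)[OF root_closure_subring] by blast
qed

text \<open>The root closure inside the integral closure is weakly subintegral, so weak normality collapses it to the image of \<open>R\<close>.\<close>

lemma weakly_normal_root_closed:
  assumes "weakly_normal R" "z \<in> carrier QR" "z [^]\<^bsub>QR\<^esub> (p ^ n) \<in> \<iota> ` carrier R"
  shows "z \<in> \<iota> ` carrier R"
proof -
  have "root_closure \<subseteq> \<iota> ` carrier R"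
    using assms(1) root_closure_weakly_subintegral unfolding weakly_normal_def is_weak_normalization_def by blast
  then show ?thesis using root_closureI[OF assms(2,3)] by blast
qed

end

section \<open>The endomorphism ring of the maximal ideal\<close>

text \<open>Split off one linear factor at a time: \<open>u\<close> is a zero of one of the factors, as \<open>L\<close> is a domain.\<close>

lemma algebraically_closed_root_in_image:
  assumes k: "algebraically_closed k" and L: "domain L" and \<psi>: "\<psi> \<in> ring_hom k L" and u: "u \<in> carrier L"
    and g: "g \<in> carrier (poly_ring k)" "g \<noteq> []" "ring.eval L (map \<psi> g) u = \<zero>\<^bsub>L\<^esub>"
  shows "\<exists>c\<in>carrier k. \<psi> c = u"
proof -
  interpret k: algebraically_closed k by (rule k)
  interpret L: domain L by (rule L)
  interpret \<psi>: ring_hom_ring k L \<psi> by (rule ring_hom_ringI2[OF k.ring_axioms L.ring_axioms \<psi>])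
  have inj: "c = \<zero>\<^bsub>k\<^esub>" if c: "c \<in> carrier k" "\<psi> c = \<zero>\<^bsub>L\<^esub>" for c
  proof (rule ccontr)
    assume "c \<noteq> \<zero>\<^bsub>k\<^esub>"
    then have "c \<in> Units k" using c k.field_Units by auto
    then have "\<psi> (c \<otimes>\<^bsub>k\<^esub> inv\<^bsub>k\<^esub> c) = \<one>\<^bsub>L\<^esub>" by simp
    moreover have "\<psi> (c \<otimes>\<^bsub>k\<^esub> inv\<^bsub>k\<^esub> c) = \<zero>\<^bsub>L\<^esub>" using c k.Units_inv_closed[OF \<open>c \<in> Units k\<close>] by simp
    ultimately show False using L.one_not_zero by simp
  qed
  from g show ?thesis
  proof (induction "degree g" arbitrary: g rule: less_induct)
    case less
    note g = less.prems
    have gset: "set g \<subseteq> carrier k" using g(1) k.polynomial_incl unfolding univ_poly_carrier[symmetric] by blast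
    show ?case
    proof (cases "degree g = 0")
      case True
      then obtain c where c: "g = [c]" using g(2) by (cases g) auto
      then have "c \<in> carrier k" "c \<noteq> \<zero>\<^bsub>k\<^esub>" using g(1) unfolding univ_poly_carrier[symmetric] polynomial_def by auto
      moreover have "\<psi> c = \<zero>\<^bsub>L\<^esub>" using g(3) c u \<open>c \<in> carrier k\<close> by simp
      ultimately show ?thesis using inj by blast
    next
      case False
      have "k.splitted g" by (rule k.roots_over_carrier[OF g(1)])
      then have "k.roots g \<noteq> {#}" using False by (auto simp: k.splitted_def)
      then obtain a where a: "a \<in> carrier k" "[\<one>\<^bsub>k\<^esub>, \<ominus>\<^bsub>k\<^esub> a] pdivides\<^bsub>k\<^esub> g" "[\<one>\<^bsub>k\<^esub>, \<ominus>\<^bsub>k\<^esub> a] \<in> carrier (poly_ring k)"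
        using k.not_empty_rootsE[OF g(1)] by metis
      then obtain h where h: "h \<in> carrier (poly_ring k)" "g = k.poly_mult [\<one>\<^bsub>k\<^esub>, \<ominus>\<^bsub>k\<^esub> a] h"
        by (auto simp: pdivides_def factor_def univ_poly_mult)
      have hset: "set h \<subseteq> carrier k" using h(1) k.polynomial_incl unfolding univ_poly_carrier[symmetric] by blast
      have h0: "h \<noteq> []" using h(2) g(2) k.poly_mult_zero(2)[of "[\<one>\<^bsub>k\<^esub>, \<ominus>\<^bsub>k\<^esub> a]"] a by auto
      have deg: "degree g = Suc (degree h)"
        using k.poly_mult_degree_eq[OF k.carrier_is_subring, of "[\<one>\<^bsub>k\<^esub>, \<ominus>\<^bsub>k\<^esub> a]" h] a(3) h h0
        unfolding univ_poly_carrier[symmetric] by simp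
      have mset: "set (map \<psi> p) \<subseteq> carrier L" if "set p \<subseteq> carrier k" for p using that by auto
      have lin: "set [\<one>\<^bsub>k\<^esub>, \<ominus>\<^bsub>k\<^esub> a] \<subseteq> carrier k" using a by simp
      have "L.eval (map \<psi> g) u = L.eval (L.normalize (map \<psi> g)) u"
        by (rule L.eval_normalize[OF mset[OF gset] u, symmetric])
      also have "\<dots> = L.eval (L.poly_mult (map \<psi> [\<one>\<^bsub>k\<^esub>, \<ominus>\<^bsub>k\<^esub> a]) (map \<psi> h)) u"
        unfolding h(2) \<psi>.poly_mult_hom'[OF lin hset] ..
      also have "\<dots> = L.eval (map \<psi> [\<one>\<^bsub>k\<^esub>, \<ominus>\<^bsub>k\<^esub> a]) u \<otimes>\<^bsub>L\<^esub> L.eval (map \<psi> h) u"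
        by (rule L.eval_poly_mult[OF mset[OF lin] mset[OF hset] u])
      also have "L.eval (map \<psi> [\<one>\<^bsub>k\<^esub>, \<ominus>\<^bsub>k\<^esub> a]) u = u \<ominus>\<^bsub>L\<^esub> \<psi> a" using a u by (simp add: a_minus_def)
      finally have "(u \<ominus>\<^bsub>L\<^esub> \<psi> a) \<otimes>\<^bsub>L\<^esub> L.eval (map \<psi> h) u = \<zero>\<^bsub>L\<^esub>" using g(3) by simp
      moreover have "L.eval (map \<psi> h) u \<in> carrier L" by (rule L.eval_in_carrier[OF mset[OF hset] u])
      ultimately have "u \<ominus>\<^bsub>L\<^esub> \<psi> a = \<zero>\<^bsub>L\<^esub> \<or> L.eval (map \<psi> h) u = \<zero>\<^bsub>L\<^esub>"
        using L.integral[of "u \<ominus>\<^bsub>L\<^esub> \<psi> a" "L.eval (map \<psi> h) u"] a u by simp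
      then show ?thesis
      proof
        assume "u \<ominus>\<^bsub>L\<^esub> \<psi> a = \<zero>\<^bsub>L\<^esub>"
        then have "u = \<psi> a" using L.eq_of_minus_eq_zero[of u "\<psi> a"] a u by simp
        then show ?thesis using a by blast
      next
        assume "L.eval (map \<psi> h) u = \<zero>\<^bsub>L\<^esub>"
        then show ?thesis using less.hyps[of h] deg h(1) h0 by simp
      qed
    qed
  qed
qed

locale complete_root_closed_domain = noetherian_local_domain R m + char_p_domain R p for R (structure) and m and p +
  assumes complete: "adically_complete R m" and residue_closed: "algebraically_closed (R Quot m)"
    and root_closed: "z \<in> carrier QR \<Longrightarrow> z [^]\<^bsub>QR\<^esub> (p ^ n) \<in> \<iota> ` carrier R \<Longrightarrow> z \<in> \<iota> ` carrier R"
begin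

definition M where "M = \<iota> ` m"

text \<open>The ring \<open>(m : m)\<close> of multipliers of \<open>m\<close>, which is isomorphic to the ring of endomorphisms of the module \<open>m\<close>.
  Its elements satisfy \<open>S M \<subseteq> M\<close>, so \<open>M\<close> is an ideal of \<open>S\<close> as well as of \<open>R\<close>.\<close>

definition S where "S = {z \<in> carrier QR. \<forall>x\<in>M. x \<otimes>\<^bsub>QR\<^esub> z \<in> M}"

lemma \<iota>_inj: "x \<in> carrier R \<Longrightarrow> y \<in> carrier R \<Longrightarrow> \<iota> x = \<iota> y \<Longrightarrow> x = y"
  using inj_onD[OF to_Q_inj] by blast

lemma \<iota>_in_M: "x \<in> carrier R \<Longrightarrow> \<iota> x \<in> M \<longleftrightarrow> x \<in> m"
  using \<iota>_inj[of x] m_closed unfolding M_def by blast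

lemma M_closed:
  "\<zero>\<^bsub>QR\<^esub> \<in> M" "\<And>x. x \<in> M \<Longrightarrow> x \<in> carrier QR"
  "\<And>x y. x \<in> M \<Longrightarrow> y \<in> M \<Longrightarrow> x \<oplus>\<^bsub>QR\<^esub> y \<in> M" "\<And>x. x \<in> M \<Longrightarrow> \<ominus>\<^bsub>QR\<^esub> x \<in> M"
  "\<And>x y. x \<in> M \<Longrightarrow> y \<in> M \<Longrightarrow> x \<ominus>\<^bsub>QR\<^esub> y \<in> M"
proof -
  note c = ideal_closed[OF m_ideal]
  show 0: "\<zero>\<^bsub>QR\<^esub> \<in> M" unfolding M_def using c(1) i.hom_zero by (metis imageI)
  show "x \<in> carrier QR" if "x \<in> M" for x using that by (auto simp: M_def)
  show a: "x \<oplus>\<^bsub>QR\<^esub> y \<in> M" if xy: "x \<in> M" "y \<in> M" for x y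
  proof -
    obtain a b where "a \<in> m" "b \<in> m" "x = \<iota> a" "y = \<iota> b" using xy by (auto simp: M_def)
    then show ?thesis using c(3)[of a b] i.hom_add[of a b] by (auto simp: M_def intro!: image_eqI[of _ _ "a \<oplus> b"])
  qed
  show n: "\<ominus>\<^bsub>QR\<^esub> x \<in> M" if x: "x \<in> M" for x
  proof -
    obtain a where "a \<in> m" "x = \<iota> a" using x by (auto simp: M_def)
    then show ?thesis using c(4)[of a] by (auto simp: M_def intro!: image_eqI[of _ _ "\<ominus> a"])
  qed
  show "x \<ominus>\<^bsub>QR\<^esub> y \<in> M" if "x \<in> M" "y \<in> M" for x y unfolding a_minus_def using a n that by blast
qed

lemma S_carrier: "z \<in> S \<Longrightarrow> z \<in> carrier QR" by (simp add: S_def)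

lemma M_S: "x \<in> M \<Longrightarrow> z \<in> S \<Longrightarrow> x \<otimes>\<^bsub>QR\<^esub> z \<in> M" by (simp add: S_def)

lemma S_M: "x \<in> M \<Longrightarrow> z \<in> S \<Longrightarrow> z \<otimes>\<^bsub>QR\<^esub> x \<in> M"
  using M_S[of x z] Q.m_comm[of z x] M_closed(2) S_carrier by simp

lemma \<iota>_in_S: "r \<in> carrier R \<Longrightarrow> \<iota> r \<in> S"
  using ideal_closed(5)[OF m_ideal, of _ r] by (auto simp: S_def M_def i.hom_mult[symmetric] simp del: i.hom_mult)

lemma S_subring: "subring S QR"
proof (rule Q.subringI)
  show "S \<subseteq> carrier QR" by (auto simp: S_def)
  show "\<one>\<^bsub>QR\<^esub> \<in> S" using M_closed(2) by (simp add: S_def)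
  fix z assume z: "z \<in> S"
  show "\<ominus>\<^bsub>QR\<^esub> z \<in> S" using z M_closed(2,4) by (simp add: S_def Q.r_minus)
  fix w assume w: "w \<in> S"
  show "z \<otimes>\<^bsub>QR\<^esub> w \<in> S" using z w M_closed(2) by (simp add: S_def Q.m_assoc[symmetric])
  show "z \<oplus>\<^bsub>QR\<^esub> w \<in> S" using z w M_closed(2,3) by (simp add: S_def Q.r_distr)
qed

lemma S_closed: "\<zero>\<^bsub>QR\<^esub> \<in> S" "\<one>\<^bsub>QR\<^esub> \<in> S" "\<And>z w. z \<in> S \<Longrightarrow> w \<in> S \<Longrightarrow> z \<otimes>\<^bsub>QR\<^esub> w \<in> S"
  "\<And>z w. z \<in> S \<Longrightarrow> w \<in> S \<Longrightarrow> z \<oplus>\<^bsub>QR\<^esub> w \<in> S" "\<And>z. z \<in> S \<Longrightarrow> \<ominus>\<^bsub>QR\<^esub> z \<in> S"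
  "\<And>z w. z \<in> S \<Longrightarrow> w \<in> S \<Longrightarrow> z \<ominus>\<^bsub>QR\<^esub> w \<in> S"
  using subringE(2,3,5-7)[OF S_subring] by (auto simp: a_minus_def)

lemma S_pow: "z \<in> S \<Longrightarrow> z [^]\<^bsub>QR\<^esub> (n::nat) \<in> S"
  by (induction n) (auto simp: S_closed)

lemma M_subset_S: "M \<subseteq> S"
  using \<iota>_in_S by (auto simp: M_def)

text \<open>The last factor of a product in a power of \<open>m\<close> absorbs the multiplier, so the powers of \<open>m\<close> are ideals of \<open>S\<close>. The
  power with exponent 0 has to be excluded: it is \<open>R\<close>.\<close>

lemma power_ideal_S:
  assumes z: "z \<in> S" and r: "r \<in> ideal_power R m (Suc n)"
  shows "z \<otimes>\<^bsub>QR\<^esub> \<iota> r \<in> \<iota> ` ideal_power R m (Suc n)"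
proof -
  let ?I = "ideal_power R m (Suc n)"
  have iI: "ideal ?I R" by (rule ideal_power_ideal[OF m_ideal])
  have iJ: "ideal (ideal_power R m n) R" by (rule ideal_power_ideal[OF m_ideal])
  note c = ideal_closed[OF iI]
  define K where "K = {r \<in> carrier R. z \<otimes>\<^bsub>QR\<^esub> \<iota> r \<in> \<iota> ` ?I}"
  have zc: "z \<in> carrier QR" by (rule S_carrier[OF z])
  have iK: "ideal K R"
  proof (rule idealI_cring)
    show "K \<subseteq> carrier R" by (auto simp: K_def)
    show "\<zero> \<in> K" using zc c(1) i.hom_zero by (auto simp: K_def intro!: image_eqI[of _ _ \<zero>])
    fix a b assume "a \<in> K"
    then obtain a' where a: "a \<in> carrier R" "a' \<in> ?I" "z \<otimes>\<^bsub>QR\<^esub> \<iota> a = \<iota> a'" unfolding K_def by blast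
    have ac': "a' \<in> carrier R" using c(2)[OF a(2)] .
    { assume "b \<in> K"
      then obtain b' where b: "b \<in> carrier R" "b' \<in> ?I" "z \<otimes>\<^bsub>QR\<^esub> \<iota> b = \<iota> b'" unfolding K_def by blast
      have bc': "b' \<in> carrier R" using c(2)[OF b(2)] .
      have "z \<otimes>\<^bsub>QR\<^esub> \<iota> (a \<oplus> b) = \<iota> (a' \<oplus> b')" using a b zc ac' bc' by (simp add: Q.r_distr)
      then show "a \<oplus> b \<in> K" unfolding K_def using a b c(3)[OF a(2) b(2)] by blast }
    { assume b: "b \<in> carrier R"
      have "z \<otimes>\<^bsub>QR\<^esub> \<iota> (b \<otimes> a) = \<iota> (b \<otimes> a')" using a b zc ac' Q.m_lcomm[of z "\<iota> b" "\<iota> a"] by simp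
      then show "b \<otimes> a \<in> K" unfolding K_def using a b c(6)[OF a(2) b] by blast }
  qed
  have "?I \<subseteq> K"
    unfolding ideal_power_simps(2)
  proof (rule ideal_prod_subset[OF iK])
    fix a b assume a: "a \<in> ideal_power R m n" and b: "b \<in> m"
    have ac: "a \<in> carrier R" using ideal_closed(2)[OF iJ a] .
    have "z \<otimes>\<^bsub>QR\<^esub> \<iota> b \<in> M" using S_M[OF _ z] b by (auto simp: M_def)
    then obtain b' where b': "b' \<in> m" "z \<otimes>\<^bsub>QR\<^esub> \<iota> b = \<iota> b'" by (auto simp: M_def)
    have "z \<otimes>\<^bsub>QR\<^esub> \<iota> (a \<otimes> b) = \<iota> (a \<otimes> b')"
      using b b' ac zc Q.m_lcomm[of z "\<iota> a" "\<iota> b"] by simp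
    moreover have "a \<otimes> b' \<in> ?I" unfolding ideal_power_simps(2) by (rule ideal_prod.prod[OF a b'(1)])
    ultimately show "a \<otimes> b \<in> K" unfolding K_def using ac b by auto
  qed
  then show ?thesis using r by (auto simp: K_def)
qed

lemma ideal_power_1: "ideal_power R m (Suc 0) = m"
  unfolding ideal_power_simps using ideal_prod_commute[OF oneideal m_ideal] ideal_prod_one[OF m_ideal] by simp

lemma completeE:
  assumes "\<And>n::nat. x n \<in> carrier R" "\<And>n. x (Suc n) \<ominus> x n \<in> ideal_power R m n"
  obtains r where "r \<in> carrier R" "\<And>n. r \<ominus> x n \<in> ideal_power R m n"
  using complete assms unfolding adically_complete_def by meson

lemma ideal_powers_Inter:
  assumes "h \<in> carrier R" "\<And>n. h \<in> ideal_power R m n"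
  shows "h = \<zero>"
proof -
  have z: "\<zero> \<in> ideal_power R m n" for n using ideal_closed(1)[OF ideal_power_ideal[OF m_ideal]] .
  have "\<exists>!r. r \<in> carrier R \<and> (\<forall>n. r \<ominus> (\<lambda>n::nat. \<zero>) n \<in> ideal_power R m n)"
    using complete z unfolding adically_complete_def by (auto simp: minus_self_eq_zero)
  moreover have "h \<ominus> \<zero> = h" "\<zero> \<ominus> \<zero> = \<zero>" using assms(1) by (simp_all add: minus_self_eq_zero) (simp add: a_minus_def)
  ultimately show ?thesis using assms z zero_closed by metis
qed

lemma idempotent_defect_add:
  assumes "E \<in> carrier QR" "D \<in> carrier QR"
  shows "(E \<oplus>\<^bsub>QR\<^esub> D) \<otimes>\<^bsub>QR\<^esub> (E \<oplus>\<^bsub>QR\<^esub> D) \<ominus>\<^bsub>QR\<^esub> (E \<oplus>\<^bsub>QR\<^esub> D)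
    = (E \<otimes>\<^bsub>QR\<^esub> E \<ominus>\<^bsub>QR\<^esub> E) \<oplus>\<^bsub>QR\<^esub> (E \<oplus>\<^bsub>QR\<^esub> E \<oplus>\<^bsub>QR\<^esub> D \<ominus>\<^bsub>QR\<^esub> \<one>\<^bsub>QR\<^esub>) \<otimes>\<^bsub>QR\<^esub> D"
  using assms
  by (simp add: Q.minus_eq Q.l_distr Q.r_distr Q.m_comm[of E D] Q.l_minus Q.minus_add Q.a_ac)

text \<open>Lifting an idempotent of \<open>S/M\<close>. Since \<open>e\<^sup>p - e\<close> is divisible by \<open>e\<^sup>2 - e\<close>, it lies in \<open>M\<close>, and by additivity of the Frobenius map the
  differences of consecutive elements \<open>e\<^bsup>p^n\<^esup>\<close> are its powers with exponent \<open>p^n\<close>. So the sequence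
  converges, and its limit \<open>g\<close> satisfies \<open>g\<^sup>2 - g \<in> m\<^sup>n\<close> for all \<open>n\<close>. All differences from \<open>e\<close> lie in \<open>M\<close>,
  hence in \<open>R\<close>, so completeness of \<open>R\<close> suffices. As \<open>g\<close> is an idempotent of a field, it is 0 or 1.\<close>

lemma idempotent_mod_M:
  assumes e: "e \<in> S" and idem: "e \<otimes>\<^bsub>QR\<^esub> e \<ominus>\<^bsub>QR\<^esub> e \<in> M"
  shows "e \<in> M \<or> \<one>\<^bsub>QR\<^esub> \<ominus>\<^bsub>QR\<^esub> e \<in> M"
proof -
  have ec: "e \<in> carrier QR" by (rule S_carrier[OF e])
  have pow: "e [^]\<^bsub>QR\<^esub> Suc k \<ominus>\<^bsub>QR\<^esub> e \<in> M" for k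
  proof (induction k)
    case 0
    then show ?case using ec M_closed(1) by (simp add: Q.minus_self_eq_zero)
  next
    case (Suc k)
    have "e [^]\<^bsub>QR\<^esub> Suc (Suc k) \<ominus>\<^bsub>QR\<^esub> e = e \<otimes>\<^bsub>QR\<^esub> (e [^]\<^bsub>QR\<^esub> Suc k \<ominus>\<^bsub>QR\<^esub> e) \<oplus>\<^bsub>QR\<^esub> (e \<otimes>\<^bsub>QR\<^esub> e \<ominus>\<^bsub>QR\<^esub> e)"
    proof -
      have "e [^]\<^bsub>QR\<^esub> Suc (Suc k) = e \<otimes>\<^bsub>QR\<^esub> (e [^]\<^bsub>QR\<^esub> Suc k)" by (rule Q.nat_pow_Suc2[OF ec])
      moreover have "e [^]\<^bsub>QR\<^esub> Suc k \<in> carrier QR" using ec by (rule Q.nat_pow_closed)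
      ultimately show ?thesis using ec
        by (simp add: Q.minus_eq Q.r_distr Q.r_minus Q.a_assoc Q.r_neg1 del: Q.nat_pow_Suc)
    qed
    then show ?case using S_M[OF Suc e] idem M_closed(3) by simp
  qed
  have powq: "e [^]\<^bsub>QR\<^esub> (p ^ n) \<ominus>\<^bsub>QR\<^esub> e \<in> M" for n
  proof -
    obtain k where "p ^ n = Suc k" using p_pos[of n] by (cases "p ^ n") auto
    then show ?thesis using pow[of k] by simp
  qed
  have np: "n \<le> p ^ n" for n using power_gt_expt[of p n] prime_gt_1_nat[OF p] by simp
  have "\<exists>x. x \<in> m \<and> \<iota> x = e [^]\<^bsub>QR\<^esub> (p ^ n) \<ominus>\<^bsub>QR\<^esub> e" for n using powq[of n] by (auto simp: M_def)
  then obtain x where x: "\<And>n. x n \<in> m" "\<And>n. \<iota> (x n) = e [^]\<^bsub>QR\<^esub> (p ^ n) \<ominus>\<^bsub>QR\<^esub> e" by metis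
  have xc: "x n \<in> carrier R" for n using x(1) by simp
  have "e [^]\<^bsub>QR\<^esub> p \<ominus>\<^bsub>QR\<^esub> e \<in> M" using powq[of 1] by simp
  then obtain \<delta> where \<delta>: "\<delta> \<in> m" "\<iota> \<delta> = e [^]\<^bsub>QR\<^esub> p \<ominus>\<^bsub>QR\<^esub> e" by (auto simp: M_def)
  have diff: "x (Suc n) \<ominus> x n = \<delta> [^] (p ^ n)" for n
  proof (rule \<iota>_inj)
    let ?E = "e [^]\<^bsub>QR\<^esub> (p ^ n)"
    have "\<iota> (x (Suc n) \<ominus> x n) = (e [^]\<^bsub>QR\<^esub> (p ^ Suc n) \<ominus>\<^bsub>QR\<^esub> e) \<ominus>\<^bsub>QR\<^esub> (?E \<ominus>\<^bsub>QR\<^esub> e)"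
      using xc by (simp add: minus_eq x(2) Q.minus_eq)
    also have "\<dots> = e [^]\<^bsub>QR\<^esub> (p ^ Suc n) \<ominus>\<^bsub>QR\<^esub> ?E"
      using ec by (simp add: Q.minus_eq Q.minus_add Q.a_ac Q.r_neg1 Q.r_neg2 Q.r_neg Q.l_neg)
    also have "e [^]\<^bsub>QR\<^esub> (p ^ Suc n) = (e [^]\<^bsub>QR\<^esub> p) [^]\<^bsub>QR\<^esub> (p ^ n)" using ec by (simp add: Q.nat_pow_pow)
    also have "\<dots> \<ominus>\<^bsub>QR\<^esub> ?E = (e [^]\<^bsub>QR\<^esub> p \<ominus>\<^bsub>QR\<^esub> e) [^]\<^bsub>QR\<^esub> (p ^ n)"
      using Q.frobenius_pow_minus[OF p char_Q, of "e [^]\<^bsub>QR\<^esub> p" e n] ec by simp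
    finally show "\<iota> (x (Suc n) \<ominus> x n) = \<iota> (\<delta> [^] (p ^ n))" using \<delta> by (simp add: i.hom_nat_pow)
  qed (use xc \<delta> in auto)
  have powm: "a [^] (p ^ n) \<in> ideal_power R m n" if "a \<in> m" for a n
    using pow_in_ideal_power[OF m_ideal that, of "p ^ n"] ideal_power_antimono[OF m_ideal np] by blast
  obtain r where r: "r \<in> carrier R" "\<And>n. r \<ominus> x n \<in> ideal_power R m n"
    using completeE[of x] xc diff powm[OF \<delta>(1)] by metis
  have "r \<ominus> x (Suc 0) \<in> m" using r(2)[of "Suc 0"] unfolding ideal_power_1 .
  then have "(r \<ominus> x (Suc 0)) \<oplus> x (Suc 0) \<in> m" using x(1) ideal_closed(3)[OF m_ideal] by blast
  then have rm: "r \<in> m" using r(1) xc by (simp add: minus_add_cancel)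
  define g where "g = e \<oplus>\<^bsub>QR\<^esub> \<iota> r"
  have gc: "g \<in> carrier QR" using ec r by (simp add: g_def)
  obtain t where t: "t \<in> m" "\<iota> t = e \<otimes>\<^bsub>QR\<^esub> e \<ominus>\<^bsub>QR\<^esub> e" using idem by (auto simp: M_def)
  \<comment> \<open>Write \<open>g = E + D\<close> with \<open>E = e\<^bsup>p^(n+1)\<^esup>\<close>; both the defect \<open>E\<^sup>2 - E\<close> and the remainder \<open>D\<close> lie in the power of \<open>m\<close>
  with exponent \<open>n + 1\<close>. The shift by one avoids the exponent 0.\<close>
  have g_in: "g \<otimes>\<^bsub>QR\<^esub> g \<ominus>\<^bsub>QR\<^esub> g \<in> \<iota> ` ideal_power R m (Suc n)" for n
  proof -
    let ?q = "p ^ Suc n"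
    define E where "E = e [^]\<^bsub>QR\<^esub> ?q"
    define D where "D = \<iota> (r \<ominus> x (Suc n))"
    have E: "E \<in> S" "E \<in> carrier QR" using S_pow[OF e] ec by (auto simp: E_def)
    have D: "D \<in> S" "D \<in> carrier QR" using r(1) xc \<iota>_in_S by (auto simp: D_def)
    have "E \<ominus>\<^bsub>QR\<^esub> e \<oplus>\<^bsub>QR\<^esub> D = \<iota> (x (Suc n) \<oplus> (r \<ominus> x (Suc n)))" unfolding D_def E_def x(2)[symmetric] using xc r(1) by simp
    also have "x (Suc n) \<oplus> (r \<ominus> x (Suc n)) = r" using xc r(1) by (simp add: a_comm[of "x (Suc n)"] minus_add_cancel)
    finally have "g = e \<oplus>\<^bsub>QR\<^esub> (E \<ominus>\<^bsub>QR\<^esub> e \<oplus>\<^bsub>QR\<^esub> D)" by (simp add: g_def)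
    then have g: "g = E \<oplus>\<^bsub>QR\<^esub> D" using E D ec by (simp add: Q.minus_eq Q.a_ac Q.r_neg)
    have "E \<otimes>\<^bsub>QR\<^esub> E \<ominus>\<^bsub>QR\<^esub> E = (e \<otimes>\<^bsub>QR\<^esub> e \<ominus>\<^bsub>QR\<^esub> e) [^]\<^bsub>QR\<^esub> ?q"
      using Q.frobenius_pow_minus[OF p char_Q, of "e \<otimes>\<^bsub>QR\<^esub> e" e "Suc n"] ec by (simp add: E_def Q.nat_pow_distrib)
    also have "\<dots> = \<iota> (t [^] ?q)" using t by (simp add: i.hom_nat_pow)
    finally have 1: "E \<otimes>\<^bsub>QR\<^esub> E \<ominus>\<^bsub>QR\<^esub> E = \<iota> (t [^] ?q)" .
    have "(E \<oplus>\<^bsub>QR\<^esub> E \<oplus>\<^bsub>QR\<^esub> D \<ominus>\<^bsub>QR\<^esub> \<one>\<^bsub>QR\<^esub>) \<otimes>\<^bsub>QR\<^esub> D \<in> \<iota> ` ideal_power R m (Suc n)"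
    proof -
      have W: "E \<oplus>\<^bsub>QR\<^esub> E \<oplus>\<^bsub>QR\<^esub> D \<ominus>\<^bsub>QR\<^esub> \<one>\<^bsub>QR\<^esub> \<in> S"
        by (rule S_closed(6)[OF S_closed(4)[OF S_closed(4)[OF E(1) E(1)] D(1)] S_closed(2)])
      show ?thesis using power_ideal_S[OF W r(2)[of "Suc n"]] by (simp only: D_def)
    qed
    then obtain v where v: "v \<in> ideal_power R m (Suc n)" "(E \<oplus>\<^bsub>QR\<^esub> E \<oplus>\<^bsub>QR\<^esub> D \<ominus>\<^bsub>QR\<^esub> \<one>\<^bsub>QR\<^esub>) \<otimes>\<^bsub>QR\<^esub> D = \<iota> v" by blast
    note c = ideal_closed[OF ideal_power_ideal[OF m_ideal, of "Suc n"]]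
    have "g \<otimes>\<^bsub>QR\<^esub> g \<ominus>\<^bsub>QR\<^esub> g = \<iota> (t [^] ?q \<oplus> v)"
      unfolding g idempotent_defect_add[OF E(2) D(2)] 1 v(2) using t c(2)[OF v(1)] by simp
    then show ?thesis using c(3)[OF powm[OF t(1), of "Suc n"] v(1)] by blast
  qed
  then obtain h where h: "h \<in> ideal_power R m (Suc 0)" "g \<otimes>\<^bsub>QR\<^esub> g \<ominus>\<^bsub>QR\<^esub> g = \<iota> h" by blast
  note c = ideal_closed[OF ideal_power_ideal[OF m_ideal]]
  have hc: "h \<in> carrier R" using c(2)[OF h(1)] .
  have "h \<in> ideal_power R m (Suc n)" for n
  proof -
    obtain y where y: "y \<in> ideal_power R m (Suc n)" "g \<otimes>\<^bsub>QR\<^esub> g \<ominus>\<^bsub>QR\<^esub> g = \<iota> y" using g_in[of n] by blast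
    have "h = y" by (rule \<iota>_inj[OF hc c(2)[OF y(1)]]) (use h(2) y(2) in simp)
    then show ?thesis using y(1) by (simp only:)
  qed
  then have "h \<in> ideal_power R m n" for n using ideal_power_Suc_subset[OF m_ideal] by blast
  then have "h = \<zero>" by (rule ideal_powers_Inter[OF hc])
  then have gg: "g \<otimes>\<^bsub>QR\<^esub> g \<ominus>\<^bsub>QR\<^esub> g = \<zero>\<^bsub>QR\<^esub>" using h(2) by simp
  have "g \<otimes>\<^bsub>QR\<^esub> (g \<ominus>\<^bsub>QR\<^esub> \<one>\<^bsub>QR\<^esub>) = g \<otimes>\<^bsub>QR\<^esub> g \<ominus>\<^bsub>QR\<^esub> g"
    using gc by (simp add: Q.minus_eq Q.r_distr Q.r_minus)
  then have "g = \<zero>\<^bsub>QR\<^esub> \<or> g \<ominus>\<^bsub>QR\<^esub> \<one>\<^bsub>QR\<^esub> = \<zero>\<^bsub>QR\<^esub>"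
    using gg Q.integral[of g "g \<ominus>\<^bsub>QR\<^esub> \<one>\<^bsub>QR\<^esub>"] gc by simp
  then show ?thesis
  proof
    assume "g = \<zero>\<^bsub>QR\<^esub>"
    then have "e = \<ominus>\<^bsub>QR\<^esub> \<iota> r" using ec r(1) Q.minus_equality[of e "\<iota> r"] by (simp add: g_def)
    then show ?thesis using rm M_closed(4) by (auto simp: M_def)
  next
    assume "g \<ominus>\<^bsub>QR\<^esub> \<one>\<^bsub>QR\<^esub> = \<zero>\<^bsub>QR\<^esub>"
    then have "g = \<one>\<^bsub>QR\<^esub>" using Q.eq_of_minus_eq_zero[OF gc] by simp
    then have "\<iota> r \<oplus>\<^bsub>QR\<^esub> e \<ominus>\<^bsub>QR\<^esub> e = \<one>\<^bsub>QR\<^esub> \<ominus>\<^bsub>QR\<^esub> e" using ec r(1) by (simp add: g_def Q.a_comm)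
    then have "\<one>\<^bsub>QR\<^esub> \<ominus>\<^bsub>QR\<^esub> e = \<iota> r" using ec r(1) by (simp add: Q.minus_add_cancel)
    then show ?thesis using rm by (auto simp: M_def)
  qed
qed

text \<open>If \<open>a\<^sup>n\<close> is a multiple of \<open>a\<^bsup>n+1\<^esup>\<close>, then iterating shows that \<open>a\<^sup>n\<close> equals \<open>a\<^sup>n e\<close> with
  \<open>e = (a y)\<^sup>n\<close>, and that \<open>e\<close> is idempotent. The two idempotents 0 and 1 correspond to the two cases.\<close>

lemma nilpotent_or_unit_of_fitting:
  assumes a: "a \<in> S" and y: "y \<in> S" and fit: "a [^]\<^bsub>QR\<^esub> (n::nat) \<ominus>\<^bsub>QR\<^esub> a [^]\<^bsub>QR\<^esub> Suc n \<otimes>\<^bsub>QR\<^esub> y \<in> M"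
  shows "(\<exists>n::nat. a [^]\<^bsub>QR\<^esub> n \<in> M) \<or> (\<exists>y\<in>S. \<one>\<^bsub>QR\<^esub> \<ominus>\<^bsub>QR\<^esub> a \<otimes>\<^bsub>QR\<^esub> y \<in> M)"
proof -
  have ac: "a \<in> carrier QR" and yc: "y \<in> carrier QR" using a y S_carrier by auto
  define A where "A = a [^]\<^bsub>QR\<^esub> n"
  have A: "A \<in> S" "A \<in> carrier QR" using S_pow[OF a] ac by (auto simp: A_def)
  have iter: "A \<ominus>\<^bsub>QR\<^esub> A \<otimes>\<^bsub>QR\<^esub> (a \<otimes>\<^bsub>QR\<^esub> y) [^]\<^bsub>QR\<^esub> (k::nat) \<in> M" for k
  proof (induction k)
    case 0
    then show ?case using A M_closed(1) by (simp add: Q.minus_self_eq_zero)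
  next
    case (Suc k)
    let ?w = "a \<otimes>\<^bsub>QR\<^esub> y" let ?W = "?w [^]\<^bsub>QR\<^esub> k"
    have W: "?W \<in> S" "?W \<in> carrier QR" "?w \<in> carrier QR" using S_pow[OF S_closed(3)[OF a y]] ac yc by auto
    have "A \<ominus>\<^bsub>QR\<^esub> A \<otimes>\<^bsub>QR\<^esub> ?w \<in> M" using fit A ac yc by (simp add: A_def Q.m_assoc)
    then have "?W \<otimes>\<^bsub>QR\<^esub> (A \<ominus>\<^bsub>QR\<^esub> A \<otimes>\<^bsub>QR\<^esub> ?w) \<in> M" using S_M W by blast
    then have "(A \<ominus>\<^bsub>QR\<^esub> A \<otimes>\<^bsub>QR\<^esub> ?W) \<oplus>\<^bsub>QR\<^esub> ?W \<otimes>\<^bsub>QR\<^esub> (A \<ominus>\<^bsub>QR\<^esub> A \<otimes>\<^bsub>QR\<^esub> ?w) \<in> M" using Suc M_closed(3) by blast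
    moreover have "(A \<ominus>\<^bsub>QR\<^esub> A \<otimes>\<^bsub>QR\<^esub> ?W) \<oplus>\<^bsub>QR\<^esub> ?W \<otimes>\<^bsub>QR\<^esub> (A \<ominus>\<^bsub>QR\<^esub> A \<otimes>\<^bsub>QR\<^esub> ?w) = A \<ominus>\<^bsub>QR\<^esub> A \<otimes>\<^bsub>QR\<^esub> (?W \<otimes>\<^bsub>QR\<^esub> ?w)"
      using A W(2,3) by (simp add: Q.minus_eq Q.r_distr Q.r_minus Q.a_assoc Q.r_neg1 Q.m_lcomm[of ?W A] Q.m_comm[of ?W A])
    ultimately show ?case by simp
  qed
  show ?thesis
  proof (cases n)
    case 0
    then show ?thesis using fit y ac yc by auto
  next
    case (Suc k)
    define e where "e = (a \<otimes>\<^bsub>QR\<^esub> y) [^]\<^bsub>QR\<^esub> n"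
    have yS: "y [^]\<^bsub>QR\<^esub> n \<in> S" "y [^]\<^bsub>QR\<^esub> n \<in> carrier QR" using S_pow[OF y] yc by auto
    have e: "e \<in> S" "e \<in> carrier QR" using S_pow[OF S_closed(3)[OF a y]] ac yc by (auto simp: e_def)
    have eA: "e = A \<otimes>\<^bsub>QR\<^esub> y [^]\<^bsub>QR\<^esub> n" using ac yc by (simp add: e_def A_def Q.nat_pow_distrib)
    have 1: "A \<ominus>\<^bsub>QR\<^esub> A \<otimes>\<^bsub>QR\<^esub> e \<in> M" using iter[of n] by (simp add: e_def)
    have "y [^]\<^bsub>QR\<^esub> n \<otimes>\<^bsub>QR\<^esub> (A \<ominus>\<^bsub>QR\<^esub> A \<otimes>\<^bsub>QR\<^esub> e) \<in> M" using S_M[OF 1 yS(1)] .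
    moreover have "y [^]\<^bsub>QR\<^esub> n \<otimes>\<^bsub>QR\<^esub> (A \<ominus>\<^bsub>QR\<^esub> A \<otimes>\<^bsub>QR\<^esub> e) = e \<ominus>\<^bsub>QR\<^esub> e \<otimes>\<^bsub>QR\<^esub> e"
    proof -
      have "y [^]\<^bsub>QR\<^esub> n \<otimes>\<^bsub>QR\<^esub> A = e" using eA A yS Q.m_comm by simp
      moreover have "y [^]\<^bsub>QR\<^esub> n \<otimes>\<^bsub>QR\<^esub> (A \<otimes>\<^bsub>QR\<^esub> e) = e \<otimes>\<^bsub>QR\<^esub> e"
        using A yS e Q.m_assoc[of "y [^]\<^bsub>QR\<^esub> n" A e] calculation by simp
      ultimately show ?thesis using A yS e by (simp add: Q.minus_eq Q.r_distr Q.r_minus)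
    qed
    ultimately have "e \<ominus>\<^bsub>QR\<^esub> e \<otimes>\<^bsub>QR\<^esub> e \<in> M" by simp
    then have "\<ominus>\<^bsub>QR\<^esub> (e \<ominus>\<^bsub>QR\<^esub> e \<otimes>\<^bsub>QR\<^esub> e) \<in> M" by (rule M_closed(4))
    then have "e \<otimes>\<^bsub>QR\<^esub> e \<ominus>\<^bsub>QR\<^esub> e \<in> M" using e by (simp add: Q.minus_eq Q.minus_add Q.a_comm)
    from idempotent_mod_M[OF e(1) this] show ?thesis
    proof
      assume "e \<in> M"
      then have "A \<ominus>\<^bsub>QR\<^esub> A \<otimes>\<^bsub>QR\<^esub> e \<oplus>\<^bsub>QR\<^esub> A \<otimes>\<^bsub>QR\<^esub> e \<in> M" using S_M[OF _ A(1)] 1 M_closed(3) by blast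
      then have "A \<in> M" using A e by (simp add: Q.minus_add_cancel)
      then show ?thesis by (auto simp: A_def)
    next
      assume *: "\<one>\<^bsub>QR\<^esub> \<ominus>\<^bsub>QR\<^esub> e \<in> M"
      have "e = a \<otimes>\<^bsub>QR\<^esub> (y \<otimes>\<^bsub>QR\<^esub> (a \<otimes>\<^bsub>QR\<^esub> y) [^]\<^bsub>QR\<^esub> k)"
        unfolding e_def Suc using ac yc Q.nat_pow_Suc2[of "a \<otimes>\<^bsub>QR\<^esub> y" k] by (simp add: Q.m_assoc del: Q.nat_pow_Suc)
      moreover have "y \<otimes>\<^bsub>QR\<^esub> (a \<otimes>\<^bsub>QR\<^esub> y) [^]\<^bsub>QR\<^esub> k \<in> S" using S_closed(3) S_pow a y by simp
      ultimately show ?thesis using * by metis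
    qed
  qed
qed

lemma eval_S:
  assumes "a \<in> S" "set f \<subseteq> carrier R" shows "Q.eval (map \<iota> f) a \<in> S"
  using assms(2) by (induction f) (use assms(1) in \<open>auto simp: S_closed S_pow \<iota>_in_S\<close>)

lemma eval_snoc:
  assumes "a \<in> carrier QR" "set f \<subseteq> carrier R" "r \<in> carrier R"
  shows "Q.eval (map \<iota> (f @ [r])) a = Q.eval (map \<iota> f) a \<otimes>\<^bsub>QR\<^esub> a \<oplus>\<^bsub>QR\<^esub> \<iota> r"
proof -
  have "set (map \<iota> f) \<subseteq> carrier QR" using assms(2) by auto
  from Q.eval_append_aux[OF this, of "\<iota> r" a] show ?thesis using assms by simp
qed

text \<open>The lowest coefficient that is a unit of \<open>R\<close> can be divided by; lower coefficients lie in \<open>m\<close> and can be dropped. The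
  list runs from the leading coefficient to the constant one, so the induction peels off the constant term.\<close>

lemma fitting_of_integral:
  assumes a: "a \<in> S" and f: "set f \<subseteq> carrier R"
    and eq: "a [^]\<^bsub>QR\<^esub> (j::nat) \<otimes>\<^bsub>QR\<^esub> Q.eval (map \<iota> (\<one> # f)) a \<in> M"
  shows "\<exists>n::nat. \<exists>y\<in>S. a [^]\<^bsub>QR\<^esub> n \<ominus>\<^bsub>QR\<^esub> a [^]\<^bsub>QR\<^esub> Suc n \<otimes>\<^bsub>QR\<^esub> y \<in> M"
  using f eq
proof (induction f arbitrary: j rule: rev_induct)
  case Nil
  have ac: "a \<in> carrier QR" using a S_carrier by auto
  then have "a [^]\<^bsub>QR\<^esub> j \<ominus>\<^bsub>QR\<^esub> a [^]\<^bsub>QR\<^esub> Suc j \<otimes>\<^bsub>QR\<^esub> \<zero>\<^bsub>QR\<^esub> \<in> M" using Nil by (simp add: a_minus_def)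
  then show ?case using S_closed(1) by blast
next
  case (snoc r g)
  have ac: "a \<in> carrier QR" using a S_carrier by auto
  have g: "set g \<subseteq> carrier R" "r \<in> carrier R" using snoc.prems by auto
  define G where "G = Q.eval (map \<iota> (\<one> # g)) a"
  have G: "G \<in> S" "G \<in> carrier QR" using eval_S[OF a, of "\<one> # g"] g S_carrier by (auto simp: G_def)
  define A where "A = a [^]\<^bsub>QR\<^esub> j"
  have A: "A \<in> S" "A \<in> carrier QR" using S_pow[OF a] ac by (auto simp: A_def)
  have ir: "\<iota> r \<in> carrier QR" using g by simp
  have "Q.eval (map \<iota> (\<one> # g @ [r])) a = G \<otimes>\<^bsub>QR\<^esub> a \<oplus>\<^bsub>QR\<^esub> \<iota> r"
    using eval_snoc[OF ac, of "\<one> # g" r] g by (simp add: G_def)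
  then have E: "A \<otimes>\<^bsub>QR\<^esub> (G \<otimes>\<^bsub>QR\<^esub> a \<oplus>\<^bsub>QR\<^esub> \<iota> r) \<in> M" using snoc.prems(2) by (simp add: A_def)
  show ?case
  proof (cases "r \<in> m")
    case True
    then have "A \<otimes>\<^bsub>QR\<^esub> \<iota> r \<in> M" using S_M[OF _ A(1)] by (auto simp: M_def)
    then have "A \<otimes>\<^bsub>QR\<^esub> (G \<otimes>\<^bsub>QR\<^esub> a \<oplus>\<^bsub>QR\<^esub> \<iota> r) \<ominus>\<^bsub>QR\<^esub> A \<otimes>\<^bsub>QR\<^esub> \<iota> r \<in> M" using E M_closed(5) by blast
    moreover have "A \<otimes>\<^bsub>QR\<^esub> (G \<otimes>\<^bsub>QR\<^esub> a \<oplus>\<^bsub>QR\<^esub> \<iota> r) \<ominus>\<^bsub>QR\<^esub> A \<otimes>\<^bsub>QR\<^esub> \<iota> r = a [^]\<^bsub>QR\<^esub> Suc j \<otimes>\<^bsub>QR\<^esub> G"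
      using A G ac ir by (simp add: Q.r_distr Q.minus_add_cancel) (simp add: A_def Q.m_assoc Q.m_comm[of G a])
    ultimately show ?thesis using snoc.IH[OF g(1), of "Suc j"] by (simp add: G_def)
  next
    case False
    then have u: "r \<in> Units R" using unit_if_notin_m g by blast
    define s where "s = \<iota> (inv r)"
    have s: "s \<in> S" "s \<in> carrier QR" using Units_inv_closed[OF u] \<iota>_in_S by (auto simp: s_def)
    have sr: "s \<otimes>\<^bsub>QR\<^esub> \<iota> r = \<one>\<^bsub>QR\<^esub>"
      unfolding s_def using Units_l_inv[OF u] Units_inv_closed[OF u] g(2) i.hom_mult[of "inv r" r] by simp
    have "s \<otimes>\<^bsub>QR\<^esub> (A \<otimes>\<^bsub>QR\<^esub> (G \<otimes>\<^bsub>QR\<^esub> a \<oplus>\<^bsub>QR\<^esub> \<iota> r)) \<in> M" using S_M[OF E s(1)] .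
    moreover have "s \<otimes>\<^bsub>QR\<^esub> (A \<otimes>\<^bsub>QR\<^esub> (G \<otimes>\<^bsub>QR\<^esub> a \<oplus>\<^bsub>QR\<^esub> \<iota> r)) = A \<ominus>\<^bsub>QR\<^esub> a [^]\<^bsub>QR\<^esub> Suc j \<otimes>\<^bsub>QR\<^esub> (\<ominus>\<^bsub>QR\<^esub> (s \<otimes>\<^bsub>QR\<^esub> G))"
    proof -
      have "s \<otimes>\<^bsub>QR\<^esub> (A \<otimes>\<^bsub>QR\<^esub> \<iota> r) = A" using sr A s ir by (simp add: Q.m_lcomm[of s A])
      moreover have "s \<otimes>\<^bsub>QR\<^esub> (A \<otimes>\<^bsub>QR\<^esub> (G \<otimes>\<^bsub>QR\<^esub> a)) = a [^]\<^bsub>QR\<^esub> Suc j \<otimes>\<^bsub>QR\<^esub> (s \<otimes>\<^bsub>QR\<^esub> G)"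
        using A s G ac by (simp add: A_def Q.m_assoc Q.m_lcomm[of s] Q.m_comm[of G a])
      ultimately show ?thesis using A s G ac ir
        by (simp add: Q.r_distr Q.r_minus a_minus_def Q.a_comm del: Q.nat_pow_Suc)
    qed
    moreover have "\<ominus>\<^bsub>QR\<^esub> (s \<otimes>\<^bsub>QR\<^esub> G) \<in> S" using S_closed s G by blast
    ultimately show ?thesis by (metis A_def)
  qed
qed

text \<open>For nonzero \<open>x \<in> m\<close> all products \<open>a\<^sup>n x\<close> lie in \<open>m\<close>, so the ideals \<open>V n\<close> generated by \<open>x, a x, \<dots>, a\<^bsup>n-1\<^esup> x\<close> form an
  ascending chain in \<open>R\<close>. When it stops, \<open>a\<^sup>n x\<close> is a combination of lower terms, and \<open>x\<close> cancels.\<close>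

lemma integral_equation:
  assumes m0: "m \<noteq> {\<zero>}" and a: "a \<in> S"
  shows "\<exists>f. set f \<subseteq> carrier R \<and> Q.eval (map \<iota> (\<one> # f)) a = \<zero>\<^bsub>QR\<^esub>"
proof -
  have ac: "a \<in> carrier QR" by (rule S_carrier[OF a])
  note mc = ideal_closed[OF m_ideal]
  obtain x where x: "x \<in> m" "x \<noteq> \<zero>" using m0 mc(1) by blast
  have ix: "\<iota> x \<in> carrier QR" "\<iota> x \<noteq> \<zero>\<^bsub>QR\<^esub>" using x \<iota>_inj[of x \<zero>] by auto
  \<comment> \<open>The recursion is the Horner scheme: an element of the next ideal is \<open>r x + a w\<close> with \<open>w\<close> in the previous one.\<close>
  define V where "V = rec_nat {\<zero>} (\<lambda>_ W. {v \<in> carrier R. \<exists>r\<in>carrier R. \<exists>w\<in>W. \<iota> v = \<iota> (r \<otimes> x) \<oplus>\<^bsub>QR\<^esub> a \<otimes>\<^bsub>QR\<^esub> \<iota> w})"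
  have V0: "V 0 = {\<zero>}" by (simp add: V_def)
  have VS: "V (Suc n) = {v \<in> carrier R. \<exists>r\<in>carrier R. \<exists>w\<in>V n. \<iota> v = \<iota> (r \<otimes> x) \<oplus>\<^bsub>QR\<^esub> a \<otimes>\<^bsub>QR\<^esub> \<iota> w}" for n
    by (simp add: V_def)
  have Vc: "w \<in> carrier R" if "w \<in> V n" for w n using that by (cases n) (auto simp: V0 VS)
  have Videal: "ideal (V n) R" for n
  proof (induction n)
    case 0
    show ?case unfolding V0 by (rule zeroideal)
  next
    case (Suc n)
    note c = ideal_closed[OF Suc]
    show ?case
    proof (rule idealI_cring)
      show "V (Suc n) \<subseteq> carrier R" using Vc by blast
      show "\<zero> \<in> V (Suc n)" unfolding VS using c(1) x(1) ac
        by (intro CollectI conjI zero_closed bexI[OF _ zero_closed] bexI[OF _ c(1)]) simp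
      fix u v assume "u \<in> V (Suc n)"
      then obtain r w where u: "u \<in> carrier R" "r \<in> carrier R" "w \<in> V n" "\<iota> u = \<iota> (r \<otimes> x) \<oplus>\<^bsub>QR\<^esub> a \<otimes>\<^bsub>QR\<^esub> \<iota> w"
        by (auto simp: VS)
      have wc: "w \<in> carrier R" by (rule Vc[OF u(3)])
      { assume "v \<in> V (Suc n)"
        then obtain r' w' where v: "v \<in> carrier R" "r' \<in> carrier R" "w' \<in> V n" "\<iota> v = \<iota> (r' \<otimes> x) \<oplus>\<^bsub>QR\<^esub> a \<otimes>\<^bsub>QR\<^esub> \<iota> w'"
          by (auto simp: VS)
        have wc': "w' \<in> carrier R" by (rule Vc[OF v(3)])
        have "\<iota> (u \<oplus> v) = \<iota> ((r \<oplus> r') \<otimes> x) \<oplus>\<^bsub>QR\<^esub> a \<otimes>\<^bsub>QR\<^esub> \<iota> (w \<oplus> w')"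
          using u v wc wc' x(1) ac ix by (simp add: Q.l_distr Q.r_distr Q.a_ac)
        then show "u \<oplus> v \<in> V (Suc n)" unfolding VS
          using u(1,2) v(1,2) c(3)[OF u(3) v(3)] by blast }
      { assume v: "v \<in> carrier R"
        have "\<iota> (v \<otimes> u) = \<iota> ((v \<otimes> r) \<otimes> x) \<oplus>\<^bsub>QR\<^esub> a \<otimes>\<^bsub>QR\<^esub> \<iota> (v \<otimes> w)"
          using u v wc x(1) ac ix by (simp add: Q.r_distr Q.m_assoc Q.m_lcomm[of "\<iota> v" a])
        then show "v \<otimes> u \<in> V (Suc n)" unfolding VS
          using u(1,2) v c(6)[OF u(3) v] by blast }
    qed
  qed
  have mono: "V n \<subseteq> V (Suc n)" for n
  proof (induction n)
    case 0
    show ?case unfolding V0 using ideal_closed(1)[OF Videal] by blast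
  next
    case (Suc n)
    then show ?case unfolding VS by blast
  qed
  have "\<exists>n. \<forall>k\<ge>n. V k = V n" by (rule ideal_sequence_stabilizes[of V, OF Videal mono])
  then obtain n where n: "V (Suc n) = V n" by (metis le_Suc_eq order_refl)
  have rep: "\<exists>f. set f \<subseteq> carrier R \<and> length f = k \<and> \<iota> v = Q.eval (map \<iota> f) a \<otimes>\<^bsub>QR\<^esub> \<iota> x" if "v \<in> V k" for v k
    using that
  proof (induction k arbitrary: v)
    case 0
    then show ?case using ix by (intro exI[of _ "[]"]) (simp add: V0)
  next
    case (Suc k)
    then obtain r w where v: "r \<in> carrier R" "w \<in> V k" "\<iota> v = \<iota> (r \<otimes> x) \<oplus>\<^bsub>QR\<^esub> a \<otimes>\<^bsub>QR\<^esub> \<iota> w" by (auto simp: VS)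
    obtain f where f: "set f \<subseteq> carrier R" "length f = k" "\<iota> w = Q.eval (map \<iota> f) a \<otimes>\<^bsub>QR\<^esub> \<iota> x" using Suc.IH[OF v(2)] by blast
    have F: "Q.eval (map \<iota> f) a \<in> carrier QR" using eval_S[OF a f(1)] S_carrier by blast
    have "\<iota> v = (Q.eval (map \<iota> f) a \<otimes>\<^bsub>QR\<^esub> a \<oplus>\<^bsub>QR\<^esub> \<iota> r) \<otimes>\<^bsub>QR\<^esub> \<iota> x"
      unfolding v(3) f(3) using F v(1) x(1) ix ac
      by (simp add: Q.l_distr Q.m_assoc Q.m_lcomm[of a] Q.a_comm)
    then have "\<iota> v = Q.eval (map \<iota> (f @ [r])) a \<otimes>\<^bsub>QR\<^esub> \<iota> x" unfolding eval_snoc[OF ac f(1) v(1)] .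
    then show ?case using f v(1) by (intro exI[of _ "f @ [r]"]) simp
  qed
  have pw: "\<exists>u\<in>V (Suc k). u \<in> m \<and> \<iota> u = a [^]\<^bsub>QR\<^esub> k \<otimes>\<^bsub>QR\<^esub> \<iota> x" for k
  proof (induction k)
    case 0
    have eq: "\<iota> x = \<iota> (\<one> \<otimes> x) \<oplus>\<^bsub>QR\<^esub> a \<otimes>\<^bsub>QR\<^esub> \<iota> \<zero>" using x(1) ac ix by simp
    have "\<exists>r\<in>carrier R. \<exists>w\<in>{\<zero>}. \<iota> x = \<iota> (r \<otimes> x) \<oplus>\<^bsub>QR\<^esub> a \<otimes>\<^bsub>QR\<^esub> \<iota> w"
      by (rule bexI[of _ \<one>], rule bexI[of _ \<zero>], rule eq) simp_all
    then have "x \<in> V (Suc 0)" unfolding VS V0 mem_Collect_eq by (rule conjI[OF m_closed[OF x(1)]])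
    then show ?case using x(1) ix by (intro bexI[of _ x]) auto
  next
    case (Suc k)
    then obtain u where u: "u \<in> V (Suc k)" "u \<in> m" "\<iota> u = a [^]\<^bsub>QR\<^esub> k \<otimes>\<^bsub>QR\<^esub> \<iota> x" by blast
    have "a \<otimes>\<^bsub>QR\<^esub> \<iota> u \<in> M" using S_M[OF _ a, of "\<iota> u"] u(2) by (auto simp: M_def)
    then obtain u' where u': "u' \<in> m" "\<iota> u' = a \<otimes>\<^bsub>QR\<^esub> \<iota> u" by (auto simp: M_def)
    have "\<iota> u' = \<iota> (\<zero> \<otimes> x) \<oplus>\<^bsub>QR\<^esub> a \<otimes>\<^bsub>QR\<^esub> \<iota> u" using u' u(2) x(1) ac by simp
    then have "u' \<in> V (Suc (Suc k))" unfolding VS[of "Suc k"] using u(1) u'(1) zero_closed by auto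
    moreover have "\<iota> u' = a [^]\<^bsub>QR\<^esub> Suc k \<otimes>\<^bsub>QR\<^esub> \<iota> x"
      unfolding u'(2) u(3) Q.nat_pow_Suc2[OF ac] using ac ix by (simp add: Q.m_assoc)
    ultimately show ?case using u'(1) by blast
  qed
  obtain u where u: "u \<in> V (Suc n)" "\<iota> u = a [^]\<^bsub>QR\<^esub> n \<otimes>\<^bsub>QR\<^esub> \<iota> x" using pw[of n] by blast
  then have "u \<in> V n" using n by simp
  then obtain f where f: "set f \<subseteq> carrier R" "length f = n" "\<iota> u = Q.eval (map \<iota> f) a \<otimes>\<^bsub>QR\<^esub> \<iota> x" using rep by blast
  have F: "Q.eval (map \<iota> f) a \<in> carrier QR" using eval_S[OF a f(1)] S_carrier by blast
  have an: "a [^]\<^bsub>QR\<^esub> n = Q.eval (map \<iota> f) a"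
    using u(2) f(3) F ac Q.m_rcancel[OF ix(2,1), of "a [^]\<^bsub>QR\<^esub> n" "Q.eval (map \<iota> f) a"] by simp
  have neg: "Q.eval (map \<iota> (map (\<lambda>r. \<ominus> r) h)) a = \<ominus>\<^bsub>QR\<^esub> Q.eval (map \<iota> h) a" if "set h \<subseteq> carrier R" for h
    using that
  proof (induction h)
    case (Cons c h)
    have "Q.eval (map \<iota> h) a \<in> carrier QR" using eval_S[OF a, of h] Cons.prems S_carrier by auto
    then show ?case using Cons ac by (simp add: Q.minus_add Q.l_minus)
  qed simp
  have "Q.eval (map \<iota> (\<one> # map (\<lambda>r. \<ominus> r) f)) a = \<zero>\<^bsub>QR\<^esub>"
    using neg[OF f(1)] an f(2) F ac by (simp add: Q.r_neg)
  moreover have "set (map (\<lambda>r. \<ominus> r) f) \<subseteq> carrier R" using f(1) by auto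
  ultimately show ?thesis by blast
qed

lemma nilpotent_or_unit_mod_M:
  assumes m0: "m \<noteq> {\<zero>}" and a: "a \<in> S"
  shows "(\<exists>n::nat. a [^]\<^bsub>QR\<^esub> n \<in> M) \<or> (\<exists>y\<in>S. \<one>\<^bsub>QR\<^esub> \<ominus>\<^bsub>QR\<^esub> a \<otimes>\<^bsub>QR\<^esub> y \<in> M)"
proof -
  obtain f where f: "set f \<subseteq> carrier R" "Q.eval (map \<iota> (\<one> # f)) a = \<zero>\<^bsub>QR\<^esub>" using integral_equation[OF assms] by blast
  have "a [^]\<^bsub>QR\<^esub> (0::nat) \<otimes>\<^bsub>QR\<^esub> Q.eval (map \<iota> (\<one> # f)) a \<in> M" unfolding f(2) using M_closed(1) by simp
  from fitting_of_integral[OF a f(1) this] obtain n y where "y \<in> S"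
    "a [^]\<^bsub>QR\<^esub> (n::nat) \<ominus>\<^bsub>QR\<^esub> a [^]\<^bsub>QR\<^esub> Suc n \<otimes>\<^bsub>QR\<^esub> y \<in> M" by blast
  then show ?thesis by (rule nilpotent_or_unit_of_fitting[OF a])
qed

abbreviation SR where "SR \<equiv> QR\<lparr>carrier := S\<rparr>"

definition N where "N = {s \<in> S. \<exists>n::nat. s [^]\<^bsub>QR\<^esub> n \<in> M}"

lemma SR_domain: "domain SR" by (rule Q.subring_is_domain[OF S_subring])

lemma pow_M_mono:
  assumes s: "s \<in> S" and n: "s [^]\<^bsub>QR\<^esub> (n::nat) \<in> M" and k: "n \<le> k"
  shows "s [^]\<^bsub>QR\<^esub> k \<in> M"
proof -
  have "s [^]\<^bsub>QR\<^esub> k = s [^]\<^bsub>QR\<^esub> n \<otimes>\<^bsub>QR\<^esub> s [^]\<^bsub>QR\<^esub> (k - n)"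
    using k S_carrier[OF s] by (simp add: Q.nat_pow_mult)
  then show ?thesis using M_S[OF n S_pow[OF s]] by simp
qed

lemma N_frobenius:
  assumes "s \<in> N" obtains n where "\<And>k. n \<le> k \<Longrightarrow> s [^]\<^bsub>QR\<^esub> (p ^ k) \<in> M"
proof -
  obtain n where n: "s \<in> S" "s [^]\<^bsub>QR\<^esub> (n::nat) \<in> M" using assms by (auto simp: N_def)
  have "s [^]\<^bsub>QR\<^esub> (p ^ k) \<in> M" if "n \<le> k" for k
    using pow_M_mono[OF n, of "p ^ k"] power_gt_expt[of p k] prime_gt_1_nat[OF p] that by simp
  then show ?thesis using that by blast
qed

lemma N_ideal: "ideal N SR"
proof -
  interpret SR: domain SR by (rule SR_domain)
  show ?thesis
  proof (rule SR.idealI_cring)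
    show "N \<subseteq> carrier SR" by (auto simp: N_def)
    have "\<zero>\<^bsub>QR\<^esub> [^]\<^bsub>QR\<^esub> (1::nat) \<in> M" using M_closed(1) by simp
    then have "\<zero>\<^bsub>QR\<^esub> \<in> N" using S_closed(1) unfolding N_def by blast
    then show "\<zero>\<^bsub>SR\<^esub> \<in> N" by simp
    fix a b assume a: "a \<in> N"
    then have aS: "a \<in> S" by (simp add: N_def)
    obtain n where n: "\<And>k. n \<le> k \<Longrightarrow> a [^]\<^bsub>QR\<^esub> (p ^ k) \<in> M" using N_frobenius[OF a] by blast
    { assume b: "b \<in> N"
      then have bS: "b \<in> S" by (simp add: N_def)
      obtain n' where n': "\<And>k. n' \<le> k \<Longrightarrow> b [^]\<^bsub>QR\<^esub> (p ^ k) \<in> M" using N_frobenius[OF b] by blast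
      have "(a \<oplus>\<^bsub>QR\<^esub> b) [^]\<^bsub>QR\<^esub> (p ^ (n + n')) = a [^]\<^bsub>QR\<^esub> (p ^ (n + n')) \<oplus>\<^bsub>QR\<^esub> b [^]\<^bsub>QR\<^esub> (p ^ (n + n'))"
        by (rule Q.frobenius_pow_add[OF p char_Q S_carrier[OF aS] S_carrier[OF bS]])
      also have "\<dots> \<in> M" using n[of "n + n'"] n'[of "n + n'"] M_closed(3) by simp
      finally show "a \<oplus>\<^bsub>SR\<^esub> b \<in> N" using S_closed(4)[OF aS bS] by (auto simp: N_def) }
    { assume b: "b \<in> carrier SR"
      then have bS: "b \<in> S" by simp
      have "(b \<otimes>\<^bsub>QR\<^esub> a) [^]\<^bsub>QR\<^esub> (p ^ n) = b [^]\<^bsub>QR\<^esub> (p ^ n) \<otimes>\<^bsub>QR\<^esub> a [^]\<^bsub>QR\<^esub> (p ^ n)"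
        by (rule Q.nat_pow_distrib[OF S_carrier[OF bS] S_carrier[OF aS]])
      also have "\<dots> \<in> M" using S_M[OF n[OF order_refl] S_pow[OF bS]] .
      finally show "b \<otimes>\<^bsub>SR\<^esub> a \<in> N" using S_closed(3)[OF bS aS] by (auto simp: N_def) }
  qed
qed

lemma M_in_N: "x \<in> M \<Longrightarrow> x \<in> N"
proof -
  assume x: "x \<in> M"
  then have "x [^]\<^bsub>QR\<^esub> (1::nat) \<in> M" using M_closed(2) by simp
  then show "x \<in> N" using x M_subset_S unfolding N_def by blast
qed

lemma \<iota>_in_N:
  assumes "r \<in> carrier R" shows "\<iota> r \<in> N \<longleftrightarrow> r \<in> m"
proof
  assume "\<iota> r \<in> N"
  then obtain n where "\<iota> r [^]\<^bsub>QR\<^esub> (n::nat) \<in> M" by (auto simp: N_def)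
  then have "\<iota> (r [^] n) \<in> M" using assms by (simp add: i.hom_nat_pow)
  then have "r [^] n \<in> m" using \<iota>_in_M assms by simp
  then show "r \<in> m" using primeideal_pow[OF m_prime assms] by blast
next
  assume "r \<in> m" then show "\<iota> r \<in> N" using M_in_N by (auto simp: M_def)
qed

text \<open>An element outside \<open>N\<close> is a unit modulo \<open>M\<close>.\<close>

lemma N_prime:
  assumes m0: "m \<noteq> {\<zero>}" shows "primeideal N SR"
proof -
  interpret SR: domain SR by (rule SR_domain)
  note c = SR.ideal_closed[OF N_ideal]
  show ?thesis
  proof (rule primeidealI[OF N_ideal SR.is_cring])
    have "\<iota> \<one> \<notin> N" using \<iota>_in_N[OF one_closed] primeideal_one_notin[OF m_prime] by simp
    then show "carrier SR \<noteq> N" using S_closed(2) by auto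
    fix a b assume ab: "a \<in> carrier SR" "b \<in> carrier SR" "a \<otimes>\<^bsub>SR\<^esub> b \<in> N"
    then have S: "a \<in> S" "b \<in> S" "a \<in> carrier QR" "b \<in> carrier QR" using S_carrier by auto
    from nilpotent_or_unit_mod_M[OF m0 S(1)] show "a \<in> N \<or> b \<in> N"
    proof
      assume "\<exists>n::nat. a [^]\<^bsub>QR\<^esub> n \<in> M"
      then show ?thesis using S by (auto simp: N_def)
    next
      assume "\<exists>y\<in>S. \<one>\<^bsub>QR\<^esub> \<ominus>\<^bsub>QR\<^esub> a \<otimes>\<^bsub>QR\<^esub> y \<in> M"
      then obtain y where y: "y \<in> S" "\<one>\<^bsub>QR\<^esub> \<ominus>\<^bsub>QR\<^esub> a \<otimes>\<^bsub>QR\<^esub> y \<in> M" by blast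
      have yc: "y \<in> carrier QR" using y S_carrier by auto
      have 1: "b \<otimes>\<^bsub>QR\<^esub> (\<one>\<^bsub>QR\<^esub> \<ominus>\<^bsub>QR\<^esub> a \<otimes>\<^bsub>QR\<^esub> y) \<in> N" using M_in_N[OF S_M[OF y(2) S(2)]] .
      have 2: "y \<otimes>\<^bsub>QR\<^esub> (a \<otimes>\<^bsub>QR\<^esub> b) \<in> N" using c(6)[OF ab(3), of y] y by simp
      have "b \<otimes>\<^bsub>QR\<^esub> (\<one>\<^bsub>QR\<^esub> \<ominus>\<^bsub>QR\<^esub> a \<otimes>\<^bsub>QR\<^esub> y) \<oplus>\<^bsub>QR\<^esub> y \<otimes>\<^bsub>QR\<^esub> (a \<otimes>\<^bsub>QR\<^esub> b) \<in> N" using c(3)[OF 1 2] by simp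
      moreover have "b \<otimes>\<^bsub>QR\<^esub> (\<one>\<^bsub>QR\<^esub> \<ominus>\<^bsub>QR\<^esub> a \<otimes>\<^bsub>QR\<^esub> y) \<oplus>\<^bsub>QR\<^esub> y \<otimes>\<^bsub>QR\<^esub> (a \<otimes>\<^bsub>QR\<^esub> b) = b"
      proof -
        have "y \<otimes>\<^bsub>QR\<^esub> (a \<otimes>\<^bsub>QR\<^esub> b) = b \<otimes>\<^bsub>QR\<^esub> (a \<otimes>\<^bsub>QR\<^esub> y)" using S yc by (simp add: Q.m_ac)
        then show ?thesis using S yc by (simp add: Q.minus_eq Q.r_distr Q.r_minus Q.a_assoc Q.l_neg)
      qed
      ultimately show ?thesis by simp
    qed
  qed
qed

text \<open>The quotient \<open>L\<close> of \<open>S\<close> by \<open>N\<close> is a domain that is integral over the algebraically closed field \<open>k\<close>, so the class of \<open>z\<close> comes from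
  some \<open>c \<in> R\<close>. Then \<open>z - c\<close> is nilpotent modulo \<open>M\<close>, and a power with exponent \<open>p^n\<close> lies in \<open>M \<subseteq> R\<close>.\<close>

lemma S_subset_image:
  assumes m0: "m \<noteq> {\<zero>}" and z: "z \<in> S"
  shows "z \<in> \<iota> ` carrier R"
proof -
  interpret SR: domain SR by (rule SR_domain)
  interpret N: primeideal N SR by (rule N_prime[OF m0])
  let ?L = "SR Quot N" and ?\<sigma> = "\<lambda>s. N +>\<^bsub>SR\<^esub> s"
  interpret L: domain ?L by (rule N.quotient_is_domain)
  interpret \<sigma>: ring_hom_ring SR ?L ?\<sigma> by (rule N.rcos_ring_hom_ring)
  note q = SR.quot_simps[OF N_ideal]
  have iS: "\<iota> \<in> ring_hom R SR" by (rule ring_hom_memI) (use \<iota>_in_S in auto)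
  define h where "h r = ?\<sigma> (\<iota> r)" for r
  have hhom: "h \<in> ring_hom R ?L"
    unfolding h_def by (rule ring_hom_memI) (use \<iota>_in_S \<sigma>.hom_closed \<sigma>.hom_mult \<sigma>.hom_add \<sigma>.hom_one in auto)
  interpret h: ring_hom_ring R ?L h by (rule ring_hom_ringI2[OF ring_axioms L.ring_axioms hhom])
  have "?\<sigma> (\<iota> r) = N \<longleftrightarrow> r \<in> m" if "r \<in> carrier R" for r
    using q(6)[of "\<iota> r"] \<iota>_in_S[OF that] \<iota>_in_N[OF that] by simp
  then have ker: "a_kernel R ?L h = m"
    unfolding a_kernel_def' h_def q(2) using m_closed by blast
  let ?\<psi> = "\<lambda>U. the_elem (h ` U)"
  have \<psi>: "?\<psi> \<in> ring_hom (R Quot m) ?L" using h.the_elem_hom unfolding ker .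
  have \<psi>h: "?\<psi> (m +> r) = h r" if "r \<in> carrier R" for r using h.the_elem_simp[OF that] unfolding ker .
  obtain f where f: "set f \<subseteq> carrier R" "Q.eval (map \<iota> (\<one> # f)) z = \<zero>\<^bsub>QR\<^esub>" using integral_equation[OF m0 z] by blast
  define g where "g = map (\<lambda>r. m +> r) (\<one> # f)"
  note qm = quot_simps[OF m_ideal]
  have "m +> \<one> \<noteq> m" using qm(6)[OF one_closed] primeideal_one_notin[OF m_prime] by simp
  moreover have "m +> r \<in> carrier (R Quot m)" if "r \<in> carrier R" for r using qm(1) that by blast
  ultimately have g: "g \<in> carrier (poly_ring (R Quot m))" "g \<noteq> []"
    unfolding univ_poly_carrier[symmetric] polynomial_def g_def qm(2) using f(1) one_closed by auto
  have "map ?\<psi> g = map ?\<sigma> (map \<iota> (\<one> # f))"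
    unfolding g_def map_map using f(1) \<psi>h by (auto simp: h_def)
  moreover have "?\<sigma> (SR.eval (map \<iota> (\<one> # f)) z) = L.eval (map ?\<sigma> (map \<iota> (\<one> # f))) (?\<sigma> z)"
    by (rule \<sigma>.eval_hom') (use z f(1) \<iota>_in_S S_closed(2) in auto)
  moreover have "SR.eval (map \<iota> (\<one> # f)) z = \<zero>\<^bsub>SR\<^esub>" using f(2) Q.eval_consistent[OF S_subring] by simp
  ultimately have ev: "L.eval (map ?\<psi> g) (?\<sigma> z) = \<zero>\<^bsub>?L\<^esub>" using \<sigma>.hom_zero by metis
  have zL: "?\<sigma> z \<in> carrier ?L" using z by (intro \<sigma>.hom_closed) simp
  obtain C where C: "C \<in> carrier (R Quot m)" "?\<psi> C = ?\<sigma> z"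
    using algebraically_closed_root_in_image[OF residue_closed L.domain_axioms \<psi> zL g ev] by blast
  then obtain c where c: "c \<in> carrier R" "C = m +> c" using qm(1) by auto
  have "?\<sigma> z = ?\<sigma> (\<iota> c)" using C(2) \<psi>h[OF c(1)] c(2) by (simp add: h_def)
  then have "z \<ominus>\<^bsub>SR\<^esub> \<iota> c \<in> N" using q(7)[of z "\<iota> c"] z \<iota>_in_S[OF c(1)] by simp
  moreover have "z \<ominus>\<^bsub>SR\<^esub> \<iota> c = z \<ominus>\<^bsub>QR\<^esub> \<iota> c"
  proof -
    have "\<ominus>\<^bsub>SR\<^esub> \<iota> c = \<ominus>\<^bsub>QR\<^esub> \<iota> c"
      by (rule SR.minus_equality) (use \<iota>_in_S[OF c(1)] S_closed(5) c(1) in \<open>auto simp: Q.l_neg\<close>)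
    then show ?thesis by (simp add: a_minus_def)
  qed
  ultimately have zN: "z \<ominus>\<^bsub>QR\<^esub> \<iota> c \<in> N" by simp
  obtain n where n: "\<And>k. n \<le> k \<Longrightarrow> (z \<ominus>\<^bsub>QR\<^esub> \<iota> c) [^]\<^bsub>QR\<^esub> (p ^ k) \<in> M" using N_frobenius[OF zN] by blast
  have "(z \<ominus>\<^bsub>QR\<^esub> \<iota> c) [^]\<^bsub>QR\<^esub> (p ^ n) \<in> \<iota> ` carrier R" using n[OF order_refl] by (auto simp: M_def)
  then have "z \<ominus>\<^bsub>QR\<^esub> \<iota> c \<in> \<iota> ` carrier R"
    by (rule root_closed[rotated]) (use S_carrier[OF z] c(1) in auto)
  then obtain e where e: "e \<in> carrier R" "z \<ominus>\<^bsub>QR\<^esub> \<iota> c = \<iota> e" by blast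
  have "z = \<iota> (e \<oplus> c)" using e c(1) S_carrier[OF z] Q.minus_add_cancel(1)[of z "\<iota> c"] by simp
  then show ?thesis using e(1) c(1) by blast
qed

end

section \<open>Associated primes and depth\<close>

context noetherian_cring
begin

lemma prime_avoiding_product:
  assumes "finite F" "\<And>Q. Q \<in> F \<Longrightarrow> ideal Q R \<and> \<not> Q \<subseteq> P" and P: "primeideal P R" and J: "ideal J R" "\<not> J \<subseteq> P"
  shows "\<exists>z\<in>J. z \<notin> P \<and> (\<forall>Q\<in>F. z \<in> Q)"
  using assms(1,2)
proof (induction F)
  case empty
  then show ?case using J(2) by auto
next
  case (insert Q F)
  then obtain z where z: "z \<in> J" "z \<notin> P" "\<And>Q. Q \<in> F \<Longrightarrow> z \<in> Q" by blast
  obtain q where q: "q \<in> Q" "q \<notin> P" using insert.prems[of Q] by blast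
  have iQ: "ideal Q R" using insert.prems by blast
  have c: "z \<in> carrier R" "q \<in> carrier R" using ideal_closed(2)[OF J(1) z(1)] ideal_closed(2)[OF iQ q(1)] by auto
  have "z \<otimes> q \<notin> P" using primeideal.I_prime[OF P c] z(2) q(2) by blast
  moreover have "z \<otimes> q \<in> J" using ideal_closed(5)[OF J(1) z(1) c(2)] .
  moreover have "z \<otimes> q \<in> Q'" if "Q' \<in> insert Q F" for Q'
  proof (cases "Q' = Q")
    case True
    then show ?thesis using ideal_closed(6)[OF iQ q(1) c(1)] by simp
  next
    case False
    then have "z \<in> Q'" "ideal Q' R" using that z(3) insert.prems by auto
    then show ?thesis using ideal_closed(5)[of Q' z q] c(2) by simp
  qed
  ultimately show ?case by blast
qed

text \<open>For primes without inclusions among them: if \<open>y\<close> avoids all but \<open>P\<close>, add an element that lies in all the others but not in \<open>P\<close>.\<close>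

lemma prime_avoidance:
  assumes "finite F" "\<And>Q. Q \<in> F \<Longrightarrow> primeideal Q R \<and> \<not> J \<subseteq> Q"
    "\<And>P Q. P \<in> F \<Longrightarrow> Q \<in> F \<Longrightarrow> Q \<subseteq> P \<Longrightarrow> Q = P" and J: "ideal J R"
  shows "\<exists>y\<in>J. \<forall>Q\<in>F. y \<notin> Q"
  using assms(1-3)
proof (induction F)
  case empty
  then show ?case using ideal_closed(1)[OF J] by auto
next
  case (insert P F)
  then obtain y where y: "y \<in> J" "\<And>Q. Q \<in> F \<Longrightarrow> y \<notin> Q" by blast
  have P: "primeideal P R" "\<not> J \<subseteq> P" using insert.prems(1) by blast+
  show ?case
  proof (cases "y \<in> P")
    case False
    then show ?thesis using y by blast
  next
    case True
    have "\<exists>z\<in>J. z \<notin> P \<and> (\<forall>Q\<in>F. z \<in> Q)"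
    proof (rule prime_avoiding_product[OF insert.hyps(1) _ P(1) J P(2)])
      fix Q assume Q: "Q \<in> F"
      then have "primeideal Q R" using insert.prems(1) by blast
      moreover have "Q \<noteq> P" using Q insert.hyps(2) by blast
      ultimately show "ideal Q R \<and> \<not> Q \<subseteq> P" using insert.prems(2)[of P Q] Q primeideal.axioms(1) by blast
    qed
    then obtain z where z: "z \<in> J" "z \<notin> P" "\<And>Q. Q \<in> F \<Longrightarrow> z \<in> Q" by blast
    have c: "y \<in> carrier R" "z \<in> carrier R" using ideal_closed(2)[OF J] y z by auto
    have "y \<oplus> z \<notin> P"
    proof
      assume "y \<oplus> z \<in> P"
      then have "z \<oplus> y \<ominus> y \<in> P" using ideal_closed(7)[OF primeideal.axioms(1)[OF P(1)]] True a_comm[OF c] by metis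
      then show False using z(2) c by (simp add: minus_add_cancel)
    qed
    moreover have "y \<oplus> z \<notin> Q" if Q: "Q \<in> F" for Q
    proof
      assume *: "y \<oplus> z \<in> Q"
      have "primeideal Q R" using insert.prems(1) Q by blast
      then have "y \<oplus> z \<ominus> z \<in> Q" using ideal_closed(7)[OF primeideal.axioms(1)] * z(3)[OF Q] by blast
      then show False using y(2)[OF Q] c by (simp add: minus_add_cancel)
    qed
    moreover have "y \<oplus> z \<in> J" using ideal_closed(3)[OF J] y(1) z(1) by blast
    ultimately show ?thesis by blast
  qed
qed

text \<open>The maximal annihilators of elements of \<open>R/I\<close>; they are associated primes, and every zero divisor modulo \<open>I\<close> lies in one of them.\<close>

definition max_colons :: "'a set \<Rightarrow> 'a set set" where
  "max_colons I = {P. (\<exists>b\<in>carrier R - I. P = colon R I b) \<and>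
     (\<forall>b\<in>carrier R - I. P \<subseteq> colon R I b \<longrightarrow> colon R I b = P)}"

lemma max_colons_prime:
  assumes I: "ideal I R" and P: "P \<in> max_colons I"
  shows "primeideal P R"
proof -
  obtain b where b: "b \<in> carrier R" "b \<notin> I" "P = colon R I b"
    and max: "\<And>c. c \<in> carrier R - I \<Longrightarrow> P \<subseteq> colon R I c \<Longrightarrow> colon R I c = P"
    using P by (auto simp: max_colons_def)
  show ?thesis
  proof (rule primeidealI)
    show "ideal P R" unfolding b(3) by (rule colon_ideal[OF I b(1)])
    show "cring R" by (rule is_cring)
    have "\<one> \<notin> P" using b by (simp add: colon_def)
    then show "carrier R \<noteq> P" using one_closed by blast
    fix x y assume xy: "x \<in> carrier R" "y \<in> carrier R" "x \<otimes> y \<in> P"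
    show "x \<in> P \<or> y \<in> P"
    proof (rule disjCI)
      assume y: "y \<notin> P"
      then have yb: "y \<otimes> b \<in> carrier R - I" using b xy by (auto simp: colon_def)
      have "P \<subseteq> colon R I (y \<otimes> b)"
        unfolding b(3) colon_def using xy(2) b(1) ideal_closed(6)[OF I, of _ y] by (auto simp: m_lcomm[of _ y b])
      from max[OF yb this] have eq: "colon R I (y \<otimes> b) = P" .
      have "x \<in> colon R I (y \<otimes> b)" using xy b by (simp add: colon_def m_assoc)
      then show "x \<in> P" unfolding eq .
    qed
  qed
qed

text \<open>For distinct members \<open>P n = (I : b n)\<close>, the elements \<open>v\<close> with \<open>r v \<in> I\<close> for all \<open>r\<close> in the intersection of \<open>P 0, \<dots>, P n\<close>
  form an ascending chain of ideals. If it stops at \<open>n\<close>, it contains \<open>b (n + 1)\<close>, and the intersection is contained in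
  \<open>P (n + 1)\<close>, which is impossible for primes without inclusions among them.\<close>

lemma max_colons_finite:
  assumes I: "ideal I R" shows "finite (max_colons I)"
proof (rule ccontr)
  assume "infinite (max_colons I)"
  then obtain P :: "nat \<Rightarrow> 'a set" where P: "inj P" "range P \<subseteq> max_colons I"
    using infinite_countable_subset by blast
  have prime: "primeideal (P n) R" for n using max_colons_prime[OF I] P(2) by blast
  have "\<exists>b. b \<in> carrier R - I \<and> P n = colon R I b" for n
  proof -
    have "P n \<in> max_colons I" using P(2) by blast
    then show ?thesis unfolding max_colons_def by blast
  qed
  then obtain b where b: "\<And>n. b n \<in> carrier R - I" "\<And>n. P n = colon R I (b n)" by metis
  have incomp: "\<not> P i \<subseteq> P j" if "i \<noteq> j" for i j
  proof
    assume sub: "P i \<subseteq> P j"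
    have "P i \<in> max_colons I" using P(2) by blast
    then have "P j = P i" using sub b(1)[of j] b(2)[of j] by (auto simp: max_colons_def)
    then show False using injD[OF P(1)] that by metis
  qed
  define J where "J n = {v \<in> carrier R. \<forall>r\<in>carrier R. (\<forall>i\<le>n. r \<in> P i) \<longrightarrow> r \<otimes> v \<in> I}" for n :: nat
  have "\<exists>n. \<forall>k\<ge>n. J k = J n"
  proof (rule ideal_sequence_stabilizes)
    fix n
    show "ideal (J n) R"
    proof (rule idealI_cring)
      show "J n \<subseteq> carrier R" by (auto simp: J_def)
      show "\<zero> \<in> J n" using ideal_closed(1)[OF I] by (auto simp: J_def)
      fix u v assume u: "u \<in> J n"
      show "v \<in> J n \<Longrightarrow> u \<oplus> v \<in> J n" using u ideal_closed(3)[OF I] by (auto simp: J_def r_distr)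
      show "v \<in> carrier R \<Longrightarrow> v \<otimes> u \<in> J n" using u ideal_closed(6)[OF I] by (auto simp: J_def m_lcomm[of _ v u])
    qed
    show "J n \<subseteq> J (Suc n)" by (auto simp: J_def)
  qed
  then obtain n where n: "J (Suc n) = J n" by (metis le_Suc_eq order_refl)
  have "b (Suc n) \<in> J (Suc n)" using b(1)[of "Suc n"] b(2)[of "Suc n"] by (auto simp: J_def colon_def)
  then have bn: "b (Suc n) \<in> J n" using n by simp
  have "\<exists>z\<in>carrier R. z \<notin> P (Suc n) \<and> (\<forall>Q\<in>P ` {..n}. z \<in> Q)"
  proof (rule prime_avoiding_product[OF _ _ prime oneideal])
    show "\<not> carrier R \<subseteq> P (Suc n)" using primeideal_one_notin[OF prime, of "Suc n"] one_closed by blast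
    fix Q assume "Q \<in> P ` {..n}"
    then obtain i where "i \<le> n" "Q = P i" by auto
    then show "ideal Q R \<and> \<not> Q \<subseteq> P (Suc n)" using incomp[of i "Suc n"] primeideal.axioms(1)[OF prime, of i] by auto
  qed simp
  then obtain z where z: "z \<in> carrier R" "z \<notin> P (Suc n)" "\<And>i. i \<le> n \<Longrightarrow> z \<in> P i" by auto
  then have "z \<otimes> b (Suc n) \<in> I" using bn by (auto simp: J_def)
  then show False using z(1,2) b(2)[of "Suc n"] by (simp add: colon_def)
qed

lemma zero_divisor_ideal_annihilator:
  assumes I: "ideal I R" and J: "ideal J R"
    and zd: "\<And>y. y \<in> J \<Longrightarrow> \<exists>b\<in>carrier R - I. y \<otimes> b \<in> I"
  shows "\<exists>b\<in>carrier R - I. \<forall>y\<in>J. y \<otimes> b \<in> I"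
proof -
  have "\<exists>P\<in>max_colons I. J \<subseteq> P"
  proof (rule ccontr)
    assume no: "\<not> ?thesis"
    have "\<exists>y\<in>J. \<forall>Q\<in>max_colons I. y \<notin> Q"
    proof (rule prime_avoidance[OF max_colons_finite[OF I] _ _ J])
      show "\<And>Q. Q \<in> max_colons I \<Longrightarrow> primeideal Q R \<and> \<not> J \<subseteq> Q" using max_colons_prime[OF I] no by blast
      show "\<And>P Q. P \<in> max_colons I \<Longrightarrow> Q \<in> max_colons I \<Longrightarrow> Q \<subseteq> P \<Longrightarrow> Q = P" by (auto simp: max_colons_def)
    qed
    then obtain y where y: "y \<in> J" "\<And>Q. Q \<in> max_colons I \<Longrightarrow> y \<notin> Q" by blast
    obtain b where b: "b \<in> carrier R - I" "y \<otimes> b \<in> I" using zd[OF y(1)] by blast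
    define A where "A = {colon R I c | c. c \<in> carrier R - I \<and> colon R I b \<subseteq> colon R I c}"
    have "\<exists>M\<in>A. \<forall>K\<in>A. M \<subseteq> K \<longrightarrow> K = M"
      by (rule ideal_maximal_element) (use b colon_ideal[OF I] in \<open>auto simp: A_def\<close>)
    then obtain M where M: "M \<in> A" "\<And>K. K \<in> A \<Longrightarrow> M \<subseteq> K \<Longrightarrow> K = M" by blast
    obtain c where c: "c \<in> carrier R - I" "colon R I b \<subseteq> colon R I c" "M = colon R I c" using M(1) by (auto simp: A_def)
    have "M \<in> max_colons I" unfolding max_colons_def
    proof (intro CollectI conjI ballI impI)
      show "\<exists>b\<in>carrier R - I. M = colon R I b" using c by blast
      fix e assume e: "e \<in> carrier R - I" "M \<subseteq> colon R I e"
      then have "colon R I e \<in> A" using c by (auto simp: A_def)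
      then show "colon R I e = M" using M(2) e(2) by blast
    qed
    moreover have "y \<in> M" using b c ideal_closed(2)[OF J y(1)] by (auto simp: colon_def)
    ultimately show False using y(2) by blast
  qed
  then obtain P where P: "P \<in> max_colons I" "J \<subseteq> P" by blast
  obtain b where b: "b \<in> carrier R - I" "P = colon R I b" using P(1) unfolding max_colons_def by blast
  have "y \<otimes> b \<in> I" if "y \<in> J" for y using that P(2) b(2) by (auto simp: colon_def)
  then show ?thesis using b(1) by blast
qed

end

locale local_domain = domain A for A (structure) +
  fixes n
  assumes maximal: "maximalideal n A" and unique: "maximalideal n' A \<Longrightarrow> n' = n"
begin

lemma max_ideal_eq: "max_ideal A = n"
  unfolding max_ideal_def using maximal unique by (intro the_equality)

lemma Idl_subset_n:
  assumes "U \<subseteq> n" shows "Idl U \<noteq> carrier A"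
proof -
  have "Idl U \<subseteq> n" by (rule genideal_minimal[OF maximalideal.axioms(1)[OF maximal] assms])
  moreover have "n \<subset> carrier A"
    using maximalideal.I_notcarr[OF maximal] ideal_closed(2)[OF maximalideal.axioms(1)[OF maximal]] by blast
  ultimately show ?thesis by blast
qed

lemma n_closed: "x \<in> n \<Longrightarrow> x \<in> carrier A"
  using ideal_closed(2)[OF maximalideal.axioms(1)[OF maximal]] .

lemma depth_ge_length: "set xs \<subseteq> n \<Longrightarrow> regular_sequence A xs \<Longrightarrow> enat (length xs) \<le> depth A"
  unfolding depth_def max_ideal_eq by (intro Sup_upper) blast

lemma depth_ge_1:
  assumes x: "x \<in> n" "x \<noteq> \<zero>" shows "1 \<le> depth A"
proof -
  have "regular_sequence A [x]"
    using x n_closed[OF x(1)] Idl_subset_n[of "{x}"] integral[of x] by (auto simp: regular_sequence_def genideal_empty)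
  from depth_ge_length[OF _ this] x show ?thesis by (simp add: one_enat_def)
qed

lemma depth_ge_2:
  assumes x: "x \<in> n" "x \<noteq> \<zero>" and y: "y \<in> n"
    and reg: "\<And>a. a \<in> carrier A \<Longrightarrow> y \<otimes> a \<in> PIdl x \<Longrightarrow> a \<in> PIdl x"
  shows "2 \<le> depth A"
proof -
  have c: "x \<in> carrier A" "y \<in> carrier A" using n_closed x y by auto
  have "\<forall>a\<in>carrier A. [x, y] ! i \<otimes> a \<in> Idl (set (take i [x, y])) \<longrightarrow> a \<in> Idl (set (take i [x, y]))"
    if i: "i < length [x, y]" for i
  proof -
    consider "i = 0" | "i = 1" using i by fastforce
    then show ?thesis
    proof cases
      case 1
      then show ?thesis using integral[of x] x(2) c(1) by (auto simp: genideal_empty)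
    next
      case 2
      then show ?thesis using reg cgenideal_eq_genideal[OF c(1)] by auto
    qed
  qed
  then have "regular_sequence A [x, y]"
    unfolding regular_sequence_def using c Idl_subset_n[of "set [x, y]"] x(1) y by auto
  from depth_ge_length[OF _ this] x(1) y show ?thesis by (simp add: numeral_eq_enat numeral_2_eq_2)
qed

end

lemma chain_length_ge_1E:
  assumes "1 \<le> chain_length F"
  obtains a b where "a \<in> F" "b \<in> F" "a \<subset> b"
proof -
  obtain c where "\<forall>i\<le>1. c i \<in> F" "\<forall>i<1. c i \<subset> c (Suc i)"
    using chain_length_ge_imp[of 1 F] assms by (auto simp: one_enat_def)
  then show ?thesis using that[of "c 0" "c 1"] by simp
qed

lemma chain_length_ge_2E:
  assumes "2 \<le> chain_length F"
  obtains a b c where "a \<in> F" "b \<in> F" "c \<in> F" "a \<subset> b" "b \<subset> c"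
proof -
  obtain c where c: "\<forall>i\<le>2. c i \<in> F" "\<forall>i<2. c i \<subset> c (Suc i)"
    using chain_length_ge_imp[of 2 F] assms by (auto simp: numeral_eq_enat)
  have "c 0 \<subset> c 1" "c 1 \<subset> c 2" using c(2)[rule_format, of 0] c(2)[rule_format, of 1] by (simp_all add: numeral_2_eq_2)
  then show ?thesis using that[of "c 0" "c 1" "c 2"] c(1) by simp
qed

lemma min_2_le_enatI:
  fixes d e :: enat
  assumes "1 \<le> d \<Longrightarrow> 1 \<le> e" "2 \<le> d \<Longrightarrow> 2 \<le> e"
  shows "min 2 d \<le> e"
proof (cases "2 \<le> d")
  case True
  then show ?thesis using assms(2) by (simp add: min_def)
next
  case False
  then have "d < 2" by simp
  then obtain k where k: "d = enat k" "k < 2" by (cases d) (auto simp: numeral_eq_enat)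
  then have "k = 0 \<or> k = 1" by auto
  then show ?thesis
  proof
    assume "k = 0" then show ?thesis using k by (simp add: zero_enat_def[symmetric])
  next
    assume "k = 1"
    then have "d = 1" using k by (simp add: one_enat_def)
    then show ?thesis using assms(1) by (simp add: min.coboundedI2)
  qed
qed

context domain
begin

lemma localization_at_prime_locale:
  assumes p: "primeideal p R"
  shows "domain_localization R (carrier R - p)"
proof
  interpret p: primeideal p R by (rule p)
  show "carrier R - p \<subseteq> carrier R" by blast
  show "\<one> \<in> carrier R - p" using primeideal_one_notin[OF p] by simp
  show "s \<otimes> t \<in> carrier R - p" if "s \<in> carrier R - p" "t \<in> carrier R - p" for s t
    by (rule primeideal_prod_notin[OF p that])
  show "\<zero> \<notin> carrier R - p" by simp
qed

context
  fixes p assumes p: "primeideal p R"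
begin

interpretation p: primeideal p R by (rule p)
interpretation D: domain_localization R "carrier R - p" by (rule localization_at_prime_locale[OF p])

abbreviation Rp where "Rp \<equiv> localization_at_prime R p"

lemma Rp_eq: "Rp = D.L" by (simp add: localization_at_prime_def)

definition pRp where "pRp = {D.fr a s | a s. a \<in> p \<and> s \<in> carrier R - p}"

lemma fr_in_pRp: "a \<in> carrier R \<Longrightarrow> s \<in> carrier R - p \<Longrightarrow> D.fr a s \<in> pRp \<longleftrightarrow> a \<in> p"
proof
  assume a: "a \<in> carrier R" "s \<in> carrier R - p" and "D.fr a s \<in> pRp"
  then obtain b t where b: "b \<in> p" "t \<in> carrier R - p" "D.fr a s = D.fr b t" by (auto simp: pRp_def)
  have bc: "b \<in> carrier R" using b(1) by (rule p.Icarr)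
  have "t \<otimes> a = s \<otimes> b" using b(3) D.fr_eq_iff[OF a bc b(2)] by simp
  also have "\<dots> \<in> p" using b(1) a(2) by (simp add: p.I_l_closed)
  finally show "a \<in> p" using p.I_prime[of t a] a b(2) by blast
qed (auto simp: pRp_def)

lemma Rp_local: "local_domain Rp pRp"
proof -
  interpret L: domain D.L by (rule D.L_domain)
  have one: "\<one> \<in> carrier R - p" using D.S_one .
  have ideal: "ideal pRp D.L"
  proof (rule L.idealI_cring)
    show "pRp \<subseteq> carrier D.L" using p.Icarr by (auto simp: pRp_def)
    show "\<zero>\<^bsub>D.L\<^esub> \<in> pRp" unfolding D.L_zero using fr_in_pRp[OF zero_closed one] p.zero_closed by simp
    fix x y assume "x \<in> pRp"
    then obtain a s where x: "a \<in> p" "s \<in> carrier R - p" "x = D.fr a s" by (auto simp: pRp_def)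
    have ac: "a \<in> carrier R" using x(1) by (rule p.Icarr)
    { assume "y \<in> pRp"
      then obtain b t where y: "b \<in> p" "t \<in> carrier R - p" "y = D.fr b t" by (auto simp: pRp_def)
      have bc: "b \<in> carrier R" using y(1) by (rule p.Icarr)
      have "t \<otimes> a \<oplus> s \<otimes> b \<in> p" using x y by (auto intro!: p.a_closed p.I_l_closed)
      then show "x \<oplus>\<^bsub>D.L\<^esub> y \<in> pRp" unfolding x(3) y(3) D.fr_add[OF ac x(2) bc y(2)]
        using D.S_mult[OF x(2) y(2)] by (auto simp: pRp_def) }
    { assume "y \<in> carrier D.L"
      then obtain b t where y: "b \<in> carrier R" "t \<in> carrier R - p" "y = D.fr b t" by (rule D.L_carrierE)
      have "b \<otimes> a \<in> p" using x y by (auto intro!: p.I_l_closed)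
      then show "y \<otimes>\<^bsub>D.L\<^esub> x \<in> pRp" unfolding x(3) y(3) D.fr_mult[OF y(1,2) ac x(2)]
        using D.S_mult[OF y(2) x(2)] by (auto simp: pRp_def) }
  qed
  have sub: "J \<subseteq> pRp" if J: "ideal J D.L" "J \<noteq> carrier D.L" for J
  proof
    fix x assume x: "x \<in> J"
    then have xc: "x \<in> carrier D.L" using L.ideal_closed(2)[OF J(1)] by blast
    then obtain a s where a: "a \<in> carrier R" "s \<in> carrier R - p" "x = D.fr a s" by (rule D.L_carrierE)
    show "x \<in> pRp"
    proof (rule ccontr)
      assume "x \<notin> pRp"
      then have as: "a \<in> carrier R - p" using fr_in_pRp[OF a(1,2)] a by simp
      have sc: "s \<in> carrier R" using a(2) by simp
      have "x \<otimes>\<^bsub>D.L\<^esub> D.fr s a = \<one>\<^bsub>D.L\<^esub>"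
        unfolding a(3) D.fr_mult[OF a(1,2) sc as] D.L_one
        using D.fr_eq_iff[OF _ D.S_mult[OF a(2) as] one_closed one, of "a \<otimes> s"] a(1) sc by (simp add: m_comm)
      then have "\<one>\<^bsub>D.L\<^esub> \<in> J" using L.ideal_closed(5)[OF J(1) x D.fr_closed[OF sc as]] by simp
      then show False using J(2) ideal.one_imp_carrier[OF J(1)] by blast
    qed
  qed
  have ne: "pRp \<noteq> carrier D.L"
    using fr_in_pRp[OF one_closed one] primeideal_one_notin[OF p] D.fr_closed[OF one_closed one] by blast
  have max: "maximalideal pRp D.L"
  proof (rule maximalidealI[OF ideal])
    show "carrier D.L \<noteq> pRp" using ne by blast
    show "J = pRp \<or> J = carrier D.L" if "ideal J D.L" "pRp \<subseteq> J" "J \<subseteq> carrier D.L" for J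
      using sub[OF that(1)] that(2) by blast
  qed
  have uni: "J = pRp" if J: "maximalideal J D.L" for J
  proof -
    interpret J: maximalideal J D.L by (rule J)
    have "J \<subseteq> pRp" using sub[OF J.is_ideal] J.I_notcarr by blast
    then show ?thesis using J.I_maximal[OF ideal] ne L.ideal_closed(2)[OF ideal] by blast
  qed
  show ?thesis unfolding Rp_eq using max uni
    by (intro local_domain.intro local_domain_axioms.intro L.domain_axioms)
qed

lemma depth_localization_ge_1:
  assumes x: "x \<in> p" "x \<noteq> \<zero>" shows "1 \<le> depth Rp"
proof -
  interpret L: local_domain Rp pRp by (rule Rp_local)
  have xc: "x \<in> carrier R" using x(1) by (rule p.Icarr)
  show ?thesis
    by (rule L.depth_ge_1[of "D.fr x \<one>"])
       (use x xc D.S_one fr_in_pRp[OF xc D.S_one] D.fr_zero_iff[OF xc D.S_one] in \<open>auto simp: Rp_eq\<close>)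
qed

lemma depth_localization_ge_2:
  assumes x: "x \<in> p" "x \<noteq> \<zero>" and y: "y \<in> p"
    and reg: "\<And>a s. a \<in> carrier R \<Longrightarrow> s \<in> carrier R - p \<Longrightarrow> s \<otimes> (y \<otimes> a) \<in> PIdl x \<Longrightarrow> \<exists>t\<in>carrier R - p. t \<otimes> a \<in> PIdl x"
  shows "2 \<le> depth Rp"
proof -
  interpret L: local_domain Rp pRp by (rule Rp_local)
  have c: "x \<in> carrier R" "y \<in> carrier R" using p.Icarr x y by blast+
  note one = D.S_one
  show ?thesis
  proof (rule L.depth_ge_2[of "D.fr x \<one>" "D.fr y \<one>"])
    show "D.fr x \<one> \<in> pRp" "D.fr y \<one> \<in> pRp" using fr_in_pRp[OF _ one] c x y by auto
    show "D.fr x \<one> \<noteq> \<zero>\<^bsub>Rp\<^esub>" unfolding Rp_eq using D.fr_zero_iff[OF c(1) one] x(2) by simp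
    fix u assume u: "u \<in> carrier Rp" "D.fr y \<one> \<otimes>\<^bsub>Rp\<^esub> u \<in> PIdl\<^bsub>Rp\<^esub> (D.fr x \<one>)"
    obtain a s where a: "a \<in> carrier R" "s \<in> carrier R - p" "u = D.fr a s"
      using u(1) unfolding Rp_eq by (rule D.L_carrierE)
    obtain v where v: "v \<in> carrier D.L" "D.fr y \<one> \<otimes>\<^bsub>D.L\<^esub> u = v \<otimes>\<^bsub>D.L\<^esub> D.fr x \<one>"
      using u(2) unfolding Rp_eq cgenideal_def by blast
    obtain e t where e: "e \<in> carrier R" "t \<in> carrier R - p" "v = D.fr e t" using v(1) by (rule D.L_carrierE)
    have sc: "s \<in> carrier R" "t \<in> carrier R" using a e by auto
    have "D.fr (y \<otimes> a) s = D.fr (e \<otimes> x) t"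
      using v(2) unfolding a(3) e(3) D.fr_mult[OF c(2) one a(1,2)] D.fr_mult[OF e(1,2) c(1) one] using sc by simp
    then have "t \<otimes> (y \<otimes> a) = s \<otimes> (e \<otimes> x)" using D.fr_eq_iff[of "y \<otimes> a" s "e \<otimes> x" t] a(1,2) e(1,2) c by simp
    also have "\<dots> = (s \<otimes> e) \<otimes> x" using sc e c by (simp add: m_assoc)
    finally have "t \<otimes> (y \<otimes> a) \<in> PIdl x" using sc e(1) unfolding cgenideal_def by blast
    from reg[OF a(1) e(2) this] obtain w where w: "w \<in> carrier R - p" "w \<otimes> a \<in> PIdl x" by blast
    then obtain k where k: "k \<in> carrier R" "w \<otimes> a = k \<otimes> x" by (auto simp: cgenideal_def)
    have ws: "w \<otimes> s \<in> carrier R - p" by (rule D.S_mult[OF w(1) a(2)])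
    have wc: "w \<in> carrier R" using w by simp
    have "u = D.fr k (w \<otimes> s) \<otimes>\<^bsub>D.L\<^esub> D.fr x \<one>"
    proof -
      have "D.fr k (w \<otimes> s) \<otimes>\<^bsub>D.L\<^esub> D.fr x \<one> = D.fr (w \<otimes> a) (w \<otimes> s)"
        unfolding D.fr_mult[OF k(1) ws c(1) one] k(2) using wc sc by simp
      also have "\<dots> = D.fr a s"
        using D.fr_eq_iff[OF _ ws a(1,2), of "w \<otimes> a"] wc a(1) sc by (simp add: m_ac)
      finally show ?thesis using a(3) by simp
    qed
    then show "u \<in> PIdl\<^bsub>Rp\<^esub> (D.fr x \<one>)" unfolding Rp_eq cgenideal_def using D.fr_closed[OF k(1) ws] by blast
  qed
qed

end

end

context noetherian_domain
begin

text \<open>If some \<open>y \<in> p\<close> is a nonzerodivisor modulo \<open>x\<close> in the localization, then \<open>x, y\<close> is a regular sequence there. Otherwise \<open>p\<close> kills one element \<open>b\<close>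
  modulo the contraction \<open>I\<close> of \<open>xR\<^sub>p\<close>; as \<open>p\<close> is finitely generated, a multiple \<open>s b\<close> with \<open>s\<close> outside \<open>p\<close> is
  killed by \<open>p\<close> already modulo \<open>xR\<close>.\<close>

lemma localization_depth_2_or_colon:
  assumes p: "primeideal p R" and x: "x \<in> p" "x \<noteq> \<zero>"
  shows "2 \<le> depth (localization_at_prime R p) \<or> (\<exists>b\<in>carrier R. colon R (PIdl x) b = p)"
proof -
  interpret p: primeideal p R by (rule p)
  have xc: "x \<in> carrier R" using x(1) by (rule p.Icarr)
  have iX: "ideal (PIdl x) R" by (rule cgenideal_ideal[OF xc])
  note cX = ideal_closed[OF iX]
  have Xp: "PIdl x \<subseteq> p" by (rule cgenideal_minimal[OF p.is_ideal x(1)])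
  have one: "\<one> \<in> carrier R - p" using primeideal_one_notin[OF p] by simp
  define I where "I = {r \<in> carrier R. \<exists>s\<in>carrier R - p. s \<otimes> r \<in> PIdl x}"
  have iI: "ideal I R"
  proof (rule idealI_cring)
    show "I \<subseteq> carrier R" by (auto simp: I_def)
    show "\<zero> \<in> I" using one cX(1) by (auto simp: I_def intro!: bexI[of _ \<one>])
    fix a b assume "a \<in> I"
    then obtain s where a: "a \<in> carrier R" "s \<in> carrier R - p" "s \<otimes> a \<in> PIdl x" by (auto simp: I_def)
    { assume "b \<in> I"
      then obtain t where b: "b \<in> carrier R" "t \<in> carrier R - p" "t \<otimes> b \<in> PIdl x" by (auto simp: I_def)
      have "t \<otimes> (s \<otimes> a) \<oplus> s \<otimes> (t \<otimes> b) \<in> PIdl x"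
        using a b cX(3,6) by simp
      moreover have "t \<otimes> (s \<otimes> a) \<oplus> s \<otimes> (t \<otimes> b) = (s \<otimes> t) \<otimes> (a \<oplus> b)"
        using a b by (simp add: r_distr m_assoc m_lcomm[of t s a])
      ultimately have "(s \<otimes> t) \<otimes> (a \<oplus> b) \<in> PIdl x" by simp
      then show "a \<oplus> b \<in> I" unfolding I_def using primeideal_prod_notin[OF p a(2) b(2)] a(1) b(1) by blast }
    { assume b: "b \<in> carrier R"
      have "s \<otimes> (b \<otimes> a) = b \<otimes> (s \<otimes> a)" using a b by (simp add: m_lcomm)
      then have "s \<otimes> (b \<otimes> a) \<in> PIdl x" using cX(6)[OF a(3) b] by simp
      then show "b \<otimes> a \<in> I" unfolding I_def using a b by blast }
  qed
  show ?thesis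
  proof (cases "\<exists>y\<in>p. \<forall>b\<in>carrier R - I. y \<otimes> b \<notin> I")
    case True
    then obtain y where y: "y \<in> p" "\<And>b. b \<in> carrier R - I \<Longrightarrow> y \<otimes> b \<notin> I" by blast
    have yc: "y \<in> carrier R" using y(1) by (rule p.Icarr)
    have "2 \<le> depth (localization_at_prime R p)"
    proof (rule depth_localization_ge_2[OF p x y(1)])
      fix a s assume a: "a \<in> carrier R" "s \<in> carrier R - p" "s \<otimes> (y \<otimes> a) \<in> PIdl x"
      then have "y \<otimes> a \<in> I" unfolding I_def using yc by blast
      then have "a \<in> I" using y(2)[of a] a(1) by blast
      then show "\<exists>t\<in>carrier R - p. t \<otimes> a \<in> PIdl x" by (simp add: I_def)
    qed
    then show ?thesis ..
  next
    case False
    then have "\<exists>b\<in>carrier R - I. \<forall>y\<in>p. y \<otimes> b \<in> I"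
      by (intro zero_divisor_ideal_annihilator[OF iI p.is_ideal]) blast
    then obtain b where b: "b \<in> carrier R" "b \<notin> I" "\<And>y. y \<in> p \<Longrightarrow> y \<otimes> b \<in> I" by blast
    obtain F where F: "F \<subseteq> carrier R" "finite F" "p = Idl F" using finetely_gen[OF p.is_ideal] by auto
    have common: "\<exists>s\<in>carrier R - p. \<forall>f\<in>F'. f \<otimes> (s \<otimes> b) \<in> PIdl x" if "finite F'" "F' \<subseteq> p" for F'
      using that
    proof (induction F')
      case empty
      then show ?case using one by blast
    next
      case (insert f F')
      then obtain s where s: "s \<in> carrier R - p" "\<And>f. f \<in> F' \<Longrightarrow> f \<otimes> (s \<otimes> b) \<in> PIdl x" by blast
      have "f \<otimes> b \<in> I" using b(3) insert.prems by blast
      then obtain t where t: "t \<in> carrier R - p" "t \<otimes> (f \<otimes> b) \<in> PIdl x" by (auto simp: I_def)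
      have fc: "g \<in> carrier R" if "g \<in> insert f F'" for g using insert.prems that p.Icarr by blast
      have "g \<otimes> ((t \<otimes> s) \<otimes> b) \<in> PIdl x" if g: "g \<in> insert f F'" for g
      proof (cases "g = f")
        case True
        have "g \<otimes> ((t \<otimes> s) \<otimes> b) = s \<otimes> (t \<otimes> (f \<otimes> b))" unfolding True using fc s t b(1) by (simp add: m_ac)
        then show ?thesis using cX(6)[OF t(2)] s(1) by simp
      next
        case False
        have "g \<otimes> ((t \<otimes> s) \<otimes> b) = t \<otimes> (g \<otimes> (s \<otimes> b))" using fc[OF g] s t b(1) by (simp add: m_ac)
        then show ?thesis using cX(6)[OF s(2)] t(1) False g by simp
      qed
      then show ?case using primeideal_prod_notin[OF p t(1) s(1)] by blast
    qed
    have "F \<subseteq> p" unfolding F(3) by (rule genideal_self[OF F(1)])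
    then obtain s where s: "s \<in> carrier R - p" "\<And>f. f \<in> F \<Longrightarrow> f \<otimes> (s \<otimes> b) \<in> PIdl x"
      using common[OF F(2)] by blast
    have sb: "s \<otimes> b \<in> carrier R" using s b by simp
    have iC: "ideal (colon R (PIdl x) (s \<otimes> b)) R" by (rule colon_ideal[OF iX sb])
    have "F \<subseteq> colon R (PIdl x) (s \<otimes> b)" using s(2) F(1) by (auto simp: colon_def)
    then have 1: "p \<subseteq> colon R (PIdl x) (s \<otimes> b)" unfolding F(3) by (rule genideal_minimal[OF iC])
    have 2: "r \<in> p" if r: "r \<in> colon R (PIdl x) (s \<otimes> b)" for r
    proof (rule ccontr)
      assume "r \<notin> p"
      then have rc: "r \<in> carrier R - p" using r by (simp add: colon_def)
      have "(r \<otimes> s) \<otimes> b \<in> PIdl x" using r rc s(1) b(1) by (simp add: colon_def m_assoc)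
      then have "b \<in> I" unfolding I_def using primeideal_prod_notin[OF p rc s(1)] b(1) by blast
      then show False using b(2) by simp
    qed
    have "colon R (PIdl x) (s \<otimes> b) = p" using 1 2 by blast
    then show ?thesis using sb by blast
  qed
qed

end

context noetherian_local_domain
begin

lemma local_domain: "local_domain R m"
  by (intro local_domain.intro local_domain_axioms.intro domain_axioms maximal unique)

text \<open>The same alternative for \<open>R\<close> itself, whose maximal ideal needs no denominators.\<close>

lemma depth_2_or_colon:
  assumes x: "x \<in> m" "x \<noteq> \<zero>"
  shows "2 \<le> depth R \<or> (\<exists>b\<in>carrier R. colon R (PIdl x) b = m)"
proof -
  interpret A: local_domain R m by (rule local_domain)
  have xc: "x \<in> carrier R" using x(1) by simp
  have iX: "ideal (PIdl x) R" by (rule cgenideal_ideal[OF xc])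
  show ?thesis
  proof (cases "\<exists>y\<in>m. \<forall>b\<in>carrier R - PIdl x. y \<otimes> b \<notin> PIdl x")
    case True
    then obtain y where y: "y \<in> m" "\<And>b. b \<in> carrier R - PIdl x \<Longrightarrow> y \<otimes> b \<notin> PIdl x" by blast
    have "2 \<le> depth R" by (rule A.depth_ge_2[OF x y(1)]) (use y(2) in blast)
    then show ?thesis ..
  next
    case False
    then have "\<exists>b\<in>carrier R - PIdl x. \<forall>y\<in>m. y \<otimes> b \<in> PIdl x"
      by (intro zero_divisor_ideal_annihilator[OF iX m_ideal]) blast
    then obtain b where b: "b \<in> carrier R" "b \<notin> PIdl x" "\<And>y. y \<in> m \<Longrightarrow> y \<otimes> b \<in> PIdl x" by blast
    have "\<one> \<notin> colon R (PIdl x) b" using b(1,2) by (simp add: colon_def)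
    then have "colon R (PIdl x) b \<subseteq> m" using proper_ideal_subset_m[OF colon_ideal[OF iX b(1)]] by blast
    moreover have "m \<subseteq> colon R (PIdl x) b" using b(3) by (auto simp: colon_def)
    ultimately show ?thesis using b(1) by blast
  qed
qed

end

section \<open>The depth of a complete weakly normal domain\<close>

context complete_root_closed_domain
begin

text \<open>Multiplication by \<open>z = b/x\<close> sends \<open>r \<in> m\<close> to \<open>c r \<in> R\<close>. Either all these values lie in \<open>m\<close>, and then \<open>z \<in> R\<close> by the previous
  section, so that 1 would lie in \<open>(xR : b)\<close>; or some \<open>c r\<close> is a unit, and then \<open>m\<close> is generated by \<open>r\<close>. A prime \<open>q\<close> strictly
  below a principal \<open>m\<close> satisfies \<open>q = r q\<close>, hence lies in all powers of \<open>m\<close> and is zero.\<close>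

lemma no_colon_m:
  assumes q: "primeideal q R" "q \<noteq> {\<zero>}" "q \<noteq> m" and x: "x \<in> m" "x \<noteq> \<zero>" and b: "b \<in> carrier R"
  shows "colon R (PIdl x) b \<noteq> m"
proof
  assume col: "colon R (PIdl x) b = m"
  have xc: "x \<in> carrier R" using x(1) by simp
  have "\<exists>c. c \<in> carrier R \<and> r \<otimes> b = c \<otimes> x" if r: "r \<in> m" for r
  proof -
    have "r \<in> colon R (PIdl x) b" using r col by simp
    then show ?thesis by (auto simp: colon_def cgenideal_def)
  qed
  then obtain c where c: "\<And>r. r \<in> m \<Longrightarrow> c r \<in> carrier R" "\<And>r. r \<in> m \<Longrightarrow> r \<otimes> b = c r \<otimes> x" by metis
  show False
  proof (cases "\<forall>r\<in>m. c r \<in> m")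
    case True
    have ix: "\<iota> x \<in> carrier QR" "\<iota> x \<noteq> \<zero>\<^bsub>QR\<^esub>" using x xc \<iota>_inj[of x \<zero>] by auto
    then have u: "\<iota> x \<in> Units QR" using Q.field_Units by simp
    define z where "z = \<iota> b \<otimes>\<^bsub>QR\<^esub> inv\<^bsub>QR\<^esub> (\<iota> x)"
    have ic: "inv\<^bsub>QR\<^esub> (\<iota> x) \<in> carrier QR" using Q.Units_inv_closed[OF u] .
    have zc: "z \<in> carrier QR" using ic b by (simp add: z_def)
    have zx: "z \<otimes>\<^bsub>QR\<^esub> \<iota> x = \<iota> b" unfolding z_def using b ic ix Q.Units_l_inv[OF u] by (simp add: Q.m_assoc)
    have "\<iota> r \<otimes>\<^bsub>QR\<^esub> z = \<iota> (c r)" if r: "r \<in> m" for r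
    proof -
      have "(\<iota> r \<otimes>\<^bsub>QR\<^esub> z) \<otimes>\<^bsub>QR\<^esub> \<iota> x = \<iota> (r \<otimes> b)" using r zc ix b zx by (simp add: Q.m_assoc)
      also have "\<dots> = \<iota> (c r) \<otimes>\<^bsub>QR\<^esub> \<iota> x" unfolding c(2)[OF r] using c(1)[OF r] xc by simp
      finally show ?thesis using Q.m_rcancel[OF ix(2,1), of "\<iota> r \<otimes>\<^bsub>QR\<^esub> z" "\<iota> (c r)"] r c(1)[OF r] zc by simp
    qed
    then have "z \<in> S" using zc True by (auto simp: S_def M_def)
    moreover have "m \<noteq> {\<zero>}" using x by blast
    ultimately have "z \<in> \<iota> ` carrier R" using S_subset_image by blast
    then obtain v where v: "v \<in> carrier R" "z = \<iota> v" by blast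
    have "\<iota> b = \<iota> (v \<otimes> x)" using zx v xc by simp
    then have "b = v \<otimes> x" using \<iota>_inj b v(1) xc by simp
    then have "\<one> \<in> colon R (PIdl x) b" using b v(1) by (auto simp: colon_def cgenideal_def)
    then show False using col primeideal_one_notin[OF m_prime] by simp
  next
    case False
    then obtain r where r: "r \<in> m" "c r \<notin> m" by blast
    have u: "c r \<in> Units R" using unit_if_notin_m[OF c(1)[OF r(1)] r(2)] .
    have rc: "r \<in> carrier R" using r(1) by simp
    have b0: "b \<noteq> \<zero>"
    proof
      assume "b = \<zero>"
      then have "c r \<otimes> x = \<zero>" using c(2)[OF r(1)] rc by simp
      then have "c r = \<zero>" using integral[of "c r" x] c(1)[OF r(1)] xc x(2) by simp
      then show False using r(2) ideal_closed(1)[OF m_ideal] by simp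
    qed
    have xr: "x = inv (c r) \<otimes> (r \<otimes> b)"
      unfolding c(2)[OF r(1)] using u c(1)[OF r(1)] xc by (simp add: m_assoc[symmetric])
    have mr: "\<exists>w\<in>carrier R. y = w \<otimes> r" if y: "y \<in> m" for y
    proof -
      define w where "w = c y \<otimes> inv (c r)"
      have wc: "w \<in> carrier R" using c(1)[OF y] u by (simp add: w_def)
      have yc: "y \<in> carrier R" using y by simp
      have "y \<otimes> b = c y \<otimes> (inv (c r) \<otimes> (r \<otimes> b))" using c(2)[OF y] xr by simp
      also have "\<dots> = (w \<otimes> r) \<otimes> b" unfolding w_def using c(1)[OF y] u rc b by (simp add: m_assoc)
      finally have "y = w \<otimes> r" using m_rcancel[OF b0 b, of y "w \<otimes> r"] yc wc rc by simp
      then show ?thesis using wc by blast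
    qed
    have qm: "q \<subseteq> m" by (rule prime_subset_m[OF q(1)])
    interpret q: primeideal q R by (rule q(1))
    have rq: "r \<notin> q"
    proof
      assume "r \<in> q"
      then have "m \<subseteq> q" using mr q.I_l_closed by blast
      then show False using qm q(3) by blast
    qed
    have "q \<subseteq> ideal_power R m n" for n
    proof (induction n)
      case 0
      then show ?case unfolding ideal_power_simps using q.Icarr by blast
    next
      case (Suc n)
      show ?case
      proof
        fix y assume y: "y \<in> q"
        then obtain w where w: "w \<in> carrier R" "y = w \<otimes> r" using mr qm by blast
        then have "w \<in> q" using q.I_prime[OF w(1) rc] y rq by blast
        then have "w \<in> ideal_power R m n" using Suc by blast
        then show "y \<in> ideal_power R m (Suc n)" unfolding ideal_power_simps w(2) by (rule ideal_prod.prod[OF _ r(1)])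
      qed
    qed
    then have "y = \<zero>" if "y \<in> q" for y using ideal_powers_Inter[of y] q.Icarr[OF that] that by blast
    then show False using q(2) q.zero_closed by blast
  qed
qed

lemma zero_in_ideal_prime: "primeideal q R \<Longrightarrow> \<zero> \<in> q"
  using ideal_closed(1) primeideal.axioms(1) by blast

lemma two_chain_middle:
  assumes "2 \<le> chain_length F" "F \<subseteq> Spec R"
  obtains q where "primeideal q R" "q \<noteq> {\<zero>}" "q \<noteq> m"
proof -
  obtain a q e where c: "a \<in> F" "q \<in> F" "e \<in> F" "a \<subset> q" "q \<subset> e" using chain_length_ge_2E[OF assms(1)] by blast
  then have pr: "primeideal a R" "primeideal q R" "primeideal e R" using assms(2) by (auto simp: Spec_def)
  have "q \<noteq> {\<zero>}" using c(4) zero_in_ideal_prime[OF pr(1)] by blast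
  moreover have "q \<noteq> m" using c(5) prime_subset_m[OF pr(3)] by blast
  ultimately show ?thesis using that pr(2) by blast
qed

lemma one_chain_nonzero:
  assumes "1 \<le> chain_length F" "F \<subseteq> {q \<in> Spec R. q \<subseteq> P}"
  obtains x where "x \<in> P" "x \<noteq> \<zero>"
proof -
  obtain a q where c: "a \<in> F" "q \<in> F" "a \<subset> q" using chain_length_ge_1E[OF assms(1)] by blast
  then have "primeideal a R" "q \<subseteq> P" using assms(2) by (auto simp: Spec_def)
  then show ?thesis using c(3) zero_in_ideal_prime[of a] that by blast
qed

lemma depth_ge_min_2_krull_dim: "min 2 (krull_dim R) \<le> depth R"
proof (rule min_2_le_enatI)
  interpret A: local_domain R m by (rule local_domain)
  have sub: "Spec R \<subseteq> {q \<in> Spec R. q \<subseteq> m}" using prime_subset_m by (auto simp: Spec_def)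
  { assume "1 \<le> krull_dim R"
    then obtain x where "x \<in> m" "x \<noteq> \<zero>" using one_chain_nonzero[OF _ sub] unfolding krull_dim_def by blast
    then show "1 \<le> depth R" by (rule A.depth_ge_1) }
  { assume 2: "2 \<le> krull_dim R"
    then obtain q where q: "primeideal q R" "q \<noteq> {\<zero>}" "q \<noteq> m"
      using two_chain_middle[of "Spec R"] unfolding krull_dim_def by blast
    obtain x where x: "x \<in> q" "x \<noteq> \<zero>" using q(2) zero_in_ideal_prime[OF q(1)] by blast
    then have "x \<in> m" using prime_subset_m[OF q(1)] by blast
    then show "2 \<le> depth R" using depth_2_or_colon[OF _ x(2)] no_colon_m[OF q _ x(2)] by blast }
qed

text \<open>A prime of height at least two that violates the condition would be of the form \<open>(xR : b)\<close>, which is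
  excluded by weak normality if it is \<open>m\<close> and by local cohomology otherwise.\<close>

lemma serre_S2_of_resolution:
  assumes res: "injective_resolution R (ring_as_module R) e E d"
    and fin: "\<And>i. enat i < krull_dim R \<Longrightarrow> module_length R (local_cohomology R m E d i) < \<infinity>"
  shows "serre_S2 R"
  unfolding serre_S2_def
proof
  fix P assume "P \<in> Spec R"
  then have P: "primeideal P R" by (simp add: Spec_def)
  interpret E: resolved_domain R m e E d
    by (intro resolved_domain.intro resolved_domain_axioms.intro noetherian_local_domain_axioms res)
  show "min 2 (height R P) \<le> depth (localization_at_prime R P)"
  proof (rule min_2_le_enatI)
    { assume "1 \<le> height R P"
      then obtain x where "x \<in> P" "x \<noteq> \<zero>" using one_chain_nonzero[OF _ order_refl] unfolding height_def by blast
      then show "1 \<le> depth (localization_at_prime R P)" by (rule depth_localization_ge_1[OF P]) }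
    { assume 2: "2 \<le> height R P"
      then have "1 \<le> height R P" by (rule order_trans[rotated]) simp
      then obtain x where x: "x \<in> P" "x \<noteq> \<zero>" using one_chain_nonzero[OF _ order_refl] unfolding height_def by blast
      have "colon R (PIdl x) b \<noteq> P" if b: "b \<in> carrier R" for b
      proof (cases "P = m")
        case True
        obtain q where q: "primeideal q R" "q \<noteq> {\<zero>}" "q \<noteq> m"
          using two_chain_middle[of "{q \<in> Spec R. q \<subseteq> P}"] 2 unfolding height_def by blast
        show ?thesis using no_colon_m[OF q _ x(2) b] x(1) True by blast
      next
        case False
        show ?thesis by (rule E.no_colon_prime[OF fin P False _ x b]) (use 2 in \<open>simp_all add: numeral_eq_enat\<close>)
      qed
      then show "2 \<le> depth (localization_at_prime R P)" using localization_depth_2_or_colon[OF P x] by blast }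
  qed
qed

end

theorem corollary1p4:
  fixes R :: "('a, 'm) ring_scheme"
  assumes "noetherian_domain R"
    and "local_ring R"
    and "adically_complete R (max_ideal R)"
    and "Factorial_Ring.prime (ring_char R)"
    and "weakly_normal R"
    and "algebraically_closed (R Quot max_ideal R)"
  shows "depth R \<ge> min 2 (krull_dim R) \<and>
    (generalized_cohen_macaulay TYPE('c) R \<longrightarrow> serre_S2 R)"
proof -
  interpret R: noetherian_domain R by fact
  have ex: "\<exists>!m. maximalideal m R" using assms(2) by (simp add: local_ring_def)
  have m: "maximalideal (max_ideal R) R" unfolding max_ideal_def by (rule theI'[OF ex])
  have uniq: "m' = max_ideal R" if "maximalideal m' R" for m' using ex m that by blast
  interpret C: char_p_domain R "ring_char R"
    by (intro char_p_domain.intro char_p_domain_axioms.intro R.domain_axioms assms(4) ring_char_prime_imp)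
  interpret R: complete_root_closed_domain R "max_ideal R" "ring_char R"
  proof (intro complete_root_closed_domain.intro noetherian_local_domain.intro noetherian_local_domain_axioms.intro
      complete_root_closed_domain_axioms.intro R.noetherian_domain_axioms m uniq C.char_p_domain_axioms assms(3,6))
    show "z \<in> C.\<iota> ` carrier R" if "z \<in> carrier C.QR" "z [^]\<^bsub>C.QR\<^esub> (ring_char R ^ n) \<in> C.\<iota> ` carrier R" for z n
      by (rule C.weakly_normal_root_closed[OF assms(5) that])
  qed
  have "serre_S2 R" if "generalized_cohen_macaulay TYPE('c) R"
  proof -
    from that obtain e :: "'a \<Rightarrow> 'c" and E d where "injective_resolution R (ring_as_module R) e E d"
      "\<And>i. enat i < krull_dim R \<Longrightarrow> module_length R (local_cohomology R (max_ideal R) E d i) < \<infinity>"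
      unfolding generalized_cohen_macaulay_def by blast
    then show ?thesis by (rule R.serre_S2_of_resolution)
  qed
  then show ?thesis using R.depth_ge_min_2_krull_dim by blast
qed

end
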